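(* Let $d\ge 2$ be fixed. As $x\to\infty$, the number of primes $p\le x$ such that $p\equiv 1\pmod d$ and $(S_d(\mathbb{F}_p)-1)\setminus\{0\}$ can be written as $AB$ for some $A,B\subset\mathbb{F}_p^*$ with $|A|,|B|\ge 2$ is $o(\pi(x))$.
   Context: $S_d(\mathbb{F}_p)=\{x^d:x\in\mathbb{F}_p^*\}$, $S_d(\mathbb{F}_p)-1=\{s-1:s\in S_d(\mathbb{F}_p)\}$, $AB=\{ab:a\in A,b\in B\}$, and $\pi(x)$ is the number of primes up to $x$. *)

theory Defs
  imports "HOL-Number_Theory.Number_Theory" "HOL-Library.Landau_Symbols" "HOL-Algebra.Coset"
begin

abbreviation Fp :: "nat \<Rightarrow> int ring"
  where "Fp p \<equiv> residue_ring (int p)"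

abbreviation Fp_units :: "nat \<Rightarrow> int set"
  where "Fp_units p \<equiv> carrier (mult_of (Fp p))"

definition dth_powers :: "nat \<Rightarrow> nat \<Rightarrow> int set"
  where "dth_powers d p = {x [^]\<^bsub>Fp p\<^esub> d | x. x \<in> Fp_units p}"

definition shifted_dth_powers :: "nat \<Rightarrow> nat \<Rightarrow> int set"
  where "shifted_dth_powers d p = {s \<ominus>\<^bsub>Fp p\<^esub> \<one>\<^bsub>Fp p\<^esub> | s. s \<in> dth_powers d p}"

text \<open>
  The library's \<open>A <#>\<^bsub>R\<^esub> B\<close> is the product set
  \<open>{a \<otimes>\<^bsub>R\<^esub> b | a \<in> A, b \<in> B}\<close>.
\<close>

definition mult_decomposable :: "nat \<Rightarrow> int set \<Rightarrow> bool"
  where "mult_decomposable p X \<longleftrightarrow>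
    (\<exists>A B. A \<subseteq> Fp_units p \<and> B \<subseteq> Fp_units p \<and> card A \<ge> 2 \<and> card B \<ge> 2 \<and>
       X = A <#>\<^bsub>Fp p\<^esub> B)"

definition prime_pi :: "real \<Rightarrow> nat"
  where "prime_pi x = card {p :: nat. prime p \<and> real p \<le> x}"

end

theory Submission
  imports Defs "HOL-Computational_Algebra.Computational_Algebra"
    "HOL-Analysis.Harmonic_Numbers" "HOL-Real_Asymp.Real_Asymp"
begin

text \<open>
  Let \<open>p = n d + 1\<close> and suppose that \<open>A B\<close> is the set of all \<open>s - 1 \<noteq> 0\<close> with \<open>s\<close> in the group of \<open>d\<close>-th
  powers, which has order \<open>n\<close>. A polynomial of degree at most \<open>n + |A| - 1\<close> that vanishes to order \<open>|A|\<close> on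
  \<open>B \<union> {0}\<close> shows \<open>|A| |B| \<le> n - 1\<close>, so \<open>|A| |B| = n - 1\<close>. Stepanov's method shows that the conditions
  \<open>a x + 1 \<in> S\<^sub>d\<close> for boundedly many \<open>a\<close> are independent up to an error \<open>O(\<surd>p)\<close>; a fourth moment over
  \<open>A\<close> then gives \<open>|A|, |B| = O(\<surd>p)\<close>.

  Hence \<open>p - 1 - d = d a b\<close> with \<open>a\<close> and \<open>b\<close> within a constant factor of \<open>\<surd>p\<close>, and the argument of Erdos for
  the multiplication table applies. Let \<open>L\<close> be the sum of \<open>1/q\<close> over the primes \<open>q \<le> z\<close>. By Selberg's sieve,
  few \<open>p\<close> are such that \<open>p - 1 - d\<close> has at least \<open>3 L / 2\<close> prime factors up to \<open>z\<close>; for all other \<open>p\<close> one of \<open>a\<close> and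
  \<open>b\<close> has at most \<open>3 L / 4\<close> of them, and summing the sieve bound over such \<open>a\<close> shows that they are few as well.
  Both bounds tend to \<open>0\<close> relative to \<open>x / ln x\<close> as \<open>z\<close> grows, because \<open>L\<close> diverges.
\<close>

section \<open>Integer polynomials modulo a prime\<close>

text \<open>The moment must be the fourth. On \<open>B\<close> the sum of the centred indicators
  over \<open>A\<close> is at least |A| / 2; since |A| |B| is about p / d, in a second moment the
  contribution |B| |A|^2 of \<open>B\<close> has only the order of the diagonal term p |A|. In the
  fourth moment the contribution of \<open>B\<close> exceeds the diagonal by a factor of order |A|.
  An error O(\<surd>p) without a logarithm puts a and b into windows of bounded ratio. The threshold
  3 L / 2 lies between the roughly L prime factors up to z of a typical p - 1 - d and the roughly 2
  L of a typical product a b. Rankin's method controls both tails because 3/2 ln (3/2) > 1/2 and 3/4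
  ln (4/3) < 1/4. As z is fixed before x grows, the sieve is applied to finitely many fixed moduli
  in the first tail; in the second the modulus d a grows with x, so the sieve bound must be uniform
  in the modulus.\<close>

locale prime_modulus =
  fixes p :: nat
  assumes prime_p: "prime p"
begin

text \<open>As \<open>p\<close> is a variable, there is no type for the field with \<open>p\<close> elements; integer polynomials are
  considered modulo \<open>p\<close> instead.\<close>
definition null_poly :: "int poly \<Rightarrow> bool"
  where "null_poly f \<longleftrightarrow> [:int p:] dvd f"

lemma prime_int_p: "prime (int p)"
  using prime_p by simp

lemma prime_dvd_mult_int: "int p dvd a * b \<longleftrightarrow> int p dvd a \<or> int p dvd b"
  using prime_int_p prime_dvd_mult_iff by blast

lemma null_poly_mult_iff: "null_poly (f * g) \<longleftrightarrow> null_poly f \<or> null_poly g"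
proof -
  have "prime_elem [:int p:]"
    using prime_int_p by (intro lift_prime_elem_poly) simp
  then show ?thesis
    unfolding null_poly_def by (rule prime_elem_dvd_mult_iff)
qed

lemma null_poly_0 [simp]: "null_poly 0"
  by (simp add: null_poly_def)

lemma null_poly_add: "null_poly f \<Longrightarrow> null_poly g \<Longrightarrow> null_poly (f + g)"
  by (simp add: null_poly_def)

lemma null_poly_diff: "null_poly f \<Longrightarrow> null_poly g \<Longrightarrow> null_poly (f - g)"
  by (simp add: null_poly_def)

lemma null_poly_mult1: "null_poly f \<Longrightarrow> null_poly (f * g)"
  by (simp add: null_poly_mult_iff)

lemma null_poly_mult2: "null_poly f \<Longrightarrow> null_poly (g * f)"
  by (simp add: null_poly_mult_iff)

lemma null_poly_sum: "(\<And>i. i \<in> A \<Longrightarrow> null_poly (f i)) \<Longrightarrow> null_poly (sum f A)"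
  unfolding null_poly_def by (rule dvd_sum)

lemma null_poly_diff_iff: "null_poly (f - g) \<Longrightarrow> null_poly f \<longleftrightarrow> null_poly g"
  using null_poly_add[of "f - g" g] null_poly_diff[of f "f - g"] by auto

lemma null_poly_coeff: "null_poly f \<longleftrightarrow> (\<forall>i. int p dvd poly.coeff f i)"
  unfolding null_poly_def by (rule const_poly_dvd_iff)

lemma null_poly_poly: "null_poly f \<Longrightarrow> int p dvd poly f b"
  by (auto simp: null_poly_def dvd_def)

lemma null_poly_pderiv: "null_poly f \<Longrightarrow> null_poly (pderiv f)"
  by (simp add: null_poly_coeff coeff_pderiv)

lemma null_poly_higher_pderiv: "null_poly f \<Longrightarrow> null_poly ((pderiv ^^ k) f)"
  by (induction k) (auto simp: null_poly_pderiv)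

lemma null_poly_const [simp]: "null_poly [:c:] \<longleftrightarrow> int p dvd c"
  by (simp add: null_poly_def)

lemma not_null_poly_monic:
  assumes "lead_coeff f = 1"
  shows "\<not> null_poly f"
proof
  assume "null_poly f"
  then have "int p dvd 1"
    using assms unfolding null_poly_coeff by metis
  then show False
    using prime_int_p not_prime_unit by blast
qed

lemma not_null_poly_linear_power: "\<not> null_poly ([:b, 1:] ^ k)"
  by (rule not_null_poly_monic) (simp add: lead_coeff_power)

lemma null_poly_div_linear_power:
  "null_poly ([:b, 1:] ^ k * f) \<Longrightarrow> null_poly f"
  using not_null_poly_linear_power null_poly_mult_iff by blast

lemma null_poly_linear_factor:
  assumes "int p dvd poly f b"
  shows "null_poly (f - [:-b, 1:] * synthetic_div f b)"
proof -
  have "f - [:-b, 1:] * synthetic_div f b = [:poly f b:]"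
    using synthetic_div_correct'[of b f] by (metis add_diff_cancel_left')
  then show ?thesis
    using assms by simp
qed

section \<open>Orders of vanishing at a point modulo p, and their behaviour under derivation\<close>

lemma exact_order_exists:
  assumes "\<not> null_poly f"
  shows "\<exists>v g. null_poly (f - [:-b, 1:] ^ v * g) \<and> \<not> int p dvd poly g b"
  using assms
proof (induction "degree f" arbitrary: f rule: less_induct)
  case less
  show ?case
  proof (cases "int p dvd poly f b")
    case False
    then show ?thesis
      by (intro exI[of _ 0] exI[of _ f]) auto
  next
    case True
    let ?g = "synthetic_div f b"
    have fg: "null_poly (f - [:-b, 1:] * ?g)"
      by (rule null_poly_linear_factor[OF True])
    have "\<not> null_poly ?g"
      using less.prems null_poly_diff_iff[OF fg] null_poly_mult_iff by blast
    moreover have "degree f \<noteq> 0"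
    proof
      assume "degree f = 0"
      then obtain c where "f = [:c:]"
        by (auto elim: degree_eq_zeroE)
      then show False
        using True less.prems by simp
    qed
    ultimately obtain v h where vh: "null_poly (?g - [:-b, 1:] ^ v * h)" "\<not> int p dvd poly h b"
      using less.hyps[of ?g] by (auto simp: degree_synthetic_div)
    have "f - [:-b, 1:] ^ Suc v * h = (f - [:-b, 1:] * ?g) + [:-b, 1:] * (?g - [:-b, 1:] ^ v * h)"
      by (simp add: algebra_simps)
    then have "null_poly (f - [:-b, 1:] ^ Suc v * h)"
      using fg vh(1) by (metis null_poly_add null_poly_mult2)
    then show ?thesis
      using vh(2) by blast
  qed
qed

text \<open>The product rule gives the new cofactor L (v g + (x - b) g'), whose value at b is L(b) v
  g(b).\<close>

lemma exact_order_pderiv: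
  assumes f: "null_poly (f - [:-b, 1:] ^ v * g)" and g: "\<not> int p dvd poly g b"
    and v: "\<not> p dvd v" and L: "\<not> int p dvd poly L b"
  shows "\<exists>h. null_poly (L * pderiv f - [:-b, 1:] ^ (v - 1) * h) \<and> \<not> int p dvd poly h b"
proof -
  obtain w where w: "v = Suc w"
    using v by (cases v) auto
  define h where "h = L * (Polynomial.smult (of_nat v) g + [:-b, 1:] * pderiv g)"
  have "L * pderiv f - [:-b, 1:] ^ (v - 1) * h = L * pderiv (f - [:-b, 1:] ^ v * g)"
    unfolding h_def w pderiv_diff lemma_order_pderiv1 by (simp add: algebra_simps)
  then have "null_poly (L * pderiv f - [:-b, 1:] ^ (v - 1) * h)"
    using f by (simp add: null_poly_pderiv null_poly_mult2)
  moreover have "poly h b = poly L b * (int v * poly g b)"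
    by (simp add: h_def)
  then have "\<not> int p dvd poly h b"
    using g v L by (simp add: prime_dvd_mult_int)
  ultimately show ?thesis by blast
qed

lemma exact_order_not_null:
  assumes f: "null_poly (f - [:-b, 1:] ^ v * g)" and g: "\<not> int p dvd poly g b"
  shows "\<not> null_poly f"
  using assms null_poly_diff_iff[OF f] null_poly_div_linear_power null_poly_poly by blast

text \<open>As s \<le> v mod p, none of the orders v, v - 1, ..., v - s + 1 met on the way is
  divisible by p, so each derivation lowers the order by exactly one.\<close>

lemma exact_order_iterate_pderiv:
  assumes f: "null_poly (f - [:-b, 1:] ^ v * g)" and g: "\<not> int p dvd poly g b"
    and s: "s \<le> v mod p" and L: "\<not> int p dvd poly L b"
  shows "\<exists>h. null_poly (((\<lambda>h. L * pderiv h) ^^ s) f - [:-b, 1:] ^ (v - s) * h) \<and> \<not> int p dvd poly h b"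
  using s
proof (induction s)
  case 0
  then show ?case using f g by auto
next
  case (Suc s)
  then obtain h where h: "null_poly (((\<lambda>h. L * pderiv h) ^^ s) f - [:-b, 1:] ^ (v - s) * h)"
    "\<not> int p dvd poly h b"
    by auto
  have "\<not> p dvd (v - s)"
  proof
    assume "p dvd v - s"
    moreover have "s \<le> v"
      using Suc.prems mod_less_eq_dividend[of v p] by linarith
    ultimately have "v mod p = s mod p"
      using mod_eq_dvd_iff_nat by auto
    then show False
      using Suc.prems mod_less_eq_dividend[of s p] by linarith
  qed
  from exact_order_pderiv[OF h this L] show ?case
    by simp
qed

text \<open>The criterion for zeros of order M in Stepanov's method. If the exact order v were below
  M \<le> p, then v mod p = v, and v derivations would bring the order down to exactly 0, so the
  value at b would not vanish modulo p.\<close>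

lemma high_order_of_iterate_pderiv:
  assumes "\<not> null_poly f" and L: "\<not> int p dvd poly L b" and M: "M \<le> p"
    and van: "\<And>s. s < M \<Longrightarrow> int p dvd poly (((\<lambda>h. L * pderiv h) ^^ s) f) b"
  shows "\<exists>g. null_poly (f - [:-b, 1:] ^ M * g)"
proof -
  obtain v g where vg: "null_poly (f - [:-b, 1:] ^ v * g)" "\<not> int p dvd poly g b"
    using exact_order_exists[OF assms(1)] by blast
  have "M \<le> v"
  proof (rule ccontr)
    assume "\<not> M \<le> v"
    then have "v < M" "v \<le> v mod p"
      using M by auto
    from exact_order_iterate_pderiv[OF vg this(2) L] obtain h where
      h: "null_poly (((\<lambda>h. L * pderiv h) ^^ v) f - h)" "\<not> int p dvd poly h b"
      by auto
    from null_poly_poly[OF h(1), of b] van[OF \<open>v < M\<close>]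
    have "int p dvd poly h b"
      by (simp add: dvd_diff_right_iff)
    with h(2) show False by blast
  qed
  then have "[:-b, 1:] ^ v * g = [:-b, 1:] ^ M * ([:-b, 1:] ^ (v - M) * g)"
    by (simp flip: mult.assoc power_add)
  then show ?thesis
    using vg(1) by metis
qed

section \<open>Counting zeros with multiplicity\<close>

lemma null_poly_cancel_coprime_linear_power:
  assumes "null_poly (P * g - [:-b, 1:] ^ M * h)" and P: "\<not> int p dvd poly P b"
  shows "\<exists>k. null_poly (g - [:-b, 1:] ^ M * k)"
  using assms(1)
proof (induction M arbitrary: h)
  case 0
  then show ?case by (intro exI[of _ g]) simp
next
  case (Suc M)
  have "null_poly (P * g - [:-b, 1:] ^ M * ([:-b, 1:] * h))"
    using Suc.prems by (metis mult.assoc power_Suc2)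
  then obtain k where k: "null_poly (g - [:-b, 1:] ^ M * k)"
    using Suc.IH by blast
  have "[:-b, 1:] ^ M * (P * k - [:-b, 1:] * h) =
      (P * g - [:-b, 1:] ^ Suc M * h) - P * (g - [:-b, 1:] ^ M * k)"
    by (simp add: algebra_simps)
  then have "null_poly (P * k - [:-b, 1:] * h)"
    using Suc.prems k by (metis null_poly_diff null_poly_mult2 null_poly_div_linear_power)
  from null_poly_poly[OF this, of b] have "int p dvd poly k b"
    using P by (simp add: prime_dvd_mult_int)
  from null_poly_linear_factor[OF this]
  have kk: "null_poly (k - [:-b, 1:] * synthetic_div k b)" .
  have "g - [:-b, 1:] ^ Suc M * synthetic_div k b =
      (g - [:-b, 1:] ^ M * k) + [:-b, 1:] ^ M * (k - [:-b, 1:] * synthetic_div k b)"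
    by (simp add: algebra_simps)
  then have "null_poly (g - [:-b, 1:] ^ Suc M * synthetic_div k b)"
    using k kk by (metis null_poly_add null_poly_mult2)
  then show ?case by blast
qed

lemma degree_ge_monic_factor:
  assumes "null_poly (f - P * g)" and P: "lead_coeff P = 1" and f: "\<not> null_poly f"
  shows "degree P \<le> degree f"
proof (rule ccontr)
  assume less: "\<not> degree P \<le> degree f"
  \<comment> \<open>The leading coefficient of \<open>g\<close> may be a multiple of p, so its
    integer degree says nothing. After reduction of the coefficients, the leading one is a unit
    modulo p unless the polynomial is 0.\<close>
  define g' where "g' = map_poly (\<lambda>c. c mod int p) g"
  have "null_poly (g - g')"
    by (auto simp: null_poly_coeff g'_def coeff_map_poly)
  have "f - P * g' = (f - P * g) + P * (g - g')"
    by (simp add: algebra_simps)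
  then have *: "null_poly (f - P * g')"
    using assms(1) \<open>null_poly (g - g')\<close> by (metis null_poly_add null_poly_mult2)
  have "g' \<noteq> 0"
    using null_poly_diff_iff[OF *] f by auto
  let ?k = "degree P + degree g'"
  have "poly.coeff (f - P * g') ?k = - lead_coeff g'"
    using less P by (simp add: coeff_mult_degree_sum coeff_eq_0)
  then have "int p dvd lead_coeff g'"
    using * unfolding null_poly_coeff by (metis dvd_minus_iff)
  moreover have "lead_coeff g' = poly.coeff g (degree g') mod int p"
    unfolding g'_def by (simp add: coeff_map_poly)
  moreover have "0 < int p" using prime_p prime_gt_0_nat by simp
  ultimately have "lead_coeff g' = 0"
    by (simp add: dvd_eq_mod_eq_0)
  with \<open>g' \<noteq> 0\<close> show False by simp
qed

lemma multiplicity_root_bound: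
  assumes f: "\<not> null_poly f" and fin: "finite S"
    and S: "\<And>b c. b \<in> S \<Longrightarrow> c \<in> S \<Longrightarrow> int p dvd b - c \<Longrightarrow> b = c"
    and van: "\<And>b. b \<in> S \<Longrightarrow> \<exists>g. null_poly (f - [:-b, 1:] ^ M * g)"
  shows "M * card S \<le> degree f"
proof -
  have "\<exists>g. null_poly (f - (\<Prod>b\<in>T. [:-b, 1:]) ^ M * g)" if "T \<subseteq> S" for T
    using finite_subset[OF that fin] that
  proof (induction T rule: finite_induct)
    case empty
    then show ?case by (intro exI[of _ f]) simp
  next
    case (insert b T)
    let ?P = "(\<Prod>b\<in>T. [:-b, 1:]) ^ M"
    obtain g where g: "null_poly (f - ?P * g)"
      using insert by auto
    obtain h where h: "null_poly (f - [:-b, 1:] ^ M * h)"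
      using van insert.prems by auto
    have "null_poly (?P * g - [:-b, 1:] ^ M * h)"
      using null_poly_diff[OF h g] by simp
    moreover have "\<not> int p dvd poly ?P b"
    proof
      assume "int p dvd poly ?P b"
      then have "int p dvd (\<Prod>c\<in>T. b - c)"
        using prime_dvd_power[OF prime_int_p] by (force simp: poly_prod poly_power)
      then obtain c where "c \<in> T" "int p dvd b - c"
        using prime_int_p insert.hyps(1) by (auto simp: prime_dvd_prod_iff)
      then show False
        using S[of b c] insert by auto
    qed
    ultimately obtain k where k: "null_poly (g - [:-b, 1:] ^ M * k)"
      using null_poly_cancel_coprime_linear_power by blast
    have ring_id: "f - X * Q * k = (f - Q * g) + Q * (g - X * k)" for X Q :: "int poly"
      by (simp add: algebra_simps)
    have "f - (\<Prod>b\<in>insert b T. [:-b, 1:]) ^ M * k = (f - ?P * g) + ?P * (g - [:-b, 1:] ^ M * k)"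
      unfolding prod.insert[OF insert.hyps] power_mult_distrib by (rule ring_id)
    then show ?case
      using g k by (metis null_poly_add null_poly_mult2)
  qed
  from this[of S] obtain g where g: "null_poly (f - (\<Prod>b\<in>S. [:-b, 1:]) ^ M * g)"
    by auto
  have "lead_coeff ((\<Prod>b\<in>S. [:-b, 1:]) ^ M) = 1"
    by (simp add: lead_coeff_power lead_coeff_prod)
  from degree_ge_monic_factor[OF g this f]
  have "degree ((\<Prod>b\<in>S. [:-b, 1:]) ^ M) \<le> degree f" .
  moreover have "degree ((\<Prod>b\<in>S. [:-b, 1:]) ^ M) = M * card S"
    by (subst degree_power_eq) (auto simp: degree_prod_sum_eq fin prod_zero_iff)
  ultimately show ?thesis by simp
qed

end

section \<open>Independence of products of powers of linear polynomials\<close>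

definition linear_prod :: "int set \<Rightarrow> int poly"
  where "linear_prod A = (\<Prod>a\<in>A. [:a, 1:])"

definition power_prod :: "nat \<Rightarrow> int set \<Rightarrow> (int \<Rightarrow> nat) \<Rightarrow> int poly"
  where "power_prod n A e = (\<Prod>a\<in>A. [:a, 1:] ^ (n * e a))"

text \<open>This is \<open>linear_prod A\<close> times the logarithmic derivative of
  \<open>power_prod n A e\<close>, that is, the logarithmic derivative with its denominators
  cleared.\<close>

definition power_prod_log :: "nat \<Rightarrow> int set \<Rightarrow> (int \<Rightarrow> nat) \<Rightarrow> int poly"
  where "power_prod_log n A e = (\<Sum>a\<in>A. of_nat (n * e a) * linear_prod (A - {a}))"

text \<open>The derivation \<open>linear_prod A * pderiv\<close> conjugated by
  \<open>power_prod n A e\<close>: it acts on the cofactor \<open>T\<close> and leaves the product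
  of powers in place.\<close>

definition twisted_pderiv :: "nat \<Rightarrow> int set \<Rightarrow> (int \<Rightarrow> nat) \<Rightarrow> int poly \<Rightarrow> int poly"
  where "twisted_pderiv n A e T = linear_prod A * pderiv T + power_prod_log n A e * T"

lemma mult_pderiv_linear_power:
  "[:a, 1:] * pderiv ([:a, 1:] ^ v) = of_nat v * [:a, 1:] ^ v" for a :: int
proof (cases v)
  case (Suc w)
  have "pderiv [:a, 1:] = 1"
    by (simp add: pderiv_pCons)
  then show ?thesis
    unfolding Suc pderiv_power_Suc by (simp add: of_nat_poly)
qed simp

lemma linear_prod_remove:
  "finite A \<Longrightarrow> a \<in> A \<Longrightarrow> linear_prod A = [:a, 1:] * linear_prod (A - {a})"
  unfolding linear_prod_def by (rule prod.remove)

lemma pderiv_power_prod: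
  assumes "finite A"
  shows "linear_prod A * pderiv (power_prod n A e) = power_prod_log n A e * power_prod n A e"
proof -
  have "linear_prod A * (prod (\<lambda>a. [:a, 1:] ^ (n * e a)) (A - {a}) * pderiv ([:a, 1:] ^ (n * e a)))
      = of_nat (n * e a) * linear_prod (A - {a}) * power_prod n A e" if a: "a \<in> A" for a
  proof -
    have "linear_prod A * (prod (\<lambda>a. [:a, 1:] ^ (n * e a)) (A - {a}) * pderiv ([:a, 1:] ^ (n * e a)))
      = linear_prod (A - {a}) * prod (\<lambda>a. [:a, 1:] ^ (n * e a)) (A - {a}) *
          ([:a, 1:] * pderiv ([:a, 1:] ^ (n * e a)))"
      unfolding linear_prod_remove[OF assms a] by (simp only: mult_ac)
    also have "\<dots> = of_nat (n * e a) * linear_prod (A - {a}) * power_prod n A e"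
      unfolding mult_pderiv_linear_power power_prod_def prod.remove[OF assms a] by (simp only: mult_ac)
    finally show ?thesis .
  qed
  then show ?thesis
    unfolding power_prod_def power_prod_log_def pderiv_prod sum_distrib_left sum_distrib_right
    by (intro sum.cong) (auto simp: power_prod_def)
qed

lemma linear_prod_mult_pderiv_power_prod:
  assumes "finite A"
  shows "linear_prod A * pderiv (T * power_prod n A e) = twisted_pderiv n A e T * power_prod n A e"
  using pderiv_power_prod[OF assms, of n e]
  unfolding pderiv_mult twisted_pderiv_def by (simp add: algebra_simps)

lemma degree_linear_prod: "finite A \<Longrightarrow> degree (linear_prod A) = card A"
  unfolding linear_prod_def by (subst degree_prod_sum_eq) auto

lemma degree_linear_prod_remove: "finite A \<Longrightarrow> a \<in> A \<Longrightarrow> degree (linear_prod (A - {a})) = card A - 1"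
  by (simp add: degree_linear_prod)

lemma degree_power_prod_log_le: "finite A \<Longrightarrow> degree (power_prod_log n A e) \<le> card A - 1"
  unfolding power_prod_log_def
  by (intro degree_sum_le) (auto simp: degree_linear_prod_remove of_nat_poly intro: order_trans[OF degree_smult_le])

lemma power_prod_monic: "lead_coeff (power_prod n A e) = 1"
  unfolding power_prod_def by (simp add: lead_coeff_prod lead_coeff_power)

lemma poly_linear_prod: "poly (linear_prod A) b = (\<Prod>a\<in>A. a + b)"
  by (simp add: linear_prod_def poly_prod)

context prime_modulus
begin

definition incongruent :: "int set \<Rightarrow> bool"
  where "incongruent S \<longleftrightarrow> (\<forall>b\<in>S. \<forall>c\<in>S. int p dvd b - c \<longrightarrow> b = c)"

text \<open>For \<open>R \<le> p\<close>, modulo \<open>p\<close> these are the polynomials whose exponents \<open>u\<close> all satisfy \<open>u mod p < R\<close>. The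
  derivative makes it evident that the condition is invariant under translation.\<close>
definition pderiv_null :: "nat \<Rightarrow> int poly \<Rightarrow> bool"
  where "pderiv_null R T \<longleftrightarrow> null_poly ((pderiv ^^ R) T)"

lemma pderiv_null_Suc: "pderiv_null (Suc R) T \<longleftrightarrow> pderiv_null R (pderiv T)"
  by (simp add: pderiv_null_def funpow_swap1)

lemma pderiv_null_add: "pderiv_null R S \<Longrightarrow> pderiv_null R T \<Longrightarrow> pderiv_null R (S + T)"
  by (simp add: pderiv_null_def higher_pderiv_add null_poly_add)

lemma higher_pderiv_diff: "(pderiv ^^ k) (f - g) = (pderiv ^^ k) f - (pderiv ^^ k) (g :: int poly)"
  by (induction k arbitrary: f g) (simp_all add: pderiv_diff)

lemma pderiv_null_diff: "pderiv_null R S \<Longrightarrow> pderiv_null R T \<Longrightarrow> pderiv_null R (S - T)"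
  by (simp add: pderiv_null_def higher_pderiv_diff null_poly_diff)

lemma pderiv_null_sum: "(\<And>i. i \<in> I \<Longrightarrow> pderiv_null R (f i)) \<Longrightarrow> pderiv_null R (sum f I)"
  by (simp add: pderiv_null_def higher_pderiv_sum null_poly_sum)

lemma pderiv_null_mono: "pderiv_null a T \<Longrightarrow> a \<le> b \<Longrightarrow> pderiv_null b T"
  unfolding pderiv_null_def
  by (metis null_poly_higher_pderiv funpow_add comp_apply le_add_diff_inverse2)

text \<open>Leibniz: in a derivative of order a + b - 1 every term has at least a derivatives on S
  or at least b on T. If a or b is 0, the product itself is null, whatever the truncated difference
  is.\<close>

lemma pderiv_null_mult:
  "pderiv_null a S \<Longrightarrow> pderiv_null b T \<Longrightarrow> pderiv_null (a + b - 1) (S * T)"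
proof (induction "a + b" arbitrary: a b S T)
  case 0
  then show ?case by (simp add: pderiv_null_def null_poly_mult1)
next
  case (Suc m)
  show ?case
  proof (cases "a = 0 \<or> b = 0")
    case True
    then have "null_poly (S * T)"
      using Suc.prems by (auto simp: pderiv_null_def null_poly_mult_iff)
    then show ?thesis
      by (simp add: pderiv_null_def null_poly_higher_pderiv)
  next
    case False
    then obtain a' b' where ab: "a = Suc a'" "b = Suc b'"
      by (meson not0_implies_Suc)
    have "pderiv_null (a' + b - 1) (pderiv S * T)"
      by (rule Suc.hyps) (use Suc ab in \<open>auto simp: pderiv_null_Suc\<close>)
    moreover have "pderiv_null (a + b' - 1) (S * pderiv T)"
      by (rule Suc.hyps) (use Suc ab in \<open>auto simp: pderiv_null_Suc\<close>)
    ultimately have "pderiv_null (a' + b') (pderiv (S * T))"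
      by (simp add: ab pderiv_mult pderiv_null_add mult.commute)
    then show ?thesis
      by (simp add: ab flip: pderiv_null_Suc)
  qed
qed

lemma pderiv_null_degree: "degree T < R \<Longrightarrow> pderiv_null R T"
proof (induction R arbitrary: T)
  case (Suc R)
  show ?case
  proof (cases "degree T = 0")
    case True
    then have "pderiv T = 0" by (simp add: pderiv_eq_0_iff)
    then show ?thesis
      unfolding pderiv_null_Suc by (simp add: pderiv_null_def)
  next
    case False
    then show ?thesis
      unfolding pderiv_null_Suc using Suc by (simp add: degree_pderiv)
  qed
qed simp

text \<open>Otherwise R derivations would lower the order by exactly R and could not produce a null
  polynomial. The order v itself may be large; only its residue is bounded.\<close>

lemma pderiv_null_order:
  assumes T: "pderiv_null R T"
    and g: "null_poly (T - [:-b, 1:] ^ v * g)" "\<not> int p dvd poly g b"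
  shows "v mod p < R"
proof (rule ccontr)
  assume "\<not> v mod p < R"
  then have "R \<le> v mod p" by simp
  have "\<not> int p dvd poly 1 b"
    using prime_int_p not_prime_unit by auto
  from exact_order_iterate_pderiv[OF g \<open>R \<le> v mod p\<close> this]
  obtain h where "null_poly ((pderiv ^^ R) T - [:-b, 1:] ^ (v - R) * h)" "\<not> int p dvd poly h b"
    by auto
  from exact_order_not_null[OF this] T show False
    by (simp add: pderiv_null_def)
qed

text \<open>Modulo p, n is -1/d. Multiplying by d turns the expression into d x - (i - j), where x
  is the difference of the residues of v and w. Since |x| \<le> R - 1 and |i - j| < d, this is
  smaller than d R \<le> p in absolute value, so divisibility would force d x = i - j and hence i =
  j.\<close>

lemma exponent_incongruent:
  assumes nd: "n * d = p - 1" and dR: "d * R \<le> p"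
    and "v mod p < R" "w mod p < R" "i < d" "j < d" "i \<noteq> j"
  shows "\<not> int p dvd int v - int w + int n * (int i - int j)"
proof
  assume dvd: "int p dvd int v - int w + int n * (int i - int j)"
  define x where "x = int (v mod p) - int (w mod p)"
  have nd': "int n * int d = int p - 1"
    using nd prime_gt_0_nat[OF prime_p] by (metis of_nat_mult of_nat_1 of_nat_diff Suc_leI One_nat_def)
  have "int v = int p * int (v div p) + int (v mod p)" "int w = int p * int (w div p) + int (w mod p)"
    by (simp_all flip: of_nat_mult of_nat_add)
  then have "int d * (int v - int w + int n * (int i - int j)) =
      int d * x - (int i - int j) + int p * (int d * (int (v div p) - int (w div p)) + (int i - int j))"
  proof -
    have alg: "D * ((P * v1 + v2) - (P * w1 + w2) + N * k) = D * (v2 - w2) - k + P * (D * (v1 - w1) + k)"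
      if "N * D = P - 1" for D P N v1 v2 w1 w2 k :: int
    proof -
      have "D * (N * k) = (P - 1) * k"
        using that by (metis mult.assoc mult.commute)
      then show ?thesis by (simp add: algebra_simps)
    qed
    show ?thesis
      using alg[OF nd', of "int (v div p)" "int (v mod p)" "int (w div p)" "int (w mod p)" "int i - int j"]
        \<open>int v = _\<close> \<open>int w = _\<close> unfolding x_def by simp
  qed
  then have "int p dvd int d * x - (int i - int j)"
    using dvd by (metis dvd_add_times_triv_right_iff dvd_mult mult.commute)
  moreover have "\<bar>int d * x - (int i - int j)\<bar> < int p"
  proof -
    have "\<bar>x\<bar> \<le> int R - 1" using assms unfolding x_def by auto
    then have "int d * \<bar>x\<bar> \<le> int d * (int R - 1)" by (intro mult_left_mono) auto
    moreover have "int d * int R \<le> int p" using dR by (metis of_nat_mult of_nat_le_iff)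
    moreover have "\<bar>int i - int j\<bar> < int d" using assms by auto
    moreover have "\<bar>int d * x - (int i - int j)\<bar> \<le> int d * \<bar>x\<bar> + \<bar>int i - int j\<bar>"
      by (metis abs_mult abs_of_nat abs_triangle_ineq4)
    ultimately show ?thesis by (simp add: algebra_simps)
  qed
  ultimately have "int d * x = int i - int j"
    by (metis abs_ge_zero dvd_imp_le_int eq_iff_diff_eq_0 linorder_not_le abs_of_nat)
  then have "int d dvd int i - int j"
    by (metis dvd_triv_left)
  moreover have "\<bar>int i - int j\<bar> < int d" using assms by auto
  ultimately show False using \<open>i \<noteq> j\<close>
    by (metis dvd_imp_le_int eq_iff_diff_eq_0 linorder_not_le abs_of_nat of_nat_eq_iff)
qed

text \<open>Only the term of a survives at the point -a; it carries the residue n e(a) of the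
  logarithmic derivative there.\<close>

lemma power_prod_log_local:
  assumes "finite A" "a \<in> A"
  shows "\<exists>Q. power_prod_log n A e = of_nat (n * e a) * linear_prod (A - {a}) + [:a, 1:] * Q"
proof -
  have "power_prod_log n A e = of_nat (n * e a) * linear_prod (A - {a})
      + (\<Sum>b\<in>A - {a}. of_nat (n * e b) * linear_prod (A - {b}))"
    unfolding power_prod_log_def by (rule sum.remove[OF assms])
  also have "(\<Sum>b\<in>A - {a}. of_nat (n * e b) * linear_prod (A - {b})) =
      (\<Sum>b\<in>A - {a}. [:a, 1:] * (of_nat (n * e b) * linear_prod (A - {b} - {a})))"
  proof (intro sum.cong refl)
    fix b assume "b \<in> A - {a}"
    then have "linear_prod (A - {b}) = [:a, 1:] * linear_prod (A - {b} - {a})"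
      using assms by (intro linear_prod_remove) auto
    then show "of_nat (n * e b) * linear_prod (A - {b}) =
      [:a, 1:] * (of_nat (n * e b) * linear_prod (A - {b} - {a}))"
      by (simp only: mult_ac)
  qed
  finally show ?thesis
    unfolding sum_distrib_left[symmetric] by blast
qed

text \<open>If this Wronskian vanished, the logarithmic derivatives of the two products would agree, and
  comparing residues at \<open>-a\<close> would contradict \<open>exponent_incongruent\<close>.\<close>
lemma twisted_wronskian_not_null:
  assumes nd: "n * d = p - 1" and dR: "d * R \<le> p"
    and A: "finite A" "incongruent A" and a: "a \<in> A" "e a < d" "f a < d" "e a \<noteq> f a"
    and S: "pderiv_null R S" "\<not> null_poly S" and T: "pderiv_null R T" "\<not> null_poly T"
  shows "\<not> null_poly (S * twisted_pderiv n A e T - T * twisted_pderiv n A f S)"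
proof
  assume null: "null_poly (S * twisted_pderiv n A e T - T * twisted_pderiv n A f S)"
  define z where "z = [:- (-a), 1:]"
  obtain v g where g: "null_poly (T - z ^ v * g)" "\<not> int p dvd poly g (-a)"
    using exact_order_exists[OF T(2), of "-a"] unfolding z_def by blast
  obtain w h where h: "null_poly (S - z ^ w * h)" "\<not> int p dvd poly h (-a)"
    using exact_order_exists[OF S(2), of "-a"] unfolding z_def by blast
  have vR: "v mod p < R" and wR: "w mod p < R"
    using pderiv_null_order[OF T(1) g[unfolded z_def]] pderiv_null_order[OF S(1) h[unfolded z_def]] by auto
  obtain Q where Q: "power_prod_log n A e = of_nat (n * e a) * linear_prod (A - {a}) + z * Q"
    using power_prod_log_local[OF A(1) a(1)] unfolding z_def by auto
  obtain Q' where Q': "power_prod_log n A f = of_nat (n * f a) * linear_prod (A - {a}) + z * Q'"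
    using power_prod_log_local[OF A(1) a(1)] unfolding z_def by auto
  define L where "L = linear_prod (A - {a})"
  have zL: "linear_prod A = z * L"
    unfolding L_def z_def using linear_prod_remove[OF A(1) a(1)] by simp
  define S' T' where "S' = z ^ w * h" and "T' = z ^ v * g"
  have diff: "twisted_pderiv n A e (X - Y) = twisted_pderiv n A e X - twisted_pderiv n A e Y" for e X Y
    by (simp add: twisted_pderiv_def pderiv_diff algebra_simps)
  have nt: "null_poly (twisted_pderiv n A e X)" if "null_poly X" for e X
    using that by (simp add: twisted_pderiv_def null_poly_add null_poly_mult2 null_poly_pderiv)
  \<comment> \<open>\<open>V\<close> is the Wronskian of \<open>S'\<close> and \<open>T'\<close>
    with the factor z^(v + w) removed. Its value at -a is a product of units modulo p with v - w + n
    (e a - f a), the difference of the two residues.\<close>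
  define V where "V = h * (L * (of_nat v * g + z * pderiv g) + (of_nat (n * e a) * L + z * Q) * g)
      - g * (L * (of_nat w * h + z * pderiv h) + (of_nat (n * f a) * L + z * Q') * h)"
  have zz: "z * pderiv (z ^ v) = of_nat v * z ^ v" for v
    using mult_pderiv_linear_power[of a v] by (simp add: z_def)
  have zp: "z * L * pderiv (z ^ v * g) + (of_nat c * L + z * Q) * (z ^ v * g) =
      z ^ v * (L * (of_nat v * g + z * pderiv g) + (of_nat c * L + z * Q) * g)" for v c and g Q :: "int poly"
  proof -
    have "z * L * pderiv (z ^ v * g) = L * (g * (z * pderiv (z ^ v))) + z ^ v * (L * (z * pderiv g))"
      unfolding pderiv_mult by (simp only: distrib_left mult_ac add_ac)
    then show ?thesis
      unfolding zz by (simp only: distrib_left distrib_right mult_ac add_ac)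
  qed
  have tT: "twisted_pderiv n A e T' = z ^ v * (L * (of_nat v * g + z * pderiv g) + (of_nat (n * e a) * L + z * Q) * g)"
    unfolding twisted_pderiv_def zL Q L_def[symmetric] T'_def by (rule zp)
  have tS: "twisted_pderiv n A f S' = z ^ w * (L * (of_nat w * h + z * pderiv h) + (of_nat (n * f a) * L + z * Q') * h)"
    unfolding twisted_pderiv_def zL Q' L_def[symmetric] S'_def by (rule zp)
  have 1: "S' * twisted_pderiv n A e T' - T' * twisted_pderiv n A f S' = z ^ (v + w) * V"
  proof -
    have "z ^ w * h * (z ^ v * X) - z ^ v * g * (z ^ w * Y) = z ^ (v + w) * (h * X - g * Y)" for X Y
      unfolding power_add by (simp only: right_diff_distrib mult_ac)
    then show ?thesis
      unfolding tT tS V_def unfolding S'_def T'_def .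
  qed
  have "null_poly (z ^ (v + w) * V)"
  proof -
    have "z ^ (v + w) * V = (S * twisted_pderiv n A e T - T * twisted_pderiv n A f S)
       - (S - S') * twisted_pderiv n A e T - S' * twisted_pderiv n A e (T - T')
       + (T - T') * twisted_pderiv n A f S + T' * twisted_pderiv n A f (S - S')"
      unfolding 1[symmetric] diff by (simp only: left_diff_distrib right_diff_distrib)
    moreover have "null_poly (S - S')" "null_poly (T - T')"
      unfolding S'_def T'_def by (rule h(1), rule g(1))
    moreover from this have "null_poly ((S - S') * X)" "null_poly ((T - T') * X)"
      "null_poly (S' * twisted_pderiv n A e (T - T'))" "null_poly (T' * twisted_pderiv n A f (S - S'))" for X
      by (auto intro: null_poly_mult1 null_poly_mult2 nt)
    moreover have "null_poly (f0 - f1 - f2 + f3 + f4)"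
      if "null_poly f0" "null_poly f1" "null_poly f2" "null_poly f3" "null_poly f4" for f0 f1 f2 f3 f4
      using that by (intro null_poly_add null_poly_diff)
    ultimately show ?thesis
      using null by (simp only:)
  qed
  then have "null_poly V"
    unfolding z_def by (rule null_poly_div_linear_power)
  then have "int p dvd poly V (-a)"
    by (rule null_poly_poly)
  moreover have "poly V (-a) = poly h (-a) * poly g (-a) * poly L (-a) *
      (int v - int w + int n * (int (e a) - int (f a)))"
  proof -
    have "poly z (-a) = 0" by (simp add: z_def)
    then have "poly V (-a) = poly h (-a) * (poly L (-a) * (int v * poly g (-a)) + int (n * e a) * poly L (-a) * poly g (-a))
       - poly g (-a) * (poly L (-a) * (int w * poly h (-a)) + int (n * f a) * poly L (-a) * poly h (-a))"
      unfolding V_def by simp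
    then show ?thesis by (simp add: algebra_simps)
  qed
  ultimately have "int p dvd poly L (-a)"
    using g(2) h(2) exponent_incongruent[OF nd dR vR wR a(2-4)] by (simp add: prime_dvd_mult_int)
  then have "\<exists>b\<in>A - {a}. int p dvd b - a"
    using prime_int_p A(1) by (simp add: L_def poly_linear_prod prime_dvd_prod_iff)
  then show False
    using A(2) a(1) unfolding incongruent_def by blast
qed

text \<open>By induction on the number of terms: differentiating the relation allows one to eliminate a term, at the cost
  of replacing \<open>R\<close> by \<open>2 R + card A\<close>.\<close>
lemma power_prod_independent:
  assumes nd: "n * d = p - 1" and A: "finite A" "incongruent A" and "finite E"
    and E: "\<And>e a. e \<in> E \<Longrightarrow> a \<in> A \<Longrightarrow> e a < d"
    and sep: "\<And>e f. e \<in> E \<Longrightarrow> f \<in> E \<Longrightarrow> e \<noteq> f \<Longrightarrow> \<exists>a\<in>A. e a \<noteq> f a"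
    and R: "d * (2 ^ card E * (R + card A)) \<le> p"
    and T: "\<And>e. e \<in> E \<Longrightarrow> pderiv_null R (T e)"
    and rel: "null_poly (\<Sum>e\<in>E. T e * power_prod n A e)"
  shows "\<forall>e\<in>E. null_poly (T e)"
  using \<open>finite E\<close> E sep R T rel
proof (induction E arbitrary: R T rule: finite_induct)
  case (insert f F)
  have step: "null_poly (T f)" if "\<forall>e\<in>F. null_poly (T e)"
  proof -
    have "null_poly (\<Sum>e\<in>F. T e * power_prod n A e)"
      using that by (intro null_poly_sum) (auto simp: null_poly_mult1)
    moreover have "T f * power_prod n A f = (\<Sum>e\<in>insert f F. T e * power_prod n A e) - (\<Sum>e\<in>F. T e * power_prod n A e)"
      using insert.hyps by simp
    ultimately have "null_poly (T f * power_prod n A f)"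
      using insert.prems(5) null_poly_diff by metis
    then show ?thesis
      using not_null_poly_monic[OF power_prod_monic] null_poly_mult_iff by blast
  qed
  show ?case
  proof (cases "null_poly (T f)")
    case True
    have "\<forall>e\<in>F. null_poly (T e)"
    proof (rule insert.IH)
      have "(\<Sum>e\<in>F. T e * power_prod n A e) = (\<Sum>e\<in>insert f F. T e * power_prod n A e) - T f * power_prod n A f"
        using insert.hyps by simp
      then show "null_poly (\<Sum>e\<in>F. T e * power_prod n A e)"
        using insert.prems(5) True by (metis null_poly_diff null_poly_mult1)
      have "2 ^ card F * (R + card A) \<le> 2 ^ card (insert f F) * (R + card A)"
        using insert.hyps by simp
      then show "d * (2 ^ card F * (R + card A)) \<le> p"
        using insert.prems(3) by (meson mult_le_mono2 order_trans)
    qed (use insert.prems in auto)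
    with True show ?thesis by auto
  next
    case False
    \<comment> \<open>\<open>T f\<close> times the differentiated relation, minus
      \<open>twisted_pderiv n A f (T f)\<close> times the relation itself; this cancels the term of
      \<open>f\<close>, as \<open>U f\<close> = 0.\<close>
    define U where "U e = T f * twisted_pderiv n A e (T e) - T e * twisted_pderiv n A f (T f)" for e
    define Rel where "Rel = (\<Sum>e\<in>insert f F. T e * power_prod n A e)"
    have "(\<Sum>e\<in>F. U e * power_prod n A e) = (\<Sum>e\<in>insert f F. U e * power_prod n A e)"
      using insert.hyps by (simp add: U_def)
    also have "\<dots> = T f * (linear_prod A * pderiv Rel) - twisted_pderiv n A f (T f) * Rel"
      unfolding Rel_def higher_pderiv_sum[of 1, simplified] sum_distrib_left
        linear_prod_mult_pderiv_power_prod[OF A(1)] U_def sum_subtractf[symmetric]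
      by (intro sum.cong refl) (simp add: algebra_simps)
    finally have "null_poly (\<Sum>e\<in>F. U e * power_prod n A e)"
      using insert.prems(5) unfolding Rel_def[symmetric]
      by (simp add: null_poly_diff null_poly_mult2 null_poly_pderiv)
    moreover have "pderiv_null (2 * R + card A) (U e)" if "e \<in> F" for e
    proof -
      have tw: "pderiv_null (R + card A) (twisted_pderiv n A e X)" if "pderiv_null R X" for e X
      proof -
        have "pderiv_null (card A + 1) (linear_prod A)" "pderiv_null (card A + 1) (power_prod_log n A e)"
          using degree_linear_prod[OF A(1)] degree_power_prod_log_le[OF A(1), of n e]
          by (auto intro!: pderiv_null_degree)
        moreover have "pderiv_null R (pderiv X)"
          using that pderiv_null_mono pderiv_null_Suc by (meson le_Suc_eq order_refl)
        ultimately have "pderiv_null (card A + 1 + R - 1) (twisted_pderiv n A e X)"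
          unfolding twisted_pderiv_def using that by (intro pderiv_null_add pderiv_null_mult)
        then show ?thesis by (simp add: add.commute)
      qed
      have "pderiv_null (R + (R + card A) - 1) (U e)"
        unfolding U_def using that insert.prems(4) by (intro pderiv_null_diff pderiv_null_mult tw) auto
      then show ?thesis
        by (rule pderiv_null_mono) auto
    qed
    \<comment> \<open>Replacing R by 2 R + card A while dropping one term leaves this quantity
      unchanged; this is the origin of the hypothesis on R.\<close>
    moreover have "2 ^ card F * (2 * R + card A + card A) = 2 ^ card (insert f F) * (R + card A)"
      using insert.hyps by simp
    ultimately have U: "\<forall>e\<in>F. null_poly (U e)"
      using insert.prems(1-3) by (intro insert.IH[of "2 * R + card A" U]) (simp_all only: insert_iff, blast+)
    have "1 * R \<le> 2 ^ card (insert f F) * (R + card A)"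
      by (intro mult_le_mono) auto
    then have "d * R \<le> d * (2 ^ card (insert f F) * (R + card A))"
      by (intro mult_le_mono2) simp
    then have dR: "d * R \<le> p"
      using insert.prems(3) by (rule order_trans)
    have "\<forall>e\<in>F. null_poly (T e)"
    proof (intro ballI, rule ccontr)
      fix e assume e: "e \<in> F" "\<not> null_poly (T e)"
      then obtain a where a: "a \<in> A" "e a \<noteq> f a"
        using insert.hyps insert.prems(2)[of e f] by auto
      have "\<not> null_poly (U e)"
        unfolding U_def
        by (rule twisted_wronskian_not_null[OF nd dR A a(1)]) (use insert.prems e a False in auto)
      then show False using U e by blast
    qed
    with step show ?thesis by blast
  qed
qed simp

end

section \<open>Stepanov's method\<close>

text \<open>With L = \<open>linear_prod A\<close> this derivation maps multiples of
  \<open>power_prod n A e\<close> to multiples of it. This L does not vanish modulo p on a fibre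
  whose prescribed values are nonzero, so the criterion for high order applies there.\<close>

definition weighted_pderiv :: "int poly \<Rightarrow> int poly \<Rightarrow> int poly"
  where "weighted_pderiv L f = L * pderiv f"

lemma weighted_pderiv_add: "weighted_pderiv L (f + g) = weighted_pderiv L f + weighted_pderiv L g"
  by (simp add: weighted_pderiv_def pderiv_add distrib_left)

lemma weighted_pderiv_smult: "weighted_pderiv L (Polynomial.smult c f) = Polynomial.smult c (weighted_pderiv L f)"
  by (simp add: weighted_pderiv_def pderiv_smult)

lemma iterate_weighted_pderiv_sum:
  "(weighted_pderiv L ^^ t) (\<Sum>u\<in>U. Polynomial.smult (r u) (f u)) = (\<Sum>u\<in>U. Polynomial.smult (r u) ((weighted_pderiv L ^^ t) (f u)))"
proof (induction t)
  case (Suc t)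
  have "weighted_pderiv L (\<Sum>u\<in>U. Polynomial.smult (r u) (g u)) = (\<Sum>u\<in>U. Polynomial.smult (r u) (weighted_pderiv L (g u)))" for g
    by (induction U rule: infinite_finite_induct)
       (simp_all add: weighted_pderiv_add weighted_pderiv_smult, simp_all add: weighted_pderiv_def)
  with Suc show ?case by simp
qed simp

lemma degree_twisted_pderiv:
  assumes "finite A"
  shows "degree (twisted_pderiv n A e T) \<le> degree T + card A"
proof -
  have "degree (linear_prod A * pderiv T) \<le> degree T + card A"
    using degree_mult_le[of "linear_prod A" "pderiv T"] degree_linear_prod[OF assms] degree_pderiv[of T] by linarith
  moreover have "degree (power_prod_log n A e * T) \<le> degree T + card A"
    using degree_mult_le[of "power_prod_log n A e" T] degree_power_prod_log_le[OF assms, of n e] by linarith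
  ultimately show ?thesis
    unfolding twisted_pderiv_def by (rule degree_add_le)
qed

lemma degree_iterate_twisted_pderiv:
  "finite A \<Longrightarrow> degree ((twisted_pderiv n A e ^^ t) T) \<le> degree T + t * card A"
proof (induction t)
  case (Suc t)
  then show ?case
    using degree_twisted_pderiv[of A n e "(twisted_pderiv n A e ^^ t) T"] by simp
qed simp

lemma degree_power_prod: "finite A \<Longrightarrow> degree (power_prod n A e) = (\<Sum>a\<in>A. n * e a)"
  unfolding power_prod_def by (subst degree_prod_sum_eq) (auto simp: degree_power_eq)

lemma poly_power_prod: "poly (power_prod n A e) b = (\<Prod>a\<in>A. ((b + a) ^ n) ^ e a)"
  by (simp add: power_prod_def poly_prod poly_power power_mult add.commute)

context prime_modulus
begin

text \<open>Pigeonhole instead of linear algebra: there are more vectors with entries in {0..<p}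
  than possible images, and the difference of two vectors with the same image is a solution that is
  nonzero modulo p.\<close>

lemma homogeneous_system_mod_p:
  fixes L :: "'c \<Rightarrow> 'u \<Rightarrow> int"
  assumes "finite U" "finite C" "card C < card U"
  shows "\<exists>r. (\<exists>u\<in>U. \<not> int p dvd r u) \<and> (\<forall>c\<in>C. int p dvd (\<Sum>u\<in>U. r u * L c u))"
proof -
  have p1: "1 < p" using prime_p prime_gt_1_nat by blast
  define F where "F v = restrict (\<lambda>c. (\<Sum>u\<in>U. v u * L c u) mod int p) C" for v :: "'u \<Rightarrow> int"
  let ?dom = "PiE U (\<lambda>_. {0..<int p})" and ?ran = "PiE C (\<lambda>_. {0..<int p})"
  have "F ` ?dom \<subseteq> ?ran"
    using p1 by (auto simp: F_def)
  moreover have "finite ?ran"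
    by (intro finite_PiE assms) auto
  ultimately have "card (F ` ?dom) \<le> card ?ran"
    by (rule card_mono[rotated])
  also have "\<dots> < card ?dom"
    using assms p1 by (simp add: card_PiE)
  finally have "\<not> inj_on F ?dom"
    using card_image[of F ?dom] by auto
  then obtain v w where vw: "v \<in> ?dom" "w \<in> ?dom" "F v = F w" "v \<noteq> w"
    by (auto simp: inj_on_def)
  then obtain u where u: "u \<in> U" "v u \<noteq> w u"
    by (meson PiE_ext)
  have "v u \<in> {0..<int p}" "w u \<in> {0..<int p}"
    using vw u by auto
  then have "\<not> int p dvd v u - w u"
    using u(2) by (metis atLeastLessThan_iff mod_eq_dvd_iff mod_pos_pos_trivial)
  moreover have "int p dvd (\<Sum>u\<in>U. (v u - w u) * L c u)" if "c \<in> C" for c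
  proof -
    have "(\<Sum>u\<in>U. v u * L c u) mod int p = (\<Sum>u\<in>U. w u * L c u) mod int p"
      using fun_cong[OF vw(3), of c] that by (simp add: F_def)
    then show ?thesis
      by (simp add: mod_eq_dvd_iff left_diff_distrib sum_subtractf)
  qed
  ultimately show ?thesis
    using u by (intro exI[of _ "\<lambda>u. v u - w u"]) blast
qed

lemma null_poly_weighted_pderiv: "null_poly f \<Longrightarrow> null_poly (weighted_pderiv L f)"
  by (simp add: weighted_pderiv_def null_poly_mult2 null_poly_pderiv)

lemma null_poly_pderiv_monom_p: "null_poly (pderiv (Polynomial.monom 1 (p * j)))"
  by (auto simp: null_poly_coeff coeff_pderiv) (metis dvd_triv_left of_nat_Suc of_nat_mult)

text \<open>A polynomial X with null derivative behaves like a constant under derivation. It stands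
  for x^(p j).\<close>

lemma iterate_weighted_pderiv_power_prod:
  assumes "finite A" and "null_poly (pderiv X)"
  shows "null_poly ((weighted_pderiv (linear_prod A) ^^ t) (X * T * power_prod n A e) -
           X * (twisted_pderiv n A e ^^ t) T * power_prod n A e)"
proof (induction t)
  case (Suc t)
  define S where "S = (twisted_pderiv n A e ^^ t) T"
  define f where "f = (weighted_pderiv (linear_prod A) ^^ t) (X * T * power_prod n A e)"
  define Y where "Y = power_prod n A e"
  have "linear_prod A * pderiv (S * Y) = twisted_pderiv n A e S * Y"
    unfolding Y_def by (rule linear_prod_mult_pderiv_power_prod[OF assms(1)])
  then have "weighted_pderiv (linear_prod A) f - X * twisted_pderiv n A e S * Y =
      weighted_pderiv (linear_prod A) (f - X * S * Y) + linear_prod A * S * Y * pderiv X"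
  proof -
    assume *: "linear_prod A * pderiv (S * Y) = twisted_pderiv n A e S * Y"
    have "weighted_pderiv (linear_prod A) (f - X * S * Y) =
      weighted_pderiv (linear_prod A) f - X * (linear_prod A * pderiv (S * Y)) - linear_prod A * S * Y * pderiv X"
      unfolding weighted_pderiv_def pderiv_diff mult.assoc[of X] pderiv_mult[of X]
      by (simp only: right_diff_distrib distrib_left mult_ac)
    then show ?thesis unfolding * by (simp add: mult.assoc)
  qed
  moreover have "null_poly (f - X * S * Y)"
    using Suc by (simp add: f_def S_def Y_def)
  ultimately have "null_poly (weighted_pderiv (linear_prod A) f - X * twisted_pderiv n A e S * Y)"
    using assms(2) by (simp only:) (intro null_poly_add null_poly_mult2 null_poly_weighted_pderiv)
  then show ?case
    by (simp add: f_def S_def Y_def)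
qed simp

lemma fermat_power_p: "[b ^ (p * j) = b ^ j] (mod int p)"
proof -
  have "[b ^ p = b] (mod int p)"
  proof (cases "int p dvd b")
    case True
    then have "int p dvd b ^ p" using prime_gt_0_nat[OF prime_p] by (simp add: dvd_power_same dvd_trans[OF _ dvd_power])
    with True show ?thesis by (simp add: cong_iff_dvd_diff)
  next
    case False
    define c where "c = nat (b mod int p)"
    have bc: "[b = int c] (mod int p)"
      using prime_gt_0_nat[OF prime_p] by (simp add: c_def Cong.cong_def)
    then have "\<not> p dvd c"
      using False by (metis cong_dvd_iff of_nat_dvd_iff cong_sym)
    then have "[c ^ (p - 1) = 1] (mod p)"
      using fermat_theorem[OF prime_p] by blast
    then have "[c ^ (p - 1) * c = 1 * c] (mod p)"
      by (rule cong_scalar_right)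
    moreover have "c ^ (p - 1) * c = c ^ p"
      using prime_gt_0_nat[OF prime_p] by (metis power_minus_mult)
    ultimately have "[int c ^ p = int c] (mod int p)"
      by (metis cong_int_iff mult_1 of_nat_power)
    then show ?thesis
      using cong_pow[OF bc, of p] bc by (meson cong_sym cong_trans)
  qed
  from cong_pow[OF this, of j] show ?thesis
    by (simp add: power_mult)
qed

text \<open>When n d = p - 1 and the values \<open>g a\<close> are d-th roots of unity modulo p,
  this prescribes the class of every x + a modulo d-th powers. The expected size is p / d^card
  A.\<close>

definition kummer_fibre :: "nat \<Rightarrow> int set \<Rightarrow> (int \<Rightarrow> int) \<Rightarrow> int set"
  where "kummer_fibre n A g = {x \<in> {0..<int p}. \<forall>a\<in>A. [(x + a) ^ n = g a] (mod int p)}"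

lemma finite_kummer_fibre [simp]: "finite (kummer_fibre n A g)"
  by (rule finite_subset[of _ "{0..<int p}"]) (auto simp: kummer_fibre_def)

text \<open>The auxiliary polynomial is a combination of the \<open>x\<^bsup>p j + s\<^esup> \<Prod>\<^sub>a (x + a)\<^bsup>n e a\<^esup>\<close>. On the fibre \<open>x\<^sup>p = x\<close> and
  \<open>(x + a)\<^sup>n = g a\<close>, so each of its first \<open>M\<close> derivatives there agrees with a polynomial of low degree, which is made
  to vanish identically by the choice of the coefficients.\<close>
lemma kummer_fibre_bound:
  assumes nd: "n * d = p - 1" and A: "finite A" "incongruent A"
    and g: "\<And>a. a \<in> A \<Longrightarrow> \<not> int p dvd g a"
    and R: "d * (2 ^ (d ^ card A) * (R + card A)) \<le> p" "0 < R" and M: "M \<le> p" and J: "0 < J"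
    and big: "M * (R + J + M * card A) < d ^ card A * J * R"
  shows "M * card (kummer_fibre n A g) \<le> p * (J + card A)"
proof -
  have p1: "1 < p" using prime_p prime_gt_1_nat by blast
  have "d > 0" "n > 0" using nd p1 by (auto intro!: Nat.gr0I)
  define E where "E = PiE A (\<lambda>_. {..<d})"
  have finE: "finite E" unfolding E_def by (intro finite_PiE A) auto
  have cardE: "card E = d ^ card A" unfolding E_def by (simp add: card_PiE A)
  define U where "U = E \<times> {..<J} \<times> {..<R}"
  have finU: "finite U" unfolding U_def using finE by auto
  define c where "c e = (\<Prod>a\<in>A. g a ^ e a)" for e
  define B where "B = R + J + M * card A"
  \<comment> \<open>The equations: the coefficients below \<open>B\<close> of the first
    \<open>M\<close> reduced derivatives. The hypothesis \<open>big\<close> says that they are fewer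
    than the d^card A * J * R unknowns indexed by \<open>U\<close>.\<close>
  define C where "C = {..<M} \<times> {..<B}"
  define X :: "nat \<Rightarrow> int poly" where "X j = Polynomial.monom 1 (p * j)" for j
  define xs :: "nat \<Rightarrow> int poly" where "xs s = Polynomial.monom 1 s" for s
  define tw where "tw e t s = (twisted_pderiv n A e ^^ t) (xs s)" for e t s
  \<comment> \<open>What becomes on the fibre of the t-th derivative of a single term: x^(p j) is
    replaced by x^j and each power (x + a)^n by the constant g a.\<close>
  define K where "K t = (\<lambda>(e, j, s). Polynomial.smult (c e) (xs j * tw e t s))" for t
  have "card C < card U"
    using big by (simp add: C_def U_def card_cartesian_product cardE B_def mult.assoc)
  moreover have "finite C" by (simp add: C_def)
  ultimately obtain r where r: "\<exists>u\<in>U. \<not> int p dvd r u"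
      "\<forall>q\<in>C. int p dvd (\<Sum>u\<in>U. r u * (\<lambda>(t, i). poly.coeff (K t u) i) q)"
    using homogeneous_system_mod_p[OF finU, of C "\<lambda>q u. (\<lambda>(t, i). poly.coeff (K t u) i) q"] by auto
  define H where "H t = (\<Sum>u\<in>U. Polynomial.smult (r u) (K t u))" for t
  have degK: "degree (K t u) < B" if "t < M" "u \<in> U" for t u
  proof -
    obtain e j s where u: "u = (e, j, s)" by (cases u)
    have "degree (tw e t s) \<le> s + t * card A"
      using degree_iterate_twisted_pderiv[OF A(1), where n = n and e = e and t = t and T = "xs s"] unfolding tw_def xs_def by (simp add: degree_monom_eq)
    moreover have "degree (K t u) \<le> degree (xs j) + degree (tw e t s)"
      unfolding K_def u prod.case by (rule order_trans[OF degree_smult_le degree_mult_le])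
    moreover have "degree (xs j) = j" by (simp add: xs_def degree_monom_eq)
    moreover have "j < J" "s < R" using that by (auto simp: u U_def)
    moreover have "t * card A \<le> M * card A" using that by simp
    ultimately show ?thesis unfolding B_def by linarith
  qed
  have nullH: "null_poly (H t)" if t: "t < M" for t
    unfolding null_poly_coeff
  proof
    fix i
    show "int p dvd poly.coeff (H t) i"
    proof (cases "i < B")
      case True
      then have "(t, i) \<in> C" using t by (simp add: C_def)
      with r(2) show ?thesis by (auto simp: H_def coeff_sum)
    next
      case False
      then have "poly.coeff (K t u) i = 0" if "u \<in> U" for u
        using degK[OF t that] by (simp add: coeff_eq_0)
      then show ?thesis by (simp add: H_def coeff_sum)
    qed
  qed
  define \<Phi> where "\<Phi> = (\<Sum>(e, j, s)\<in>U. Polynomial.smult (r (e, j, s)) (X j * xs s * power_prod n A e))"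
  have \<Phi>_alt: "\<Phi> = (\<Sum>u\<in>U. Polynomial.smult (r u) ((\<lambda>(e, j, s). X j * xs s * power_prod n A e) u))"
    unfolding \<Phi>_def by (intro sum.cong) auto
  have root: "int p dvd poly ((weighted_pderiv (linear_prod A) ^^ t) \<Phi>) b"
    if t: "t < M" and b: "b \<in> kummer_fibre n A g" for t b
  proof -
    have "[poly ((weighted_pderiv (linear_prod A) ^^ t) \<Phi>) b = poly (H t) b] (mod int p)"
      unfolding \<Phi>_alt iterate_weighted_pderiv_sum H_def poly_sum poly_smult
    proof (rule cong_sum, rule cong_scalar_left)
      fix u assume "u \<in> U"
      obtain e j s where u: "u = (e, j, s)" by (cases u)
      let ?Y = "power_prod n A e"
      have "[poly ((weighted_pderiv (linear_prod A) ^^ t) (X j * xs s * ?Y)) b = poly (X j * tw e t s * ?Y) b] (mod int p)"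
        using null_poly_poly[OF iterate_weighted_pderiv_power_prod[OF A(1) null_poly_pderiv_monom_p, of t j "xs s" n e], of b]
        by (simp add: cong_iff_dvd_diff X_def tw_def)
      also have "poly (X j * tw e t s * ?Y) b = b ^ (p * j) * poly (tw e t s) b * (\<Prod>a\<in>A. ((b + a) ^ n) ^ e a)"
        by (simp add: X_def poly_monom poly_power_prod)
      also have "[\<dots> = b ^ j * poly (tw e t s) b * (\<Prod>a\<in>A. g a ^ e a)] (mod int p)"
        using b by (intro cong_mult cong_prod cong_pow cong_refl fermat_power_p) (auto simp: kummer_fibre_def)
      also have "b ^ j * poly (tw e t s) b * (\<Prod>a\<in>A. g a ^ e a) = poly (K t u) b"
        by (simp add: K_def u c_def xs_def poly_monom mult_ac)
      finally show "[poly ((weighted_pderiv (linear_prod A) ^^ t) ((\<lambda>(e, j, s). X j * xs s * power_prod n A e) u)) b =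
          poly (K t u) b] (mod int p)"
        by (simp add: u)
    qed
    then show ?thesis
      using null_poly_poly[OF nullH[OF t], of b] by (simp add: cong_dvd_iff)
  qed
  \<comment> \<open>That the reduced derivatives are null does not make \<Phi> null: otherwise
    independence would make every cofactor \<open>T e\<close> null, and since R \<le> p the
    exponents p j + s with s < R are distinct, so all coefficients \<open>r u\<close> would vanish
    modulo p.\<close>
  have nonnull: "\<not> null_poly \<Phi>"
  proof
    assume null: "null_poly \<Phi>"
    define T where "T e = (\<Sum>(j, s)\<in>{..<J} \<times> {..<R}. Polynomial.smult (r (e, j, s)) (X j * xs s))" for e
    have "\<Phi> = (\<Sum>e\<in>E. \<Sum>(j, s)\<in>{..<J} \<times> {..<R}. Polynomial.smult (r (e, j, s)) (X j * xs s * power_prod n A e))"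
      unfolding \<Phi>_def U_def by (subst sum.cartesian_product) (auto intro!: sum.cong)
    also have "\<dots> = (\<Sum>e\<in>E. T e * power_prod n A e)"
      unfolding T_def sum_distrib_right by (intro sum.cong) auto
    finally have "null_poly (\<Sum>e\<in>E. T e * power_prod n A e)"
      using null by simp
    moreover have "pderiv_null R (T e)" for e
    proof -
      have "pderiv_null R (Polynomial.smult (r (e, j, s)) (X j * xs s))" if "s < R" for j s
      proof -
        have "pderiv_null 1 (X j)"
          unfolding pderiv_null_def X_def using null_poly_pderiv_monom_p by simp
        moreover have "pderiv_null R (Polynomial.smult (r (e, j, s)) (xs s))"
          using that by (intro pderiv_null_degree le_less_trans[OF degree_smult_le]) (simp add: xs_def degree_monom_eq)
        ultimately show ?thesis
          using pderiv_null_mult[of 1 "X j" R "Polynomial.smult (r (e, j, s)) (xs s)"] by simp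
      qed
      then show ?thesis
        unfolding T_def by (intro pderiv_null_sum) auto
    qed
    moreover have "\<exists>a\<in>A. e a \<noteq> f a" if "e \<in> E" "f \<in> E" "e \<noteq> f" for e f
      using that unfolding E_def by (meson PiE_ext)
    ultimately have nullT: "\<forall>e\<in>E. null_poly (T e)"
      using R(1) by (intro power_prod_independent[OF nd A finE, of R]) (auto simp: E_def cardE[unfolded E_def])
    obtain e j s where u: "(e, j, s) \<in> U" "\<not> int p dvd r (e, j, s)"
      using r(1) by auto
    have "1 * R \<le> d * (2 ^ (d ^ card A) * (R + card A))"
      unfolding mult.assoc[symmetric] using \<open>d > 0\<close> by (intro mult_le_mono) auto
    then have "R \<le> p" using R(1) by linarith
    have uniq: "(j', s') = (j, s)" if "s' < R" "p * j' + s' = p * j + s" for j' s'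
    proof -
      have "s < p" "s' < p" using that u \<open>R \<le> p\<close> by (auto simp: U_def)
      then have "(p * j' + s') mod p = s'" "(p * j + s) mod p = s"
        "(p * j' + s') div p = j'" "(p * j + s) div p = j" by auto
      then show ?thesis using that(2) by auto
    qed
    have "poly.coeff (T e) (p * j + s) = (\<Sum>v\<in>{..<J} \<times> {..<R}. if v = (j, s) then r (e, j, s) else 0)"
      unfolding T_def coeff_sum
    proof (intro sum.cong refl)
      fix v assume v: "v \<in> {..<J} \<times> {..<R}"
      obtain j' s' where v': "v = (j', s')" by (cases v)
      have "X j' * xs s' = Polynomial.monom 1 (p * j' + s')"
        by (simp add: X_def xs_def mult_monom)
      then show "poly.coeff (case v of (j, s) \<Rightarrow> Polynomial.smult (r (e, j, s)) (X j * xs s)) (p * j + s) =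
          (if v = (j, s) then r (e, j, s) else 0)"
        using uniq[of s' j'] v by (auto simp: v')
    qed
    also have "\<dots> = r (e, j, s)"
      using u by (simp add: U_def)
    finally have "int p dvd r (e, j, s)"
      using nullT u(1) unfolding null_poly_coeff U_def by (metis SigmaE2)
    with u(2) show False by blast
  qed
  have "M * card (kummer_fibre n A g) \<le> degree \<Phi>"
  proof (rule multiplicity_root_bound[OF nonnull finite_kummer_fibre])
    fix b assume b: "b \<in> kummer_fibre n A g"
    have "\<not> int p dvd poly (linear_prod A) b"
    proof
      assume "int p dvd poly (linear_prod A) b"
      then obtain a where a: "a \<in> A" "int p dvd b + a"
        using prime_int_p A(1) by (auto simp: poly_linear_prod prime_dvd_prod_iff add.commute)
      then have "int p dvd (b + a) ^ n"
        using \<open>n > 0\<close> dvd_power dvd_trans by blast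
      moreover have "[(b + a) ^ n = g a] (mod int p)"
        using b a by (auto simp: kummer_fibre_def)
      ultimately show False
        using g[OF a(1)] cong_dvd_iff by blast
    qed
    then show "\<exists>g. null_poly (\<Phi> - [:-b, 1:] ^ M * g)"
      using root[OF _ b] unfolding weighted_pderiv_def[abs_def]
      by (intro high_order_of_iterate_pderiv[OF nonnull _ M])
  next
    fix b b' assume "b \<in> kummer_fibre n A g" "b' \<in> kummer_fibre n A g" "int p dvd b - b'"
    then show "b = b'"
      by (metis (no_types, lifting) atLeastLessThan_iff kummer_fibre_def mem_Collect_eq mod_eq_dvd_iff mod_pos_pos_trivial)
  qed
  also have "degree \<Phi> \<le> p * (J + card A)"
    unfolding \<Phi>_def
  proof (intro degree_sum_le finU)
    fix u assume "u \<in> U"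
    obtain e j s where u: "u = (e, j, s)" by (cases u)
    have ejs: "e \<in> E" "j < J" "s < R" using \<open>u \<in> U\<close> by (auto simp: u U_def)
    have "1 * R \<le> d * (2 ^ (d ^ card A) * (R + card A))"
      unfolding mult.assoc[symmetric] using \<open>d > 0\<close> by (intro mult_le_mono) auto
    then have "s < p" using R(1) ejs by linarith
    have "(\<Sum>a\<in>A. n * e a) \<le> (\<Sum>a\<in>A. p)"
    proof (intro sum_mono)
      fix a assume "a \<in> A"
      then have "e a \<in> {..<d}" using ejs(1) PiE_mem unfolding E_def by metis
      then have "e a \<le> d" by simp
      then have "n * e a \<le> n * d" by simp
      then show "n * e a \<le> p" using nd by simp
    qed
    moreover have "degree (X j * xs s * power_prod n A e) \<le> p * j + s + (\<Sum>a\<in>A. n * e a)"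
      using degree_mult_le[of "X j * xs s" "power_prod n A e"] degree_power_prod[OF A(1), of n e]
      by (simp add: X_def xs_def mult_monom degree_monom_eq)
    moreover have "p * j + s < p * Suc j" using \<open>s < p\<close> by simp
    moreover have "p * Suc j \<le> p * J" using ejs by (intro mult_le_mono) auto
    ultimately have "degree (X j * xs s * power_prod n A e) \<le> p * (J + card A)"
      by (simp add: distrib_left mult.commute[of "card A" p])
    then show "degree (case u of (e, j, s) \<Rightarrow> Polynomial.smult (r (e, j, s)) (X j * xs s * power_prod n A e)) \<le> p * (J + card A)"
      unfolding u prod.case by (rule order_trans[OF degree_smult_le])
  qed
  finally show ?thesis .
qed


lemma kummer_fibre_unique_root:
  assumes "n * d = p - 1" "a \<in> A" "int p dvd g a"
  shows "card (kummer_fibre n A g) \<le> 1"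
proof -
  have "n > 0" using assms(1) prime_gt_1_nat[OF prime_p] by (auto intro!: Nat.gr0I)
  have "int p dvd x + a" if "x \<in> kummer_fibre n A g" for x
  proof -
    have "[(x + a) ^ n = g a] (mod int p)"
      using that assms by (auto simp: kummer_fibre_def)
    then have "int p dvd (x + a) ^ n"
      using assms(3) cong_dvd_iff by blast
    then show ?thesis
      using prime_dvd_power[OF prime_int_p] by blast
  qed
  then have "x = y" if "x \<in> kummer_fibre n A g" "y \<in> kummer_fibre n A g" for x y
  proof -
    have "int p dvd (x + a) - (y + a)" using that \<open>\<And>x. _ \<Longrightarrow> int p dvd x + a\<close> dvd_diff by blast
    then have "x mod int p = y mod int p" by (simp add: mod_eq_dvd_iff)
    with that show ?thesis by (auto simp: kummer_fibre_def)
  qed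
  then show ?thesis
    by (metis card_le_Suc0_iff_eq finite_kummer_fibre One_nat_def)
qed

text \<open>Put D = d^card A and q = d 2^D. With M about \<surd>p, J about M / D and R about p / q,
  the bound p (J + card A) / M becomes p / D + O(\<surd>p). Here R is essentially as large as
  independence permits, and t is the surplus in J that makes the unknowns outnumber the
  equations.\<close>

lemma kummer_fibre_card_le:
  assumes nd: "n * d = p - 1" and A: "finite A" "incongruent A"
  defines "t \<equiv> 2 * (d * 2 ^ (d ^ card A)) * (card A + 2) + 1"
  shows "real (card (kummer_fibre n A g)) \<le> real p / real (d ^ card A) + real (3 * (t + card A)) * sqrt (real p)"
proof -
  have p1: "1 < p" using prime_p prime_gt_1_nat by blast
  have d0: "d > 0" using nd p1 by (auto intro!: Nat.gr0I)
  define k where "k = card A"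
  define D where "D = d ^ k"
  have D0: "D > 0" using d0 by (simp add: D_def)
  define q where "q = d * 2 ^ D"
  have q0: "q > 0" using d0 by (simp add: q_def)
  have t: "t = 2 * q * (k + 2) + 1" by (simp add: t_def q_def D_def k_def)
  have sp: "1 \<le> sqrt p" using p1 by simp
  show ?thesis
  proof (cases "\<exists>a\<in>A. int p dvd g a")
    case True
    then have "real (card (kummer_fibre n A g)) \<le> 1"
      using kummer_fibre_unique_root[OF nd] by force
    also have "1 \<le> real (3 * (t + card A)) * sqrt p"
      using mult_mono[of 1 "real (3 * (t + card A))" 1 "sqrt p"] sp by (simp add: t)
    also have "\<dots> \<le> real p / real (d ^ card A) + real (3 * (t + card A)) * sqrt (real p)" by simp
    finally show ?thesis .
  next
    case g: False
    show ?thesis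
    proof (cases "p < t * t")
      case True
      \<comment> \<open>Below t^2 the trivial bound p = \<surd>p \<surd>p < t \<surd>p
        suffices.\<close>
      have "card (kummer_fibre n A g) \<le> card {0..<int p}"
        by (intro card_mono) (auto simp: kummer_fibre_def)
      then have "real (card (kummer_fibre n A g)) \<le> sqrt p * sqrt p" by simp
      also have "sqrt p < t"
        using True by (metis of_nat_less_iff of_nat_mult power2_eq_square real_less_lsqrt of_nat_0_le_iff)
      then have "sqrt p * sqrt p \<le> real (3 * (t + card A)) * sqrt p"
        by (intro mult_right_mono) auto
      also have "\<dots> \<le> real p / real (d ^ card A) + real (3 * (t + card A)) * sqrt (real p)" by simp
      finally show ?thesis .
    next
      case False
      define M where "M = nat \<lfloor>sqrt p\<rfloor>"
      have M1: "real M \<le> sqrt p" and M2: "sqrt p < real M + 1" 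
        using sp unfolding M_def by linarith+
      have "real M * real M \<le> sqrt p * sqrt p"
        using M1 by (intro mult_mono) auto
      then have MM: "M * M \<le> p"
        by (simp flip: of_nat_mult)
      have "real t * real t \<le> real p" using False by (simp flip: of_nat_mult)
      then have "real t \<le> sqrt p" by (simp add: real_le_rsqrt power2_eq_square)
      then have tM: "t \<le> M" unfolding M_def by linarith
      have M0: "M > 0" using tM t by simp
      define R where "R = p div q - k"
      define J where "J = M div D + t"
      have "2 * q * (k + 1) \<le> t * 1" by (simp add: t)
      also have "\<dots> \<le> t * t" by (intro mult_le_mono) (auto simp: t)
      finally have pq: "2 * q * (k + 1) \<le> p" using False by simp
      have "p < q * (p div q) + q" using q0 by (metis add.commute dividend_less_div_times mult.commute)
      moreover have "q * (p div q) \<le> q * R + q * k"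
        unfolding R_def by (metis add_mult_distrib2 le_diff_conv mult_le_mono2 order_refl)
      ultimately have QR: "p \<le> 2 * q * R"
        using pq by (simp add: algebra_simps)
      then have R0: "R > 0" using p1 by (auto intro!: Nat.gr0I)
      have "D * (M div D) + M mod D = M" "M mod D < D" using D0 by auto
      then have DJ: "M + t \<le> D * J"
      proof -
        assume *: "D * (M div D) + M mod D = M" "M mod D < D"
        have "t = 1 + (t - 1)" using t by simp
        then have "D * t = D + D * (t - 1)" by (metis add_mult_distrib2 mult_1_right)
        moreover have "1 * (t - 1) \<le> D * (t - 1)" using D0 by (intro mult_le_mono) auto
        ultimately have "D + (t - 1) \<le> D * t" by simp
        then show ?thesis using * t unfolding J_def add_mult_distrib2 by linarith
      qed
      \<comment> \<open>As D J \<ge> M + t, it remains to show that M J + M^2 k is less than t R.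
        The left side is at most (k + 2) p, and p \<le> 2 q R together with t > 2 q (k + 2) gives
        the rest.\<close>
      have "M * (M * k) \<le> k * p"
        using mult_le_mono2[OF MM, of k] by (simp only: mult_ac)
      moreover have "M * J \<le> 2 * p"
      proof -
        have "J \<le> M + t" unfolding J_def by (simp add: div_le_dividend)
        then have "M * J \<le> M * (M + M)" using tM by (intro mult_le_mono) auto
        then show ?thesis using MM by (simp add: algebra_simps)
      qed
      moreover have "(k + 2) * p < t * R"
      proof -
        have "(k + 2) * p \<le> (k + 2) * (2 * q * R)" using QR by (intro mult_le_mono) auto
        also have "\<dots> < t * R" using R0 by (simp add: t algebra_simps)
        finally show ?thesis .
      qed
      ultimately have "M * J + M * (M * k) < t * R"
        unfolding distrib_right by linarith
      moreover have "(M + t) * R \<le> D * J * R" using DJ by (intro mult_le_mono) auto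
      ultimately have big: "M * (R + J + M * k) < D * J * R" by (simp add: algebra_simps)
      have "k \<le> p div q"
        using R0 by (simp add: R_def)
      then have "q * (R + k) = q * (p div q)" by (simp add: R_def)
      also have "\<dots> \<le> p" by simp
      finally have qR: "d * (2 ^ D * (R + k)) \<le> p" by (simp add: q_def mult.assoc)
      have "M * 1 \<le> M * M" using M0 by (intro mult_le_mono) auto
      then have "M \<le> p" using MM by linarith
      have "0 < J" by (simp add: J_def t)
      have "M * card (kummer_fibre n A g) \<le> p * (J + card A)"
        using g qR R0 big by (intro kummer_fibre_bound[OF nd A _ _ R0 \<open>M \<le> p\<close> \<open>0 < J\<close>]) (auto simp: D_def k_def)
      then have "real M * card (kummer_fibre n A g) \<le> real p * (real J + k)"
        unfolding k_def by (metis of_nat_add of_nat_le_iff of_nat_mult)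
      then have "card (kummer_fibre n A g) \<le> real p * (real J + k) / M"
        using M0 by (simp add: field_simps)
      also have "\<dots> \<le> real p * (M / D + (t + k)) / M"
        unfolding J_def using of_nat_div_le_of_nat[of M D] by (intro divide_right_mono mult_left_mono) auto
      also have "\<dots> = p / D + (t + k) * (p / M)"
        using M0 D0 by (simp add: field_simps)
      also have "p / M \<le> 2 * sqrt p"
      proof -
        have "real p = sqrt p * sqrt p" by simp
        also have "\<dots> \<le> sqrt p * (2 * M)" using M2 M0 by (intro mult_left_mono) auto
        finally show ?thesis using M0 by (simp add: field_simps)
      qed
      then have "(t + k) * (p / M) \<le> (t + k) * (2 * sqrt p)" by (intro mult_left_mono) auto
      also have "\<dots> \<le> 3 * (t + k) * sqrt p" using sp by (simp add: algebra_simps)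
      finally show ?thesis by (simp add: D_def k_def)
    qed
  qed
qed

end

section \<open>Stepanov's bound for the product of two set sizes\<close>

lemma higher_pderiv_linear_power:
  "s \<le> N \<Longrightarrow> \<exists>c. \<forall>a :: int. (pderiv ^^ s) ([:a, 1:] ^ N) = Polynomial.smult c ([:a, 1:] ^ (N - s))"
proof (induction s)
  case 0
  show ?case by (intro exI[of _ 1]) simp
next
  case (Suc s)
  then obtain c where c: "\<And>a :: int. (pderiv ^^ s) ([:a, 1:] ^ N) = Polynomial.smult c ([:a, 1:] ^ (N - s))"
    by auto
  have "pderiv ([:a, 1:] ^ (N - s)) = Polynomial.smult (of_nat (N - s)) ([:a, 1:] ^ (N - Suc s))" for a :: int
    by (simp add: pderiv_power pderiv_pCons)
  then show ?case
    by (intro exI[of _ "c * of_nat (N - s)"]) (simp add: c pderiv_smult)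
qed

context prime_modulus
begin

text \<open>Test the vanishing moments against the polynomial of degree card A - 1 whose zeros are A
  - {a}.\<close>

lemma vandermonde_mod_p:
  assumes A: "finite A" "incongruent A"
    and w: "\<And>j. j < card A \<Longrightarrow> int p dvd (\<Sum>a\<in>A. w a * a ^ j)" and a: "a \<in> A"
  shows "int p dvd w a"
proof -
  define P where "P = (\<Prod>b\<in>A - {a}. [:-b, 1:])"
  have "degree P = card A - 1"
    unfolding P_def using A a by (subst degree_prod_sum_eq) auto
  moreover have "card A > 0" using A a card_gt_0_iff by blast
  ultimately have deg: "j < card A" if "j \<le> degree P" for j using that by simp
  have "(\<Sum>b\<in>A. w b * poly P b) = (\<Sum>b\<in>A. \<Sum>j\<le>degree P. poly.coeff P j * (w b * b ^ j))"
    by (simp add: poly_altdef sum_distrib_left mult_ac)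
  also have "\<dots> = (\<Sum>j\<le>degree P. poly.coeff P j * (\<Sum>b\<in>A. w b * b ^ j))"
    by (subst sum.swap) (simp add: sum_distrib_left)
  finally have "(\<Sum>b\<in>A. w b * poly P b) = (\<Sum>j\<le>degree P. poly.coeff P j * (\<Sum>b\<in>A. w b * b ^ j))" .
  moreover have "int p dvd (\<Sum>j\<le>degree P. poly.coeff P j * (\<Sum>b\<in>A. w b * b ^ j))"
    by (rule dvd_sum, rule dvd_mult, rule w, rule deg) simp
  ultimately have "int p dvd (\<Sum>b\<in>A. w b * poly P b)"
    by simp
  also have "(\<Sum>b\<in>A. w b * poly P b) = w a * poly P a"
  proof -
    have "poly P b = 0" if "b \<in> A - {a}" for b
      using that A by (auto simp: P_def poly_prod)
    then show ?thesis using A a by (subst sum.remove[of _ a]) auto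
  qed
  finally have "int p dvd w a \<or> int p dvd (\<Prod>b\<in>A - {a}. a - b)"
    by (simp add: prime_dvd_mult_int P_def poly_prod)
  moreover have "\<not> int p dvd (\<Prod>b\<in>A - {a}. a - b)"
    using A a prime_int_p by (auto simp: prime_dvd_prod_iff incongruent_def)
  ultimately show ?thesis by blast
qed

lemma incongruentD: "incongruent S \<Longrightarrow> b \<in> S \<Longrightarrow> c \<in> S \<Longrightarrow> int p dvd b - c \<Longrightarrow> b = c"
  unfolding incongruent_def by blast

lemma incongruent_subset_range: "S \<subseteq> {0..<int p} \<Longrightarrow> incongruent S"
  unfolding incongruent_def
  by (metis atLeastLessThan_iff mod_eq_dvd_iff mod_pos_pos_trivial subset_eq)

lemma inverse_mod_p: "\<not> int p dvd a \<Longrightarrow> \<exists>b. [a * b = 1] (mod int p)"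
  using prime_int_p by (metis cong_solve_coprime_int coprime_commute prime_imp_coprime)

text \<open>With \<open>\<Sum>\<^sub>a c\<^sub>a a\<^sup>t = 0\<close> for \<open>t < m - 1\<close>, where \<open>m = card A\<close>, the polynomial
  \<open>\<Sum>\<^sub>a c\<^sub>a a\<^sup>-\<^sup>n (x + a)\<^bsup>n + m - 1\<^esup> - \<Sum>\<^sub>a c\<^sub>a a\<^bsup>m - 1\<^esup>\<close> vanishes to order \<open>m\<close> on \<open>B\<close>.\<close>
lemma stepanov_product_bound:
  assumes A: "finite A" "incongruent A" "A \<noteq> {}" "\<And>a. a \<in> A \<Longrightarrow> \<not> int p dvd a"
    and B: "finite B" "incongruent B"
    and AB: "\<And>a b. a \<in> A \<Longrightarrow> b \<in> B \<Longrightarrow> [(b + a) ^ n = a ^ n] (mod int p)"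
    and n: "0 < n" "n + card A - 1 < p"
  shows "card A * card B \<le> n + card A - 1"
proof -
  define m where "m = card A"
  define N where "N = n + m - 1"
  have m0: "m > 0" using A by (simp add: m_def card_gt_0_iff)
  have "card {..<m - 1} < card A" using m0 by (simp add: m_def)
  from homogeneous_system_mod_p[OF A(1) _ this, of "\<lambda>t a. a ^ t"]
  obtain c where c: "\<exists>a\<in>A. \<not> int p dvd c a" "\<And>t. t < m - 1 \<Longrightarrow> int p dvd (\<Sum>a\<in>A. c a * a ^ t)"
    by auto
  define \<sigma> where "\<sigma> = (\<Sum>a\<in>A. c a * a ^ (m - 1))"
  have "\<exists>w. \<forall>a\<in>A. [a ^ n * w a = 1] (mod int p)"
    using A(4) prime_dvd_power[OF prime_int_p] inverse_mod_p by (intro bchoice) blast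
  then obtain w where w: "\<And>a. a \<in> A \<Longrightarrow> [a ^ n * w a = 1] (mod int p)" by blast
  \<comment> \<open>Expanding (b + a)^t shows that the vanishing of the moments below m - 1 is
    invariant under translation, and hence so is the moment \<sigma> of order m - 1.\<close>
  have shifted: "[(\<Sum>a\<in>A. c a * (b + a) ^ t) = (if t = m - 1 then \<sigma> else 0)] (mod int p)"
    if "t \<le> m - 1" for t b
  proof -
    have "(\<Sum>a\<in>A. c a * (b + a) ^ t) = (\<Sum>a\<in>A. \<Sum>j\<le>t. of_nat (t choose j) * b ^ (t - j) * (c a * a ^ j))"
      by (subst add.commute) (simp add: binomial_ring sum_distrib_left mult_ac)
    also have "\<dots> = (\<Sum>j\<le>t. of_nat (t choose j) * b ^ (t - j) * (\<Sum>a\<in>A. c a * a ^ j))"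
      by (subst sum.swap) (simp add: sum_distrib_left)
    also have "[\<dots> = (\<Sum>j\<le>t. of_nat (t choose j) * b ^ (t - j) * (if j = m - 1 then \<sigma> else 0))] (mod int p)"
    proof (rule cong_sum, rule cong_scalar_left)
      fix j assume "j \<in> {..t}"
      show "[(\<Sum>a\<in>A. c a * a ^ j) = (if j = m - 1 then \<sigma> else 0)] (mod int p)"
        using c(2)[of j] \<open>j \<in> {..t}\<close> that by (auto simp: \<sigma>_def cong_0_iff)
    qed
    also have "(\<Sum>j\<le>t. of_nat (t choose j) * b ^ (t - j) * (if j = m - 1 then \<sigma> else 0)) = (if t = m - 1 then \<sigma> else 0)"
    proof -
      have "(\<Sum>j\<le>t. of_nat (t choose j) * b ^ (t - j) * (if j = m - 1 then \<sigma> else 0)) =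
        (\<Sum>j\<le>t. if j = m - 1 then of_nat (t choose j) * b ^ (t - j) * \<sigma> else 0)"
        by (intro sum.cong) auto
      also have "\<dots> = (if t = m - 1 then \<sigma> else 0)"
        using that by (auto simp: sum.delta)
      finally show ?thesis .
    qed
    finally show ?thesis .
  qed
  define f where "f = (\<Sum>a\<in>A. Polynomial.smult (c a * w a) ([:a, 1:] ^ N)) - [:\<sigma>:]"
  have reduce: "[(\<Sum>a\<in>A. c a * w a * (b + a) ^ (n + t)) = (\<Sum>a\<in>A. c a * (b + a) ^ t)] (mod int p)"
    if "b \<in> B" for b t
  proof (rule cong_sum)
    fix a assume a: "a \<in> A"
    have "[w a * (b + a) ^ n = w a * a ^ n] (mod int p)"
      using AB[OF a that] by (rule cong_scalar_left)
    also have "[w a * a ^ n = 1] (mod int p)" using w[OF a] by (simp add: mult.commute)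
    finally have "[c a * (b + a) ^ t * (w a * (b + a) ^ n) = c a * (b + a) ^ t * 1] (mod int p)"
      by (rule cong_scalar_left)
    then show "[c a * w a * (b + a) ^ (n + t) = c a * (b + a) ^ t] (mod int p)"
      by (simp add: power_add mult_ac)
  qed
  \<comment> \<open>On \<open>B\<close> the factor (b + a)^n cancels against a^(-n), so the s-th
    derivative of the sum reduces to a constant times the translated moment of order m - 1 - s: it
    is \<sigma> for s = 0 and 0 for 0 < s < m. The constant is the same for all a, which lets the
    relation among the coefficients survive derivation.\<close>
  have root: "int p dvd poly ((pderiv ^^ s) f) b" if b: "b \<in> B" and s: "s < m" for b s
  proof (cases "s = 0")
    case True
    have "poly f b = (\<Sum>a\<in>A. c a * w a * (b + a) ^ (n + (m - 1))) - \<sigma>"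
      using m0 by (simp add: f_def poly_sum N_def add.commute)
    moreover have "[(\<Sum>a\<in>A. c a * w a * (b + a) ^ (n + (m - 1))) = \<sigma>] (mod int p)"
      using cong_trans[OF reduce[OF b, of "m - 1"] shifted[of "m - 1" b]] by simp
    ultimately show ?thesis using True by (simp add: cong_iff_dvd_diff)
  next
    case False
    obtain k where k: "\<And>a :: int. (pderiv ^^ s) ([:a, 1:] ^ N) = Polynomial.smult k ([:a, 1:] ^ (N - s))"
    proof -
      have "s \<le> N" using s n(1) by (simp add: N_def)
      then show ?thesis using higher_pderiv_linear_power that by blast
    qed
    have "(pderiv ^^ s) [:\<sigma>:] = 0"
      using False by (cases s) (simp_all add: funpow_Suc_right pderiv_pCons del: funpow.simps)
    have "poly ((pderiv ^^ s) f) b = k * (\<Sum>a\<in>A. c a * w a * (b + a) ^ (n + (m - 1 - s)))"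
    proof -
      have "N - s = n + (m - 1 - s)" using s by (simp add: N_def)
      then show ?thesis
        using \<open>(pderiv ^^ s) [:\<sigma>:] = 0\<close>
        by (simp only: f_def higher_pderiv_diff higher_pderiv_sum higher_pderiv_smult k)
           (simp add: poly_sum sum_distrib_left add.commute[of b] mult_ac)
    qed
    moreover have "int p dvd (\<Sum>a\<in>A. c a * w a * (b + a) ^ (n + (m - 1 - s)))"
    proof -
      have *: "m - 1 - s \<le> m - 1" "m - 1 - s \<noteq> m - 1" using False s by simp_all
      show ?thesis
        using cong_trans[OF reduce[OF b] shifted[OF *(1), of b]] unfolding if_not_P[OF *(2)] cong_0_iff .
    qed
    ultimately show ?thesis by simp
  qed
  have nonnull: "\<not> null_poly f"
  proof
    assume null: "null_poly f"
    have "int p dvd c a * w a" if "a \<in> A" for a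
    proof (rule vandermonde_mod_p[OF A(1,2) _ that])
      fix j assume j: "j < card A"
      \<comment> \<open>As 0 < n, the index N - j is positive and the constant term \<sigma> does
        not enter this coefficient.\<close>
      have "j < N" using j n by (simp add: N_def m_def)
      have "poly.coeff f (N - j) = (\<Sum>a\<in>A. c a * w a * (of_nat (N choose (N - j)) * a ^ j))"
        using \<open>j < N\<close> by (simp add: f_def coeff_sum coeff_linear_poly_power coeff_pCons split: nat.splits)
      also have "\<dots> = of_nat (N choose j) * (\<Sum>a\<in>A. c a * w a * a ^ j)"
        using \<open>j < N\<close> by (simp add: sum_distrib_left mult_ac binomial_symmetric[of j N])
      finally have "int p dvd of_nat (N choose j) * (\<Sum>a\<in>A. c a * w a * a ^ j)"
        using null unfolding null_poly_coeff by metis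
      \<comment> \<open>The binomial coefficient divides N!, and N < p.\<close>
      moreover have "\<not> p dvd N choose j"
      proof
        assume "p dvd N choose j"
        moreover have "(N choose j) dvd fact N"
          using \<open>j < N\<close> binomial_fact_lemma[of j N] by (metis dvd_triv_right less_imp_le_nat)
        ultimately show False
          using prime_dvd_fact_iff[OF prime_p, of N] n dvd_trans by (auto simp: N_def m_def)
      qed
      ultimately show "int p dvd (\<Sum>a\<in>A. c a * w a * a ^ j)"
        by (simp add: prime_dvd_mult_int)
    qed
    moreover have "\<not> int p dvd w a" if "a \<in> A" for a
      using w[OF that] prime_int_p by (metis cong_dvd_iff dvd_mult not_prime_unit)
    ultimately show False using c(1) by (auto simp: prime_dvd_mult_int)
  qed
  have "m * card B \<le> degree f"
  proof (rule multiplicity_root_bound[OF nonnull B(1) incongruentD[OF B(2)]])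
    fix b assume b: "b \<in> B"
    have "\<not> int p dvd poly 1 b" using prime_int_p not_prime_unit by auto
    then show "\<exists>g. null_poly (f - [:-b, 1:] ^ m * g)"
      using root[OF b] n by (intro high_order_of_iterate_pderiv[OF nonnull, of 1]) (auto simp: m_def)
  qed
  also have "degree f \<le> N"
    unfolding f_def by (intro degree_diff_le degree_sum_le A)
      (auto intro!: order_trans[OF degree_smult_le] order_trans[OF degree_linear_power[THEN eq_refl]])
  finally show ?thesis by (simp add: m_def N_def)
qed

lemma card_power_cong_le:
  assumes "0 < m"
  shows "card {x \<in> {0..<int p}. [x ^ m = c] (mod int p)} \<le> m"
proof -
  let ?S = "{x \<in> {0..<int p}. [x ^ m = c] (mod int p)}" and ?f = "Polynomial.monom 1 m - [:c:]"
  have 1: "poly.coeff ?f m = 1"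
    using assms by (simp add: coeff_pCons split: nat.splits)
  have "degree ?f \<le> m"
    by (intro degree_diff_le) (auto simp: degree_monom_eq)
  moreover have "m \<le> degree ?f"
    using 1 by (intro le_degree) simp
  ultimately have deg: "degree ?f = m" by simp
  have "lead_coeff ?f = 1"
    unfolding deg by (rule 1)
  then have "\<not> null_poly ?f" by (rule not_null_poly_monic)
  then have "1 * card ?S \<le> degree ?f"
  proof (rule multiplicity_root_bound)
    show "finite ?S" by (rule finite_subset[of _ "{0..<int p}"]) auto
    fix b c' assume "b \<in> ?S" "c' \<in> ?S" "int p dvd b - c'"
    then show "b = c'" using incongruentD[OF incongruent_subset_range[of ?S]] by blast
  next
    fix b assume "b \<in> ?S"
    then have "int p dvd poly ?f b" by (simp add: poly_monom cong_iff_dvd_diff)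
    from null_poly_linear_factor[OF this]
    show "\<exists>g. null_poly (?f - [:-b, 1:] ^ 1 * g)" by auto
  qed
  then show ?thesis using deg by simp
qed

end

text \<open>The factor of \<surd>p in \<open>kummer_fibre_card_le\<close>, that is, 3 (t + card
  A).\<close>

definition stepanov_const :: "nat \<Rightarrow> nat \<Rightarrow> nat"
  where "stepanov_const d k = 3 * (2 * (d * 2 ^ (d ^ k)) * (k + 2) + 1 + k)"

text \<open>A fibre is bounded below by means of the others: k accounts for the zeros of the k
  linear forms, and each of fewer than d^k other fibres contributes the error
  \<open>stepanov_const d k\<close>.\<close>

definition deviation_const :: "nat \<Rightarrow> nat \<Rightarrow> nat"
  where "deviation_const d k = k + d ^ k * stepanov_const d k"

text \<open>Products of at most four distinct indicators occur in the fourth moment; the sum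
  majorises all their error constants.\<close>

definition moment_const :: "nat \<Rightarrow> nat"
  where "moment_const d = (\<Sum>k\<le>4. deviation_const d k)"

context prime_modulus
begin

section \<open>Simultaneous power conditions\<close>

definition affine_fibre :: "nat \<Rightarrow> int set \<Rightarrow> (int \<Rightarrow> int) \<Rightarrow> int set"
  where "affine_fibre n S c = {x \<in> {0..<int p}. \<forall>a\<in>S. [(a * x + 1) ^ n = c a] (mod int p)}"

lemma finite_affine_fibre [simp]: "finite (affine_fibre n S c)"
  by (rule finite_subset[of _ "{0..<int p}"]) (auto simp: affine_fibre_def)

lemma unit_range_not_dvd: "a \<in> {1..<int p} \<Longrightarrow> \<not> int p dvd a"
  by (auto dest: zdvd_imp_le)

lemma inverse_mod_p_set:
  assumes "S \<subseteq> {1..<int p}"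
  obtains iv where "\<And>a. a \<in> S \<Longrightarrow> [a * iv a = 1] (mod int p)" "inj_on iv S" "incongruent (iv ` S)"
    "\<And>a. a \<in> S \<Longrightarrow> \<not> int p dvd iv a"
proof -
  have "\<forall>a\<in>S. \<exists>b. [a * b = 1] (mod int p)"
    using assms unit_range_not_dvd inverse_mod_p by blast
  then obtain iv where iv: "\<And>a. a \<in> S \<Longrightarrow> [a * iv a = 1] (mod int p)"
    by metis
  have cong: "a = a'" if "a \<in> S" "a' \<in> S" "int p dvd iv a - iv a'" for a a'
  proof -
    have "[iv a = iv a'] (mod int p)" using that by (simp add: cong_iff_dvd_diff)
    then have "[a' * (a * iv a) = a' * (a * iv a')] (mod int p)"
      by (intro cong_scalar_left)
    moreover have "[a' * (a * iv a) = a' * 1] (mod int p)" using iv[OF that(1)] by (rule cong_scalar_left)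
    moreover have "[a * (a' * iv a') = a * 1] (mod int p)" using iv[OF that(2)] by (rule cong_scalar_left)
    ultimately have "[a' * 1 = a * 1] (mod int p)"
      by (metis cong_sym cong_trans mult.left_commute)
    then have "int p dvd a' - a" by (simp add: cong_iff_dvd_diff)
    moreover have "incongruent S" using assms by (intro incongruent_subset_range) auto
    ultimately show ?thesis using that incongruentD by metis
  qed
  have "inj_on iv S" by (rule inj_onI) (use cong in auto)
  moreover have "incongruent (iv ` S)" unfolding incongruent_def using cong by blast
  moreover have "\<not> int p dvd iv a" if "a \<in> S" for a
    using iv[OF that] prime_int_p by (metis cong_dvd_iff dvd_mult not_prime_unit)
  ultimately show thesis using that iv by blast
qed

text \<open>Since a x + 1 = a (x + 1/a), this is contained in a fibre for the shifts 1/a with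
  rescaled values.\<close>

lemma card_affine_fibre_le:
  assumes nd: "n * d = p - 1" and S: "S \<subseteq> {1..<int p}"
  shows "real (card (affine_fibre n S c)) \<le> real p / real (d ^ card S) + stepanov_const d (card S) * sqrt (real p)"
proof -
  obtain iv where iv: "\<And>a. a \<in> S \<Longrightarrow> [a * iv a = 1] (mod int p)" "inj_on iv S" "incongruent (iv ` S)"
    using inverse_mod_p_set[OF S] by metis
  have fin: "finite S" using S finite_subset by blast
  define g where "g y = c (inv_into S iv y) * y ^ n" for y
  have "affine_fibre n S c \<subseteq> kummer_fibre n (iv ` S) g"
  proof
    fix x assume x: "x \<in> affine_fibre n S c"
    have "[(x + iv a) ^ n = g (iv a)] (mod int p)" if a: "a \<in> S" for a
    proof -
      have "[x * 1 + iv a = x * (a * iv a) + iv a] (mod int p)"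
        using iv(1)[OF a] by (intro cong_add cong_scalar_left cong_refl) (rule cong_sym)
      then have "[(x + iv a) ^ n = (x * (a * iv a) + iv a) ^ n] (mod int p)"
        by (intro cong_pow) simp
      also have "x * (a * iv a) + iv a = (a * x + 1) * iv a" by (simp add: algebra_simps)
      also have "[((a * x + 1) * iv a) ^ n = c a * iv a ^ n] (mod int p)"
        unfolding power_mult_distrib using x a by (intro cong_scalar_right) (auto simp: affine_fibre_def)
      finally show ?thesis using a iv(2) by (simp add: g_def)
    qed
    then show "x \<in> kummer_fibre n (iv ` S) g"
      using x by (auto simp: kummer_fibre_def affine_fibre_def)
  qed
  then have "card (affine_fibre n S c) \<le> card (kummer_fibre n (iv ` S) g)"
    by (intro card_mono) auto
  moreover have "card (iv ` S) = card S" using iv(2) by (rule card_image)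
  ultimately show ?thesis
    using kummer_fibre_card_le[OF nd finite_imageI[OF fin] iv(3), of g] unfolding stepanov_const_def
    by (simp only:)
qed

lemma fermat_int: "\<not> int p dvd y \<Longrightarrow> [y ^ (p - 1) = 1] (mod int p)"
proof -
  assume y: "\<not> int p dvd y"
  have "y * y ^ (p - 1) = y ^ p"
    using prime_gt_0_nat[OF prime_p] by (metis mult.commute power_minus_mult)
  then have "y ^ p - y = y * (y ^ (p - 1) - 1)"
    by (simp add: algebra_simps)
  moreover have "int p dvd y ^ p - y"
    using fermat_power_p[of y 1] by (simp add: cong_iff_dvd_diff)
  ultimately show ?thesis
    using y by (simp add: prime_dvd_mult_int cong_iff_dvd_diff)
qed

lemma card_affine_root_le: "a \<in> {1..<int p} \<Longrightarrow> card {x \<in> {0..<int p}. int p dvd a * x + 1} \<le> 1"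
proof -
  assume a: "a \<in> {1..<int p}"
  let ?Z = "{x \<in> {0..<int p}. int p dvd a * x + 1}"
  have "x = y" if "x \<in> ?Z" "y \<in> ?Z" for x y
  proof -
    have "int p dvd (a * x + 1) - (a * y + 1)" using that by (intro dvd_diff) auto
    then have "int p dvd a * (x - y)" by (simp add: algebra_simps)
    then have "int p dvd x - y" using unit_range_not_dvd[OF a] prime_dvd_mult_int by blast
    then show "x = y" using incongruentD[OF incongruent_subset_range[of ?Z]] that by blast
  qed
  moreover have "finite ?Z" by (rule finite_subset[of _ "{0..<int p}"]) auto
  ultimately show "card ?Z \<le> 1" by (metis (no_types, lifting) card_le_Suc0_iff_eq One_nat_def)
qed

text \<open>Outside the at most card S zeros of the forms a x + 1, every residue lies in a fibre
  whose values are d-th roots of unity. There are at most d^card S such fibres, so the upper bound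
  for all the others leaves the asserted number for this one.\<close>

lemma card_affine_fibre_ge:
  assumes nd: "n * d = p - 1" and S: "S \<subseteq> {1..<int p}" and c: "\<And>a. a \<in> S \<Longrightarrow> [c a ^ d = 1] (mod int p)"
  shows "real (card (affine_fibre n S c)) \<ge> real p / real (d ^ card S) - deviation_const d (card S) * sqrt (real p)"
proof -
  have p1: "1 < p" using prime_p prime_gt_1_nat by blast
  have d0: "d > 0" using nd p1 by (auto intro!: Nat.gr0I)
  have fin: "finite S" using S finite_subset by blast
  define k where "k = card S"
  define K where "K = real (stepanov_const d k)"
  define \<mu> where "\<mu> = {y \<in> {0..<int p}. [y ^ d = 1] (mod int p)}"
  have fin_mu: "finite \<mu>" unfolding \<mu>_def by (rule finite_subset[of _ "{0..<int p}"]) auto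
  have card_mu: "card \<mu> \<le> d" unfolding \<mu>_def using d0 by (rule card_power_cong_le)
  define c0 where "c0 = restrict (\<lambda>a. c a mod int p) S"
  have c0: "c0 \<in> PiE S (\<lambda>_. \<mu>)"
    using c p1 by (auto simp: c0_def \<mu>_def Cong.cong_def power_mod)
  have fib0: "affine_fibre n S c0 = affine_fibre n S c"
    by (auto simp: affine_fibre_def c0_def Cong.cong_def)
  let ?P = "PiE S (\<lambda>_. \<mu>)"
  have finP: "finite ?P" using fin fin_mu by (intro finite_PiE) auto
  define Z where "Z = (\<Union>a\<in>S. {x \<in> {0..<int p}. int p dvd a * x + 1})"
  have cardZ: "card Z \<le> k"
  proof -
    have "card Z \<le> (\<Sum>a\<in>S. card {x \<in> {0..<int p}. int p dvd a * x + 1})"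
      unfolding Z_def using fin by (rule card_UN_le)
    also have "\<dots> \<le> (\<Sum>a\<in>S. 1)" using S by (intro sum_mono card_affine_root_le) auto
    finally show ?thesis by (simp add: k_def)
  qed
  have finZ: "finite Z"
    by (rule finite_subset[of _ "{0..<int p}"]) (auto simp: Z_def)
  have cover: "{0..<int p} \<subseteq> Z \<union> (\<Union>c'\<in>?P. affine_fibre n S c')"
  proof
    fix x assume x: "x \<in> {0..<int p}"
    show "x \<in> Z \<union> (\<Union>c'\<in>?P. affine_fibre n S c')"
    proof (cases "x \<in> Z")
      case False
      define c' where "c' = restrict (\<lambda>a. (a * x + 1) ^ n mod int p) S"
      have "[((a * x + 1) ^ n) ^ d = 1] (mod int p)" if "a \<in> S" for a
        using False x that fermat_int[of "a * x + 1"] unfolding power_mult[symmetric] nd by (auto simp: Z_def)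
      then have "c' \<in> ?P"
        using p1 by (auto simp: c'_def \<mu>_def Cong.cong_def power_mod)
      moreover have "x \<in> affine_fibre n S c'"
        using x by (auto simp: affine_fibre_def c'_def Cong.cong_def)
      ultimately show ?thesis by blast
    qed simp
  qed
  define b where "b = real p / real (d ^ k) + K * sqrt p"
  have "K \<ge> 0" by (simp add: K_def)
  then have b0: "b \<ge> 0" by (simp add: b_def)
  have "p = card {0..<int p}" by simp
  also have "\<dots> \<le> card (Z \<union> (\<Union>c'\<in>?P. affine_fibre n S c'))"
    using cover finZ finP by (intro card_mono) auto
  also have "\<dots> \<le> card Z + card (\<Union>c'\<in>?P. affine_fibre n S c')"
    by (rule card_Un_le)
  also have "\<dots> \<le> k + (\<Sum>c'\<in>?P. card (affine_fibre n S c'))"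
    using cardZ card_UN_le[OF finP] by (intro add_mono) auto
  finally have "real p \<le> k + (\<Sum>c'\<in>?P. real (card (affine_fibre n S c')))"
    by (metis (mono_tags, lifting) of_nat_add of_nat_le_iff of_nat_sum sum.cong)
  also have "(\<Sum>c'\<in>?P. real (card (affine_fibre n S c'))) =
      card (affine_fibre n S c) + (\<Sum>c'\<in>?P - {c0}. real (card (affine_fibre n S c')))"
    using finP c0 fib0 by (subst sum.remove[of _ c0]) auto
  also have "(\<Sum>c'\<in>?P - {c0}. real (card (affine_fibre n S c'))) \<le> (\<Sum>c'\<in>?P - {c0}. b)"
    unfolding b_def K_def k_def by (intro sum_mono card_affine_fibre_le[OF nd S])
  also have "\<dots> = real (card (?P - {c0})) * b" by simp
  also have "real (card (?P - {c0})) * b \<le> (real (d ^ k) - 1) * b"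
  proof (rule mult_right_mono[OF _ b0])
    have "card (?P - {c0}) + 1 = card ?P"
      using finP c0 by (metis card_Suc_Diff1 Suc_eq_plus1)
    also have "\<dots> \<le> d ^ k" using card_mu by (simp add: card_PiE fin k_def power_mono)
    finally show "real (card (?P - {c0})) \<le> real (d ^ k) - 1" by linarith
  qed
  also have "(real (d ^ k) - 1) * b = real p - real p / real (d ^ k) + (real (d ^ k) - 1) * (K * sqrt p)"
    unfolding b_def using d0 by (simp add: field_simps)
  also have "(real (d ^ k) - 1) * (K * sqrt p) \<le> real (d ^ k) * (K * sqrt p)"
    using \<open>K \<ge> 0\<close> by (intro mult_right_mono) auto
  finally have "real p / real (d ^ k) - k - real (d ^ k) * (K * sqrt p) \<le> card (affine_fibre n S c)"
    by simp
  moreover have "real k * 1 \<le> real k * sqrt p" using p1 by (intro mult_left_mono) auto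
  ultimately show ?thesis
    by (simp add: deviation_const_def K_def k_def algebra_simps)
qed

lemma card_affine_fibre_approx:
  assumes nd: "n * d = p - 1" and S: "S \<subseteq> {1..<int p}"
  shows "\<bar>real (card (affine_fibre n S (\<lambda>_. 1))) - real p / real (d ^ card S)\<bar> \<le> deviation_const d (card S) * sqrt (real p)"
proof -
  have p1: "1 < p" using prime_p prime_gt_1_nat by blast
  have "d > 0" using nd p1 by (auto intro!: Nat.gr0I)
  then have "1 * stepanov_const d (card S) \<le> d ^ card S * stepanov_const d (card S)"
    by (intro mult_le_mono) auto
  then have "real (stepanov_const d (card S)) \<le> deviation_const d (card S)"
    unfolding deviation_const_def of_nat_le_iff by linarith
  then have "stepanov_const d (card S) * sqrt (real p) \<le> deviation_const d (card S) * sqrt (real p)"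
    by (intro mult_right_mono) auto
  then show ?thesis
    using card_affine_fibre_le[OF nd S, of "\<lambda>_. 1"] card_affine_fibre_ge[OF nd S, of "\<lambda>_. 1"] by auto
qed

section \<open>The fourth moment of the centred indicators\<close>

definition affine_ind :: "nat \<Rightarrow> int \<Rightarrow> int \<Rightarrow> real"
  where "affine_ind n a x = (if [(a * x + 1) ^ n = 1] (mod int p) then 1 else 0)"

lemma affine_ind_idem [simp]: "affine_ind n a x * affine_ind n a x = affine_ind n a x"
  by (simp add: affine_ind_def)

lemma sum_prod_affine_ind:
  assumes "finite V"
  shows "(\<Sum>x\<in>{0..<int p}. \<Prod>a\<in>V. affine_ind n a x) = card (affine_fibre n V (\<lambda>_. 1))"
proof -
  have "(\<Prod>a\<in>V. affine_ind n a x) = (if \<forall>a\<in>V. [(a * x + 1) ^ n = 1] (mod int p) then 1 else 0)" for x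
    using assms by (induction V rule: finite_induct) (auto simp: affine_ind_def)
  then show ?thesis
    by (simp add: affine_fibre_def sum.If_cases Int_def)
qed

text \<open>Expand the factors of v, w and y into products of indicators over sets V. In each sum
  the main term p / d^(card V + 1) cancels against 1/d times p / d^card V, because u is not in V;
  coincidences among v, w, y are absorbed by idempotence. The 1 + 3 + 3 + 1 sums contribute two
  error terms each, whence 16.\<close>

lemma fourth_moment_unique_term:
  assumes nd: "n * d = p - 1" and V: "{u, v, w, y} \<subseteq> {1..<int p}" and u: "u \<notin> {v, w, y}"
  defines "f a x \<equiv> affine_ind n a x - 1 / d"
  shows "\<bar>\<Sum>x\<in>{0..<int p}. f u x * f v x * f w x * f y x\<bar> \<le> 16 * moment_const d * sqrt p"
proof -
  have p1: "1 < p" using prime_p prime_gt_1_nat by blast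
  have d0: "d > 0" using nd p1 by (auto intro!: Nat.gr0I)
  define \<delta> where "\<delta> = 1 / real d"
  have \<delta>: "0 \<le> \<delta>" "\<delta> \<le> 1" using d0 by (auto simp: \<delta>_def)
  define P where "P V x = (\<Prod>a\<in>V. affine_ind n a x)" for V x
  define F where "F V = (\<Sum>x\<in>{0..<int p}. (affine_ind n u x - \<delta>) * P V x)" for V
  define s where "s = moment_const d * sqrt p"
  have approx: "\<bar>(\<Sum>x\<in>{0..<int p}. P V x) - real p / real (d ^ card V)\<bar> \<le> s"
    if "finite V" "V \<subseteq> {1..<int p}" "card V \<le> 4" for V
  proof -
    have "deviation_const d (card V) \<le> moment_const d"
      unfolding moment_const_def using that by (intro member_le_sum) auto
    then have "deviation_const d (card V) * sqrt p \<le> s"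
      unfolding s_def by (intro mult_right_mono) auto
    then show ?thesis
      using card_affine_fibre_approx[OF nd that(2)] unfolding P_def sum_prod_affine_ind[OF that(1)] by linarith
  qed
  have F: "\<bar>F V\<bar> \<le> 2 * s" if "V \<subseteq> {v, w, y}" for V
  proof -
    have V': "finite V" "u \<notin> V" "V \<subseteq> {1..<int p}" "insert u V \<subseteq> {1..<int p}"
      using that V u finite_subset by auto
    have "card V \<le> card {v, w, y}" using that by (intro card_mono) auto
    also have "\<dots> \<le> 3" by (simp add: card_insert_if)
    finally have "card V \<le> 3" .
    have "F V = (\<Sum>x\<in>{0..<int p}. P (insert u V) x) - \<delta> * (\<Sum>x\<in>{0..<int p}. P V x)"
      using V' by (simp add: F_def P_def left_diff_distrib sum_subtractf sum_distrib_left)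
    also have "\<dots> = ((\<Sum>x\<in>{0..<int p}. P (insert u V) x) - real p / real (d ^ card (insert u V))) -
       \<delta> * ((\<Sum>x\<in>{0..<int p}. P V x) - real p / real (d ^ card V))"
      using V' d0 by (simp add: \<delta>_def field_simps)
    also have "\<bar>\<dots>\<bar> \<le> s + 1 * s"
    proof (rule order_trans[OF abs_triangle_ineq4], rule add_mono)
      show "\<bar>(\<Sum>x\<in>{0..<int p}. P (insert u V) x) - real p / real (d ^ card (insert u V))\<bar> \<le> s"
        using V' \<open>card V \<le> 3\<close> by (intro approx) auto
      show "\<bar>\<delta> * ((\<Sum>x\<in>{0..<int p}. P V x) - real p / real (d ^ card V))\<bar> \<le> 1 * s"
        unfolding abs_mult using V' \<open>card V \<le> 3\<close> \<delta> by (intro mult_mono approx) auto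
    qed
    finally show ?thesis by simp
  qed
  have PP: "affine_ind n a x * P V x = P (insert a V) x" if "finite V" for a V x
  proof (cases "a \<in> V")
    case True
    then have "P V x = affine_ind n a x * P (V - {a}) x"
      unfolding P_def using that by (rule prod.remove[rotated])
    moreover have "insert a V = V" using True by auto
    ultimately show ?thesis by (simp flip: mult.assoc)
  qed (use that in \<open>simp add: P_def\<close>)
  have "f u x * f v x * f w x * f y x =
      (affine_ind n u x - \<delta>) * P {v, w, y} x
      - \<delta> * ((affine_ind n u x - \<delta>) * P {v, w} x + (affine_ind n u x - \<delta>) * P {v, y} x + (affine_ind n u x - \<delta>) * P {w, y} x)
      + \<delta> ^ 2 * ((affine_ind n u x - \<delta>) * P {v} x + (affine_ind n u x - \<delta>) * P {w} x + (affine_ind n u x - \<delta>) * P {y} x)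
      - \<delta> ^ 3 * ((affine_ind n u x - \<delta>) * P {} x)" for x
  proof -
    have "P {} x = 1" by (simp add: P_def)
    then have "P {v, w, y} x = affine_ind n v x * affine_ind n w x * affine_ind n y x"
      "P {v, w} x = affine_ind n v x * affine_ind n w x" "P {v, y} x = affine_ind n v x * affine_ind n y x"
      "P {w, y} x = affine_ind n w x * affine_ind n y x"
      "P {v} x = affine_ind n v x" "P {w} x = affine_ind n w x" "P {y} x = affine_ind n y x"
      by (simp_all flip: PP)
    moreover have "U * (a - \<delta>) * (b - \<delta>) * (c - \<delta>) = U * (a * b * c) - \<delta> * (U * (a * b) + U * (a * c) + U * (b * c))
        + \<delta> ^ 2 * (U * a + U * b + U * c) - \<delta> ^ 3 * (U * 1)" for U a b c
      by (simp add: algebra_simps power2_eq_square power3_eq_cube)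
    ultimately show ?thesis
      unfolding f_def \<delta>_def[symmetric] \<open>P {} x = 1\<close> by (simp only:)
  qed
  then have "(\<Sum>x\<in>{0..<int p}. f u x * f v x * f w x * f y x) =
      F {v, w, y} - \<delta> * (F {v, w} + F {v, y} + F {w, y}) + \<delta> ^ 2 * (F {v} + F {w} + F {y}) - \<delta> ^ 3 * F {}"
    by (simp only: F_def sum.distrib sum_subtractf sum_distrib_left[symmetric])
  also have "\<bar>\<dots>\<bar> \<le> 2 * s + 6 * s + 6 * s + 2 * s"
  proof -
    have sm: "\<bar>c * (a1 + a2 + a3)\<bar> \<le> 6 * s" if "0 \<le> c" "c \<le> 1" "\<bar>a1\<bar> \<le> 2 * s" "\<bar>a2\<bar> \<le> 2 * s" "\<bar>a3\<bar> \<le> 2 * s" for c a1 a2 a3 :: real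
    proof -
      have "\<bar>c * (a1 + a2 + a3)\<bar> \<le> 1 * \<bar>a1 + a2 + a3\<bar>"
        unfolding abs_mult using that by (intro mult_right_mono) auto
      also have "1 * \<bar>a1 + a2 + a3\<bar> \<le> 6 * s" 
        using abs_triangle_ineq[of "a1 + a2" a3] abs_triangle_ineq[of a1 a2] that(3-5) by simp
      finally show ?thesis .
    qed
    have "\<bar>\<delta> * (F {v, w} + F {v, y} + F {w, y})\<bar> \<le> 6 * s" using \<delta> by (intro sm F) auto
    moreover have "\<bar>\<delta> ^ 2 * (F {v} + F {w} + F {y})\<bar> \<le> 6 * s" using \<delta> by (intro sm F power_le_one) auto
    moreover have "\<bar>\<delta> ^ 3 * F {}\<bar> \<le> 2 * s"
    proof -
      have "\<bar>\<delta> ^ 3 * F {}\<bar> \<le> 1 * \<bar>F {}\<bar>"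
        unfolding abs_mult using \<delta> by (intro mult_right_mono) (auto simp: power_le_one)
      also have "\<bar>F {}\<bar> \<le> 2 * s" by (intro F) auto
      finally show ?thesis by simp
    qed
    moreover have "\<bar>F {v, w, y}\<bar> \<le> 2 * s" by (intro F) auto
    ultimately show ?thesis by linarith
  qed
  finally show ?thesis by (simp add: s_def)
qed

text \<open>A quadruple in which no entry differs from the three others splits into two pairs of
  equal entries. Three pairings give at most 3 (card A)^2 of these, and for them the trivial bound p
  is used.\<close>

lemma fourth_moment_bound:
  assumes nd: "n * d = p - 1" and A: "A \<subseteq> {1..<int p}"
  defines "f a x \<equiv> affine_ind n a x - 1 / d"
  shows "(\<Sum>x\<in>{0..<int p}. (\<Sum>a\<in>A. f a x) ^ 4) \<le> 3 * card A ^ 2 * p + 16 * moment_const d * sqrt p * card A ^ 4"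
proof -
  have p1: "1 < p" using prime_p prime_gt_1_nat by blast
  have d0: "d > 0" using nd p1 by (auto intro!: Nat.gr0I)
  have fin: "finite A" using A finite_subset by blast
  let ?I = "{0..<int p}"
  define s where "s = 16 * moment_const d * sqrt p"
  define e where "e P = (if P then real p else 0)" for P
  have f1: "\<bar>f a x\<bar> \<le> 1" for a x
    using d0 by (auto simp: f_def affine_ind_def)
  have triv: "(\<Sum>x\<in>?I. f a x * f b x * f c x * f d x) \<le> p" for a b c d
  proof -
    have "f a x * f b x * f c x * f d x \<le> 1" for x
    proof -
      have "\<bar>f a x * f b x * f c x * f d x\<bar> \<le> 1"
        unfolding abs_mult by (intro mult_le_one mult_nonneg_nonneg f1) auto
      then show ?thesis by simp
    qed
    then have "(\<Sum>x\<in>?I. f a x * f b x * f c x * f d x) \<le> (\<Sum>x\<in>?I. 1)" by (rule sum_mono)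
    then show ?thesis by simp
  qed
  have bound: "(\<Sum>x\<in>?I. f a x * f b x * f c x * f d x) \<le> s + e (a = b \<and> c = d) + e (a = c \<and> b = d) + e (a = d \<and> b = c)"
    if "a \<in> A" "b \<in> A" "c \<in> A" "d \<in> A" for a b c d
  proof -
    have s0: "s \<ge> 0" by (simp add: s_def)
    have e0: "e P \<ge> 0" for P by (simp add: e_def)
    have in1: "{a, b, c, d} \<subseteq> {1..<int p}" using that A by auto
    have uniq: "(\<Sum>x\<in>?I. f u x * f v x * f w x * f y x) \<le> s" if "{u, v, w, y} \<subseteq> {1..<int p}" "u \<notin> {v, w, y}" for u v w y
      using fourth_moment_unique_term[OF nd that] unfolding s_def f_def by linarith
    consider (ab) "a = b \<and> c = d" | (ac) "a = c \<and> b = d" | (ad) "a = d \<and> b = c"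
      | (a) "a \<notin> {b, c, d}" | (b) "b \<notin> {a, c, d}" | (c) "c \<notin> {a, b, d}" | (d) "d \<notin> {a, b, c}"
      by auto
    then show ?thesis
    proof cases
      case a
      with uniq[of a b c d] in1 e0 show ?thesis by (smt (verit))
    next
      case b
      have "(\<Sum>x\<in>?I. f a x * f b x * f c x * f d x) = (\<Sum>x\<in>?I. f b x * f a x * f c x * f d x)"
        by (intro sum.cong) auto
      also have "\<dots> \<le> s" using b in1 by (intro uniq) auto
      finally show ?thesis using e0 by (smt (verit))
    next
      case c
      have "(\<Sum>x\<in>?I. f a x * f b x * f c x * f d x) = (\<Sum>x\<in>?I. f c x * f a x * f b x * f d x)"
        by (intro sum.cong) auto
      also have "\<dots> \<le> s" using c in1 by (intro uniq) auto
      finally show ?thesis using e0 by (smt (verit))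
    next
      case d
      have "(\<Sum>x\<in>?I. f a x * f b x * f c x * f d x) = (\<Sum>x\<in>?I. f d x * f a x * f b x * f c x)"
        by (intro sum.cong) auto
      also have "\<dots> \<le> s" using d in1 by (intro uniq) auto
      finally show ?thesis using e0 by (smt (verit))
    next
      case ab
      then have "e (a = b \<and> c = d) = p" by (simp add: e_def)
      then show ?thesis using triv[of a b c d] s0 e0[of "a = c \<and> b = d"] e0[of "a = d \<and> b = c"] by linarith
    next
      case ac
      then have "e (a = c \<and> b = d) = p" by (simp add: e_def)
      then show ?thesis using triv[of a b c d] s0 e0[of "a = b \<and> c = d"] e0[of "a = d \<and> b = c"] by linarith
    next
      case ad
      then have "e (a = d \<and> b = c) = p" by (simp add: e_def)
      then show ?thesis using triv[of a b c d] s0 e0[of "a = c \<and> b = d"] e0[of "a = b \<and> c = d"] by linarith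
    qed
  qed
  have "(\<Sum>a\<in>A. f a x) ^ 4 = (\<Sum>a\<in>A. \<Sum>b\<in>A. \<Sum>c\<in>A. \<Sum>d\<in>A. f a x * f b x * f c x * f d x)" for x
    by (simp add: power4_eq_xxxx sum_distrib_left sum_distrib_right mult_ac)
  then have "(\<Sum>x\<in>?I. (\<Sum>a\<in>A. f a x) ^ 4) = (\<Sum>a\<in>A. \<Sum>b\<in>A. \<Sum>c\<in>A. \<Sum>d\<in>A. \<Sum>x\<in>?I. f a x * f b x * f c x * f d x)"
    by (simp add: sum.swap[of _ _ ?I])
  also have "\<dots> \<le> (\<Sum>a\<in>A. \<Sum>b\<in>A. \<Sum>c\<in>A. \<Sum>d\<in>A. s + e (a = b \<and> c = d) + e (a = c \<and> b = d) + e (a = d \<and> b = c))"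
    by (intro sum_mono bound)
  also have "\<dots> = 3 * card A ^ 2 * p + s * card A ^ 4"
  proof -
    have "(\<Sum>c\<in>A. \<Sum>d\<in>A. e (P \<and> c = d)) = (if P then card A * real p else 0)" for P
      using fin by (cases P) (simp_all add: e_def sum.delta)
    then have "(\<Sum>a\<in>A. \<Sum>b\<in>A. \<Sum>c\<in>A. \<Sum>d\<in>A. e (a = b \<and> c = d)) = card A ^ 2 * p"
      using fin by (simp add: sum.delta power2_eq_square)
    moreover have "(\<Sum>a\<in>A. \<Sum>b\<in>A. \<Sum>c\<in>A. \<Sum>d\<in>A. e (a = c \<and> b = d)) =
        (\<Sum>a\<in>A. \<Sum>b\<in>A. \<Sum>c\<in>A. if a = c then real p else 0)"
    proof (intro sum.cong refl)
      fix a b c assume "b \<in> A"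
      then show "(\<Sum>d\<in>A. e (a = c \<and> b = d)) = (if a = c then real p else 0)"
        using fin by (cases "a = c") (simp_all add: e_def sum.delta)
    qed
    moreover have "(\<Sum>a\<in>A. \<Sum>b\<in>A. \<Sum>c\<in>A. \<Sum>d\<in>A. e (a = d \<and> b = c)) =
        (\<Sum>a\<in>A. \<Sum>b\<in>A. \<Sum>c\<in>A. if b = c then real p else 0)"
    proof (intro sum.cong refl)
      fix a b c assume "a \<in> A"
      then show "(\<Sum>d\<in>A. e (a = d \<and> b = c)) = (if b = c then real p else 0)"
        using fin by (cases "b = c") (simp_all add: e_def sum.delta)
    qed
    ultimately show ?thesis
      unfolding sum.distrib using fin by (simp add: sum.delta power2_eq_square power4_eq_xxxx)
  qed
  finally show ?thesis by (simp add: s_def)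
qed

end

text \<open>For card A < 192 d, comparing two estimates for the size of \<open>B\<close> forces
  \<surd>p below the first summand unless card A = d = 2; the second summand is for that
  case.\<close>

definition size_threshold :: "nat \<Rightarrow> nat"
  where "size_threshold d =
    d ^ (192 * d) * (192 * d * (\<Sum>k\<le>192 * d. stepanov_const d k) + 2) + 8 * moment_const d"

context prime_modulus
begin

section \<open>Multiplicative decompositions\<close>

text \<open>Membership in the group of d-th powers is tested by y^n = 1, where n d = p - 1, and
  everything is stated through congruences so that the polynomial arguments apply directly.\<close>

definition decomposes :: "nat \<Rightarrow> int set \<Rightarrow> int set \<Rightarrow> bool"
  where "decomposes n A B \<longleftrightarrow> A \<subseteq> {1..<int p} \<and> B \<subseteq> {1..<int p} \<and>
    (\<forall>a\<in>A. \<forall>b\<in>B. [(a * b + 1) ^ n = 1] (mod int p)) \<and>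
    (\<forall>y. [y ^ n = 1] (mod int p) \<longrightarrow> \<not> [y = 1] (mod int p) \<longrightarrow> (\<exists>a\<in>A. \<exists>b\<in>B. [y - 1 = a * b] (mod int p)))"

lemma decomposes_sym: "decomposes n A B \<Longrightarrow> decomposes n B A"
  unfolding decomposes_def by (metis mult.commute)

lemma decomposes_finite: "decomposes n A B \<Longrightarrow> finite A \<and> finite B"
  unfolding decomposes_def using finite_subset by blast

definition roots_of_unity_mod :: "nat \<Rightarrow> int set"
  where "roots_of_unity_mod n = {y \<in> {0..<int p}. [y ^ n = 1] (mod int p)}"

lemma finite_roots_of_unity_mod [simp]: "finite (roots_of_unity_mod n)"
  unfolding roots_of_unity_mod_def by (rule finite_subset[of _ "{0..<int p}"]) auto

text \<open>The map x -> x^d has fibres of at most d elements, hence at least n values, whereas y^n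
  = 1 has at most n solutions.\<close>

lemma roots_of_unity_mod_eq_powers:
  assumes nd: "n * d = p - 1"
  shows "roots_of_unity_mod n = (\<lambda>x. x ^ d mod int p) ` {1..<int p}" "card (roots_of_unity_mod n) = n"
proof -
  have p1: "1 < p" using prime_p prime_gt_1_nat by blast
  have d0: "d > 0" and n0: "n > 0" using nd p1 by (auto intro!: Nat.gr0I)
  let ?T = "(\<lambda>x. x ^ d mod int p) ` {1..<int p}"
  have sub: "?T \<subseteq> roots_of_unity_mod n"
  proof (rule image_subsetI)
    fix x assume x: "x \<in> {1..<int p}"
    have "[(x ^ d mod int p) ^ n = x ^ (p - 1)] (mod int p)"
      unfolding nd[symmetric] by (simp add: Cong.cong_def power_mod power_mult mult.commute[of n])
    then show "x ^ d mod int p \<in> roots_of_unity_mod n"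
      using fermat_int[OF unit_range_not_dvd[OF x]] p1 cong_trans by (auto simp: roots_of_unity_mod_def)
  qed
  have "{1..<int p} \<subseteq> (\<Union>y\<in>?T. {x \<in> {0..<int p}. [x ^ d = y] (mod int p)})"
  proof
    fix x assume "x \<in> {1..<int p}"
    then have "x \<in> {z \<in> {0..<int p}. [z ^ d = x ^ d mod int p] (mod int p)}" by (auto simp: Cong.cong_def)
    with \<open>x \<in> {1..<int p}\<close> show "x \<in> (\<Union>y\<in>?T. {x \<in> {0..<int p}. [x ^ d = y] (mod int p)})" by blast
  qed
  moreover have "finite {x \<in> {0..<int p}. [x ^ d = y] (mod int p)}" for y
    by (rule finite_subset[of _ "{0..<int p}"]) auto
  ultimately have "card {1..<int p} \<le> card (\<Union>y\<in>?T. {x \<in> {0..<int p}. [x ^ d = y] (mod int p)})"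
    by (intro card_mono) auto
  also have "\<dots> \<le> (\<Sum>y\<in>?T. card {x \<in> {0..<int p}. [x ^ d = y] (mod int p)})"
    by (intro card_UN_le) auto
  also have "\<dots> \<le> (\<Sum>y\<in>?T. d)"
    using d0 by (intro sum_mono card_power_cong_le)
  finally have "n * d \<le> card ?T * d" using nd by simp
  then have "n \<le> card ?T" using d0 by simp
  moreover have le: "card (roots_of_unity_mod n) \<le> n"
    unfolding roots_of_unity_mod_def using n0 by (rule card_power_cong_le)
  ultimately have "card (roots_of_unity_mod n) \<le> card ?T" by simp
  then show "roots_of_unity_mod n = ?T"
    using card_seteq[OF finite_roots_of_unity_mod sub] by simp
  with \<open>n \<le> card ?T\<close> le show "card (roots_of_unity_mod n) = n" by simp
qed

text \<open>The products cover n - 1 residues, which is the lower bound. For the upper bound divide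
  by a: b + 1/a and 1/a have the same n-th power, and this is also true of b = 0. So
  \<open>stepanov_product_bound\<close> applies to the inverses of A and to B with 0 added, and this
  one additional point improves |A| |B| \<le> n + |A| - 1 to |A| |B| \<le> n - 1.\<close>

lemma decomposes_card:
  assumes nd: "n * d = p - 1" and d: "d \<ge> 2" and dec: "decomposes n A B" and ne: "A \<noteq> {}" "B \<noteq> {}"
  shows "card A * card B = n - 1"
proof -
  have p1: "1 < p" using prime_p prime_gt_1_nat by blast
  have n0: "n > 0" using nd p1 by (auto intro!: Nat.gr0I)
  have fin: "finite A" "finite B" using decomposes_finite[OF dec] by auto
  have AB: "A \<subseteq> {1..<int p}" "B \<subseteq> {1..<int p}" using dec by (auto simp: decomposes_def)
  have ab: "[(a * b + 1) ^ n = 1] (mod int p)" if "a \<in> A" "b \<in> B" for a b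
    using dec that by (auto simp: decomposes_def)
  let ?G = "roots_of_unity_mod n"
  let ?f = "\<lambda>(a, b). (a * b + 1) mod int p"
  have "?G - {1} \<subseteq> ?f ` (A \<times> B)"
  proof
    fix y assume y: "y \<in> ?G - {1}"
    then have "\<not> [y = 1] (mod int p)" using p1 by (auto simp: roots_of_unity_mod_def Cong.cong_def)
    then obtain a b where ab: "a \<in> A" "b \<in> B" "[y - 1 = a * b] (mod int p)"
      using dec y by (auto simp: decomposes_def roots_of_unity_mod_def)
    have "[y - 1 + 1 = a * b + 1] (mod int p)" using ab(3) by (intro cong_add cong_refl)
    then have "y = ?f (a, b)" using y by (auto simp: roots_of_unity_mod_def Cong.cong_def)
    with ab show "y \<in> ?f ` (A \<times> B)" by blast
  qed
  then have "card (?G - {1}) \<le> card (A \<times> B)"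
    using fin by (meson card_image_le card_mono finite_SigmaI finite_imageI le_trans)
  moreover have "card (?G - {1}) = n - 1"
    using p1 roots_of_unity_mod_eq_powers(2)[OF nd] by (subst card_Diff_singleton) (auto simp: roots_of_unity_mod_def)
  ultimately have ge: "n - 1 \<le> card A * card B" by (simp add: card_cartesian_product)
  obtain b0 where b0: "b0 \<in> B" using ne by auto
  have "card A \<le> card ?G"
  proof (rule card_inj_on_le[of "\<lambda>a. (a * b0 + 1) mod int p"])
    show "inj_on (\<lambda>a. (a * b0 + 1) mod int p) A"
    proof (rule inj_onI)
      fix a a' assume "a \<in> A" "a' \<in> A" "(a * b0 + 1) mod int p = (a' * b0 + 1) mod int p"
      then have "int p dvd (a - a') * b0" by (simp add: mod_eq_dvd_iff algebra_simps)
      then have "int p dvd a - a'"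
        using b0 AB unit_range_not_dvd prime_dvd_mult_int by blast
      moreover have "incongruent A" using AB by (intro incongruent_subset_range) auto
      ultimately show "a = a'" using \<open>a \<in> A\<close> \<open>a' \<in> A\<close> incongruentD by blast
    qed
    show "(\<lambda>a. (a * b0 + 1) mod int p) ` A \<subseteq> ?G"
      using ab b0 p1 by (auto simp: roots_of_unity_mod_def Cong.cong_def power_mod)
  qed simp
  then have "card A \<le> n" using roots_of_unity_mod_eq_powers(2)[OF nd] by simp
  \<comment> \<open>Together with card A \<le> n, this keeps the degree n + card A - 1 below
    p.\<close>
  moreover have "n * 2 \<le> n * d" using d by (rule mult_le_mono2)
  ultimately have small: "n + card A - 1 < p" using nd n0 p1 by linarith
  obtain iv where iv: "\<And>a. a \<in> A \<Longrightarrow> [a * iv a = 1] (mod int p)" "inj_on iv A" "incongruent (iv ` A)"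
    "\<And>a. a \<in> A \<Longrightarrow> \<not> int p dvd iv a"
    using inverse_mod_p_set[OF AB(1)] by metis
  have "card (iv ` A) * card (insert 0 B) \<le> n + card (iv ` A) - 1"
  proof (rule stepanov_product_bound)
    show "incongruent (insert 0 B)" using AB p1 by (intro incongruent_subset_range) auto
    show "n + card (iv ` A) - 1 < p" using small iv(2) by (simp add: card_image)
    fix y b assume "y \<in> iv ` A" "b \<in> insert 0 B"
    then obtain a where a: "a \<in> A" "y = iv a" by auto
    show "[(b + y) ^ n = y ^ n] (mod int p)"
    proof (cases "b = 0")
      case False
      then have b: "b \<in> B" using \<open>b \<in> insert 0 B\<close> by simp
      have "[b * 1 + y = b * (a * y) + y] (mod int p)"
        unfolding a(2) using iv(1)[OF a(1)] by (intro cong_add cong_scalar_left cong_refl) (rule cong_sym)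
      then have "[(b + y) ^ n = (b * (a * y) + y) ^ n] (mod int p)" by (intro cong_pow) simp
      also have "(b * (a * y) + y) ^ n = y ^ n * (a * b + 1) ^ n"
        unfolding power_mult_distrib[symmetric] by (simp add: algebra_simps)
      also have "[\<dots> = y ^ n * 1] (mod int p)" using ab[OF a(1) b] by (rule cong_scalar_left)
      finally show ?thesis by simp
    qed simp
  qed (use iv fin ne n0 in auto)
  moreover have "0 \<notin> B" using AB by auto
  ultimately have "card A * (card B + 1) \<le> n + card A - 1"
    using iv(2) fin by (simp add: card_image)
  then have "card A * card B \<le> n - 1" using n0 by (simp add: algebra_simps)
  with ge show ?thesis by simp
qed

lemma decomposes_subset_affine_fibre: "decomposes n A B \<Longrightarrow> B \<subseteq> affine_fibre n A (\<lambda>_. 1)"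
  unfolding decomposes_def affine_fibre_def by force

text \<open>If \<open>A = {a, b}\<close> and \<open>d = 2\<close>, then \<open>x\<close> with \<open>x + 1\<close> a square and both \<open>x b/a + 1\<close>, \<open>x a/b + 1\<close>
  nonsquares would be in neither \<open>a B\<close> nor \<open>b B\<close>.\<close>
lemma no_pair_factor_squares:
  assumes nd: "n * 2 = p - 1" and dec: "decomposes n A B" and A: "card A = 2"
    and big: "8 * real (moment_const 2) < sqrt p"
  shows False
proof -
  have p1: "1 < p" using prime_p prime_gt_1_nat by blast
  then have p2: "2 < p" using nd by presburger
  obtain a b where ab: "A = {a, b}" "a \<noteq> b" using A by (meson card_2_iff)
  have AB: "A \<subseteq> {1..<int p}" using dec by (auto simp: decomposes_def)
  have an: "\<not> int p dvd a" "\<not> int p dvd b" using AB ab unit_range_not_dvd by auto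
  obtain a' b' where inv: "[a * a' = 1] (mod int p)" "[b * b' = 1] (mod int p)"
    using an inverse_mod_p by blast
  define r where "r = (b * a') mod int p"
  define s where "s = (a * b') mod int p"
  have ra: "[r * a = b] (mod int p)"
  proof -
    have "[r = b * a'] (mod int p)" by (simp add: r_def Cong.cong_def)
    from cong_scalar_right[OF this, of a] have "[r * a = b * (a * a')] (mod int p)" by (simp only: mult_ac)
    also have "[b * (a * a') = b * 1] (mod int p)" using inv(1) by (rule cong_scalar_left)
    finally show ?thesis by simp
  qed
  have sb: "[s * b = a] (mod int p)"
  proof -
    have "[s = a * b'] (mod int p)" by (simp add: s_def Cong.cong_def)
    from cong_scalar_right[OF this, of b] have "[s * b = a * (b * b')] (mod int p)" by (simp only: mult_ac)
    also have "[a * (b * b') = a * 1] (mod int p)" using inv(2) by (rule cong_scalar_left)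
    finally show ?thesis by simp
  qed
  have neq: "a = b" if "[a = b] (mod int p)"
  proof -
    have "incongruent A" using AB by (intro incongruent_subset_range) auto
    then show ?thesis using that ab incongruentD[of A a b] by (simp add: cong_iff_dvd_diff)
  qed
  have r1: "r \<noteq> 1" "s \<noteq> 1" using ra sb ab neq by (auto dest: cong_sym)
  have "\<not> int p dvd r" "\<not> int p dvd s"
    using ra sb an by (metis cong_dvd_iff dvd_mult2)+
  then have "r \<noteq> 0" "s \<noteq> 0" by auto
  moreover have "0 \<le> r" "r < int p" "0 \<le> s" "s < int p" using p1 by (auto simp: r_def s_def)
  ultimately have S: "{1, r, s} \<subseteq> {1..<int p}" using p1 by auto
  define c :: "int \<Rightarrow> int" where "c x = (if x = 1 then 1 else -1)" for x
  have "real (card (affine_fibre n {1, r, s} c)) \<ge> real p / real (2 ^ card {1, r, s}) - deviation_const 2 (card {1, r, s}) * sqrt (real p)"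
    by (rule card_affine_fibre_ge[OF nd S]) (simp add: c_def)
  \<comment> \<open>The set has three elements, or two if r = s, which happens for b = -a modulo
    p.\<close>
  moreover have "real p / 8 \<le> real p / real (2 ^ card {1, r, s})"
  proof -
    have "(2::nat) ^ card {1, r, s} \<le> 2 ^ 3" by (intro power_increasing) (auto simp: card_insert_if)
    then have "real (2 ^ card {1, r, s}) \<le> 8" by (metis numeral_eq_Suc of_nat_le_iff of_nat_numeral power3_eq_cube numeral_times_numeral semiring_norm(11-18))
    then show ?thesis by (intro divide_left_mono) auto
  qed
  moreover have "deviation_const 2 (card {1, r, s}) * sqrt (real p) \<le> moment_const 2 * sqrt p"
    unfolding moment_const_def by (intro mult_right_mono of_nat_mono member_le_sum) (auto simp: card_insert_if)
  moreover have "moment_const 2 * sqrt p < real p / 8"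
  proof -
    have "8 * real (moment_const 2) * sqrt p < sqrt p * sqrt p" using big p1 by (intro mult_strict_right_mono) auto
    then show ?thesis by simp
  qed
  ultimately have "0 < real (card (affine_fibre n {1, r, s} c))" by linarith
  then obtain x where x: "x \<in> affine_fibre n {1, r, s} c" by (auto simp: card_gt_0_iff)
  have x1: "[(x + 1) ^ n = 1] (mod int p)" using x by (auto simp: affine_fibre_def c_def)
  have xr: "[(r * x + 1) ^ n = -1] (mod int p)" "[(s * x + 1) ^ n = -1] (mod int p)"
    using x r1 by (auto simp: affine_fibre_def c_def)
  have pm: "\<not> [1 = -1] (mod int p)"
    using p2 by (auto simp: cong_iff_dvd_diff dest: zdvd_imp_le)
  have "\<not> [x + 1 = 1] (mod int p)"
  proof
    assume "[x + 1 = 1] (mod int p)"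
    then have "int p dvd x" by (simp add: cong_iff_dvd_diff)
    then have "[r * x + 1 = 0 + 1] (mod int p)" by (intro cong_add cong_refl) (simp add: cong_0_iff)
    then have "[(r * x + 1) ^ n = 1] (mod int p)" using cong_pow by fastforce
    then show False using xr(1) pm cong_sym cong_trans by blast
  qed
  with x1 dec obtain u v where uv: "u \<in> A" "v \<in> B" "[x = u * v] (mod int p)"
    by (auto simp: decomposes_def)
  \<comment> \<open>If x = u v, then multiplication by r or s turns u into the other element w of
    \<open>A\<close>, and w v + 1 is a square.\<close>
  have key: False if "[t * u = w] (mod int p)" "w \<in> A" "[(t * x + 1) ^ n = -1] (mod int p)" for t w
  proof -
    have "[t * x + 1 = t * (u * v) + 1] (mod int p)" using uv(3) by (intro cong_add cong_scalar_left cong_refl)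
    also have "t * (u * v) + 1 = t * u * v + 1" by simp
    also have "[t * u * v + 1 = w * v + 1] (mod int p)" using that(1) by (intro cong_add cong_scalar_right cong_refl)
    finally have "[(t * x + 1) ^ n = (w * v + 1) ^ n] (mod int p)" by (rule cong_pow)
    moreover have "[(w * v + 1) ^ n = 1] (mod int p)" using dec that uv by (auto simp: decomposes_def)
    ultimately show False using that(3) pm by (meson cong_sym cong_trans)
  qed
  show False using uv(1) ab key[OF _ _ xr(1), of b] key[OF _ _ xr(2), of a] ra sb by auto
qed

text \<open>For \<open>m = card A \<ge> 192 d\<close> the diagonal term \<open>3 m\<^sup>2 p\<close> of the fourth moment is at most half of the contribution
  of \<open>B\<close>. For smaller \<open>m\<close>, \<open>B\<close> would have at most \<open>p / d\<^sup>m + O(\<surd>p)\<close> elements, which is less than \<open>(n - 1) / m\<close>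
  unless \<open>m = d = 2\<close>.\<close>
lemma decomposes_card_bound:
  assumes nd: "n * d = p - 1" and d: "d \<ge> 2" and dec: "decomposes n A B" and AB: "card A \<ge> 2" "card B \<ge> 2"
    and big: "real (size_threshold d) < sqrt p"
  shows "card B \<le> 512 * moment_const d * sqrt p"
proof -
  have p1: "1 < p" using prime_p prime_gt_1_nat by blast
  have sp: "1 < sqrt p" using p1 by simp
  define m where "m = card A"
  have A: "A \<subseteq> {1..<int p}" and B: "B \<subseteq> {1..<int p}" using dec by (auto simp: decomposes_def)
  have fin: "finite A" "finite B" using decomposes_finite[OF dec] by auto
  have "A \<noteq> {}" "B \<noteq> {}" using AB by auto
  then have mB: "m * card B = n - 1" unfolding m_def by (intro decomposes_card[OF nd d dec])
  have "2 * 2 \<le> m * card B" unfolding m_def using AB by (intro mult_le_mono)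
  then have n5: "n \<ge> 5" using mB by simp
  have p_eq: "real p = real n * real d + 1" using nd p1 by (metis Suc_diff_1 Suc_eq_plus1 of_nat_1 of_nat_add of_nat_mult less_trans zero_less_one)
  show ?thesis
  proof (cases "m \<ge> 192 * d")
    case True
    define E where "E = real (moment_const d)"
    define \<delta> where "\<delta> = 1 / real d"
    have \<delta>: "1 / 2 \<le> 1 - \<delta>" using d by (simp add: \<delta>_def field_simps)
    have m0: "m > 0" using True d by simp
    let ?F = "\<lambda>x. (\<Sum>a\<in>A. affine_ind n a x - 1 / d) ^ 4"
    have "(real m / 2) ^ 4 \<le> ?F x" if "x \<in> B" for x
    proof -
      have "(\<Sum>a\<in>A. affine_ind n a x - 1 / d) = (\<Sum>a\<in>A. 1 - \<delta>)"
        using dec that by (intro sum.cong) (auto simp: decomposes_def affine_ind_def \<delta>_def)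
      also have "\<dots> = m * (1 - \<delta>)" by (simp add: m_def)
      finally have eq: "(\<Sum>a\<in>A. affine_ind n a x - 1 / d) = m * (1 - \<delta>)" .
      have "real m * (1 / 2) \<le> m * (1 - \<delta>)" using \<delta> by (intro mult_left_mono) auto
      then show ?thesis unfolding eq by (intro power_mono) auto
    qed
    then have "(\<Sum>x\<in>B. (real m / 2) ^ 4) \<le> (\<Sum>x\<in>B. ?F x)" by (rule sum_mono)
    also have "\<dots> \<le> (\<Sum>x\<in>{0..<int p}. ?F x)" using B by (intro sum_mono2) auto
    also have "\<dots> \<le> 3 * m ^ 2 * p + 16 * E * sqrt p * m ^ 4"
      using fourth_moment_bound[OF nd A] by (simp add: m_def E_def)
    finally have "card B * real m ^ 4 / 16 \<le> 3 * real m ^ 2 * p + 16 * E * sqrt p * m ^ 4"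
      by (simp add: power_divide)
    then have "card B * real m ^ 2 * real m ^ 2 \<le> (48 * p + 256 * E * sqrt p * m ^ 2) * real m ^ 2"
      by (simp add: algebra_simps flip: power_add)
    then have *: "card B * real m ^ 2 \<le> 48 * p + 256 * E * sqrt p * m ^ 2"
      using m0 by (subst (asm) mult_le_cancel_right) auto
    have "real p \<le> 2 * d * (real m * card B)"
    proof -
      have *: "real n = real m * card B + 1" using mB n5 by (simp flip: of_nat_mult)
      then have "real d * 4 \<le> real d * (real m * card B)" using n5 by (intro mult_left_mono) auto
      moreover have "real p = real d * (real m * card B) + real d + 1"
        unfolding p_eq * by (simp add: algebra_simps)
      moreover have "2 \<le> real d" using d by simp
      ultimately show ?thesis by linarith
    qed
    \<comment> \<open>48 is 3 * 2^4, from the three pairings and the lower bound m / 2 for the sum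
      on \<open>B\<close>. The condition m \<ge> 192 d lets half of |B| m^2 absorb this
      term.\<close>
    then have "48 * real p \<le> 96 * d * (real m * card B)" by simp
    also have "\<dots> = (96 * real d) * (real m * card B)" by simp
    also have "\<dots> \<le> (real m / 2) * (real m * card B)"
    proof (rule mult_right_mono)
      have "real (192 * d) \<le> real m" using True unfolding of_nat_le_iff .
      then show "96 * real d \<le> real m / 2" by simp
    qed simp
    finally have "48 * real p \<le> (real m / 2) * (real m * card B)" .
    moreover have "(real m / 2) * (real m * card B) = card B * real m ^ 2 / 2" by (simp add: power2_eq_square)
    moreover have "(512 * E * sqrt p) * real m ^ 2 = 2 * (256 * E * sqrt p * real m ^ 2)" by simp
    moreover have "card B * real m ^ 2 \<le> 48 * real p + 256 * E * sqrt p * real m ^ 2" using * by simp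
    ultimately have "card B * real m ^ 2 \<le> (512 * E * sqrt p) * real m ^ 2" by linarith
    then have "card B \<le> 512 * E * sqrt p"
      using m0 by (subst (asm) mult_le_cancel_right) auto
    then show ?thesis by (simp add: E_def)
  next
    case False
    define K where "K = (\<Sum>k\<le>192 * d. stepanov_const d k)"
    \<comment> \<open>Comparing |B| = (n - 1) / m with |B| \<le> p / d^m + O(\<surd>p) is
      contradictory for large p as soon as d^(m - 1) exceeds m.\<close>
    have "d ^ (m - 1) \<ge> m + 1 \<or> (m = 2 \<and> d = 2)"
    proof (cases "d = 2")
      case True
      have "2 ^ (k + 2) \<ge> k + 4" for k :: nat by (induction k) auto
      from this[of "m - 3"] have "2 ^ (m - 1) \<ge> m + 1" if "m \<noteq> 2"
      proof -
        have "m - 3 + 2 = m - 1" "m - 3 + 4 = m + 1" using that AB(1) unfolding m_def by simp_all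
        then show ?thesis using \<open>m - 3 + 4 \<le> _\<close> by (simp only:)
      qed
      then show ?thesis using True by blast
    next
      case False
      have "3 ^ (k + 1) \<ge> k + 3" for k :: nat by (induction k) auto
      from this[of "m - 2"] have "3 ^ (m - 1) \<ge> m + 1"
      proof -
        have "m - 2 + 1 = m - 1" "m - 2 + 3 = m + 1" using AB(1) unfolding m_def by simp_all
        then show ?thesis using \<open>m - 2 + 3 \<le> _\<close> by (simp only:)
      qed
      also have "3 ^ (m - 1) \<le> d ^ (m - 1)" using d False by (intro power_mono) auto
      finally show ?thesis by simp
    qed
    then show ?thesis
    proof
      assume pair: "m = 2 \<and> d = 2"
      have "8 * moment_const d \<le> size_threshold d" by (simp add: size_threshold_def)
      then have "8 * real (moment_const 2) < sqrt p" using big pair by (metis le_less_trans of_nat_le_iff of_nat_mult of_nat_numeral)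
      then show ?thesis using no_pair_factor_squares[of n A B] nd dec pair unfolding m_def by auto
    next
      assume ge: "d ^ (m - 1) \<ge> m + 1"
      have "card B \<le> card (affine_fibre n A (\<lambda>_. 1))"
        using decomposes_subset_affine_fibre[OF dec] by (intro card_mono) auto
      then have "real (card B) \<le> real p / real (d ^ m) + stepanov_const d m * sqrt p"
        using card_affine_fibre_le[OF nd A, of "\<lambda>_. 1"] unfolding m_def by linarith
      also have "stepanov_const d m * sqrt p \<le> K * sqrt p"
        unfolding K_def using False by (intro mult_right_mono of_nat_mono member_le_sum) auto
      finally have "m * real (card B) \<le> m * (real p / real (d ^ m) + K * sqrt p)"
        by (intro mult_left_mono) auto
      moreover have "m * real (card B) = real n - 1" using mB n5 by (simp flip: of_nat_mult)
      ultimately have "real n - 1 \<le> m * (real p / real (d ^ m)) + m * K * sqrt p" by (simp add: algebra_simps)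
      moreover have "real p / d - 1 \<le> real n" using p_eq d by (simp add: field_simps)
      ultimately have "real p / d \<le> m * (real p / real (d ^ m)) + m * K * sqrt p + 2" by linarith
      then have "d ^ m * (real p / d) \<le> d ^ m * (m * (real p / real (d ^ m)) + m * K * sqrt p + 2)"
        by (intro mult_left_mono) auto
      moreover have "d ^ m * (real p / d) = d ^ (m - 1) * real p"
      proof -
        have "d ^ m = d * d ^ (m - 1)" using AB(1) by (simp add: m_def power_eq_if)
        then show ?thesis using d by simp
      qed
      moreover have "(m + 1) * real p \<le> d ^ (m - 1) * real p"
        using ge by (intro mult_right_mono) (auto simp flip: of_nat_power of_nat_Suc)
      ultimately have "(m + 1) * real p \<le> m * real p + d ^ m * (m * K * sqrt p + 2)"
        using d by (simp add: algebra_simps)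
      then have "real p \<le> d ^ m * (m * K * sqrt p + 2)" by (simp add: algebra_simps)
      also have "\<dots> \<le> d ^ m * (m * K * sqrt p + 2 * sqrt p)" using sp by (intro mult_left_mono) auto
      also have "\<dots> = real (d ^ m * (m * K + 2)) * sqrt p" by (simp add: algebra_simps)
      finally have "sqrt p * sqrt p \<le> real (d ^ m * (m * K + 2)) * sqrt p" by simp
      then have "sqrt p \<le> real (d ^ m * (m * K + 2))" using sp by (subst (asm) mult_le_cancel_right) auto
      also have "d ^ m * (m * K + 2) \<le> d ^ (192 * d) * (192 * d * K + 2)"
        using d False by (intro mult_le_mono add_mono power_increasing) auto
      also have "\<dots> \<le> size_threshold d" by (simp add: size_threshold_def K_def)
      finally show ?thesis using big by simp
    qed
  qed
qed

end

lemma mult_decomposable_imp_decomposes: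
  assumes p: "prime p" and d: "[p = 1] (mod d)" "d \<ge> 2"
    and dec: "mult_decomposable p (shifted_dth_powers d p - {\<zero>\<^bsub>Fp p\<^esub>})"
  obtains A B where "prime_modulus.decomposes p ((p - 1) div d) A B" "card A \<ge> 2" "card B \<ge> 2"
proof -
  interpret prime_modulus p by unfold_locales (rule p)
  have p1: "1 < p" using p prime_gt_1_nat by blast
  interpret R: residues "int p" "Fp p" by unfold_locales (use p1 in auto)
  define n where "n = (p - 1) div d"
  have nd: "n * d = p - 1"
    using d(1) p1 unfolding n_def by (metis cong_altdef_nat cong_sym dvd_div_mult_self less_imp_le_nat)
  have units: "Fp_units p = {1..<int p}"
    by (auto simp: R.res_carrier_eq R.res_zero_eq)
  have pow: "x [^]\<^bsub>Fp p\<^esub> d = x ^ d mod int p" if "x \<in> {1..<int p}" for x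
    using R.pow_cong[of x d] that by simp
  have dth: "dth_powers d p = roots_of_unity_mod n"
    unfolding dth_powers_def units roots_of_unity_mod_eq_powers(1)[OF nd] using pow by force
  have minus: "s \<ominus>\<^bsub>Fp p\<^esub> \<one>\<^bsub>Fp p\<^esub> = (s - 1) mod int p" for s
    by (simp add: a_minus_def R.res_add_eq R.res_neg_eq R.res_one_eq mod_add_right_eq)
  obtain A B where AB: "A \<subseteq> {1..<int p}" "B \<subseteq> {1..<int p}" "card A \<ge> 2" "card B \<ge> 2"
    and eq: "shifted_dth_powers d p - {\<zero>\<^bsub>Fp p\<^esub>} = A <#>\<^bsub>Fp p\<^esub> B"
    using dec unfolding mult_decomposable_def units by blast
  have X: "(\<lambda>s. (s - 1) mod int p) ` roots_of_unity_mod n - {0} = {(a * b) mod int p | a b. a \<in> A \<and> b \<in> B}"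
  proof -
    have "shifted_dth_powers d p = (\<lambda>s. (s - 1) mod int p) ` roots_of_unity_mod n"
      unfolding shifted_dth_powers_def minus dth by auto
    moreover have "A <#>\<^bsub>Fp p\<^esub> B = {(a * b) mod int p | a b. a \<in> A \<and> b \<in> B}"
      unfolding set_mult_def R.res_mult_eq by auto
    ultimately show ?thesis using eq by (simp add: R.res_zero_eq)
  qed
  have "decomposes n A B"
    unfolding decomposes_def
  proof (intro conjI ballI allI impI)
    fix a b assume "a \<in> A" "b \<in> B"
    then have "(a * b) mod int p \<in> (\<lambda>s. (s - 1) mod int p) ` roots_of_unity_mod n" using X by blast
    then obtain s where s: "s \<in> roots_of_unity_mod n" "(a * b) mod int p = (s - 1) mod int p" by auto
    have "[a * b + 1 = s - 1 + 1] (mod int p)" using s(2) by (intro cong_add cong_refl) (simp add: Cong.cong_def)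
    then have "[(a * b + 1) ^ n = s ^ n] (mod int p)" using cong_pow by fastforce
    then show "[(a * b + 1) ^ n = 1] (mod int p)" using s(1) cong_trans by (auto simp: roots_of_unity_mod_def)
  next
    fix y assume y: "[y ^ n = 1] (mod int p)" "\<not> [y = 1] (mod int p)"
    have "y mod int p \<in> roots_of_unity_mod n" using y p1 by (auto simp: roots_of_unity_mod_def Cong.cong_def power_mod)
    moreover have "(y mod int p - 1) mod int p = (y - 1) mod int p" by (simp add: mod_diff_left_eq)
    moreover have "(y - 1) mod int p \<noteq> 0" using y(2) by (auto simp: cong_iff_dvd_diff)
    ultimately have "(y - 1) mod int p \<in> {(a * b) mod int p | a b. a \<in> A \<and> b \<in> B}"
      using X by (metis (no_types, lifting) DiffI image_eqI singletonD)
    then show "\<exists>a\<in>A. \<exists>b\<in>B. [y - 1 = a * b] (mod int p)" by (auto simp: Cong.cong_def)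
  qed (use AB in auto)
  then show thesis using that AB unfolding n_def by blast
qed

section \<open>Selberg's sieve\<close>

lemma sum_Pow_signs:
  assumes "finite X"
  shows "(\<Sum>Y\<in>Pow X. (- 1) ^ card Y) = (if X = {} then 1 else 0 :: real)"
proof -
  have "(\<Sum>Y\<in>Pow X. (- 1) ^ card Y) = (\<Prod>x\<in>X. (-1 :: real) + 1)"
    using prod_add[OF assms, of "\<lambda>_. -1 :: real" "\<lambda>_. 1"] by simp
  also have "\<dots> = (if X = {} then 1 else 0)"
    using assms by (simp add: power_0_left)
  finally show ?thesis .
qed

text \<open>Moebius inversion on the lattice of finite sets.\<close>

lemma sum_interval_signs:
  assumes "finite K" "L \<subseteq> K"
  shows "(\<Sum>S\<in>{S. L \<subseteq> S \<and> S \<subseteq> K}. (- 1) ^ card (K - S)) = (if L = K then 1 else 0 :: real)"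
proof -
  have "(\<Sum>S\<in>{S. L \<subseteq> S \<and> S \<subseteq> K}. (- 1 :: real) ^ card (K - S)) = (\<Sum>Y\<in>Pow (K - L). (- 1) ^ card Y)"
    using assms by (intro sum.reindex_bij_witness[of _ "\<lambda>Y. K - Y" "\<lambda>S. K - S"]) (auto simp: double_diff)
  also have "\<dots> = (if K - L = {} then 1 else 0)"
    using assms by (intro sum_Pow_signs) auto
  finally show ?thesis using assms by auto
qed

text \<open>Selberg's choice: the quadratic form becomes \<open>\<Sum>\<^sub>L \<phi>(L) y\<^sub>L\<^sup>2\<close>, which is least at
  \<open>y\<^sub>L = \<mu>(L) / (G \<phi>(L))\<close>. A squarefree number is represented by the set of its prime factors.\<close>
lemma selberg_weights:
  fixes P :: "nat set" and D :: "nat set set"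
  assumes P: "finite P" "\<And>q. q \<in> P \<Longrightarrow> q \<ge> 2"
    and D: "D \<subseteq> Pow P" "{} \<in> D" "\<And>A B. A \<subseteq> B \<Longrightarrow> B \<in> D \<Longrightarrow> A \<in> D"
  defines "G \<equiv> (\<Sum>S\<in>D. \<Prod>q\<in>S. 1 / (real q - 1))"
  shows "\<exists>w. w {} = 1 \<and> (\<forall>S\<in>D. \<bar>w S\<bar> \<le> (\<Prod>q\<in>S. real q)) \<and>
    (\<Sum>A\<in>D. \<Sum>B\<in>D. w A * w B / (\<Prod>q\<in>A \<union> B. real q)) = 1 / G"
proof -
  define N where "N S = (\<Prod>q\<in>S. real q)" for S :: "nat set"
  define ph where "ph S = (\<Prod>q\<in>S. real q - 1)" for S :: "nat set"
  have finD: "finite D" using D(1) P(1) finite_subset by blast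
  have fin: "finite S" if "S \<in> D" for S using that D(1) P(1) finite_subset by blast
  have ge2: "q \<ge> 2" if "q \<in> S" "S \<in> D" for q S using that D(1) P(2) by blast
  have N0: "N S > 0" if "S \<in> D" for S unfolding N_def using ge2[OF _ that] by (intro prod_pos) fastforce
  have ph0: "ph S > 0" if "S \<in> D" for S unfolding ph_def using ge2[OF _ that] by (intro prod_pos) fastforce
  have G: "G = (\<Sum>S\<in>D. 1 / ph S)" unfolding G_def ph_def by (simp add: prod_dividef)
  have G0: "G > 0" unfolding G using finD D(2) ph0 by (intro sum_pos) auto
  define y where "y L = (- 1) ^ card L / (G * ph L)" for L
  \<comment> \<open>\<open>w\<close> is recovered from \<open>y\<close> by Moebius inversion, so
    that the sum of w S / N S over the S containing L is y L.\<close>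
  define w where "w S = N S * (\<Sum>L\<in>{L\<in>D. S \<subseteq> L}. (- 1) ^ card (L - S) * y L)" for S
  have w: "w S = (- 1) ^ card S * N S / G * (\<Sum>L\<in>{L\<in>D. S \<subseteq> L}. 1 / ph L)" for S
  proof -
    have "(- 1) ^ card (L - S) * y L = (- 1) ^ card S / G * (1 / ph L)" if "L \<in> D" "S \<subseteq> L" for L
    proof -
      have "card L = card (L - S) + card S"
        using that fin by (metis card_Diff_subset card_mono finite_subset le_add_diff_inverse2)
      then have "(- 1 :: real) ^ card (L - S) * (- 1) ^ card L = (- 1) ^ card S"
        by (simp add: power_add flip: mult.assoc)
      then show ?thesis by (simp add: y_def field_simps)
    qed
    then have "(\<Sum>L\<in>{L\<in>D. S \<subseteq> L}. (- 1) ^ card (L - S) * y L) = (\<Sum>L\<in>{L\<in>D. S \<subseteq> L}. (- 1) ^ card S / G * (1 / ph L))"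
      by (intro sum.cong) auto
    then show ?thesis unfolding w_def sum_distrib_left[symmetric] by simp
  qed
  have "w {} = 1"
  proof -
    have "{L\<in>D. {} \<subseteq> L} = D" by auto
    then show ?thesis using G0 unfolding w by (simp add: N_def G[symmetric])
  qed
  \<comment> \<open>This crude bound contributes R^4 to the remainder, which is harmless when R is
    about T^(1/8).\<close>
  moreover have "\<bar>w S\<bar> \<le> N S" if S: "S \<in> D" for S
  proof -
    have "0 \<le> (\<Sum>L\<in>{L\<in>D. S \<subseteq> L}. 1 / ph L)" using ph0 by (intro sum_nonneg) (auto intro: less_imp_le)
    moreover have "(\<Sum>L\<in>{L\<in>D. S \<subseteq> L}. 1 / ph L) \<le> G"
      unfolding G using finD ph0 by (intro sum_mono2) (auto intro: less_imp_le)
    ultimately have "\<bar>w S\<bar> \<le> N S / G * G"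
      unfolding w abs_mult abs_divide power_abs using G0 N0[OF S]
      by (intro mult_mono) auto
    then show ?thesis using G0 by simp
  qed
  moreover have "(\<Sum>A\<in>D. \<Sum>B\<in>D. w A * w B / N (A \<union> B)) = 1 / G"
  proof -
    have inv: "(\<Sum>S\<in>{S\<in>D. L \<subseteq> S}. w S / N S) = y L" if L: "L \<in> D" for L
    proof -
      have "(\<Sum>S\<in>{S\<in>D. L \<subseteq> S}. w S / N S) =
          (\<Sum>S\<in>{S\<in>D. L \<subseteq> S}. \<Sum>K\<in>{K\<in>D. S \<subseteq> K}. (- 1) ^ card (K - S) * y K)"
        unfolding w_def using N0 by (intro sum.cong) (auto simp: less_imp_neq[symmetric])
      also have "\<dots> = (\<Sum>K\<in>{K\<in>D. L \<subseteq> K}. \<Sum>S\<in>{S. L \<subseteq> S \<and> S \<subseteq> K}. (- 1) ^ card (K - S) * y K)"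
      proof -
        have "{K\<in>D. L \<subseteq> K \<and> (\<exists>S. L \<subseteq> S \<and> S \<subseteq> K)} = {K\<in>D. L \<subseteq> K}" by auto
        have "(\<Sum>(S, K)\<in>(SIGMA S:{S\<in>D. L \<subseteq> S}. {K\<in>D. S \<subseteq> K}). (- 1) ^ card (K - S) * y K) =
            (\<Sum>(K, S)\<in>(SIGMA K:{K\<in>D. L \<subseteq> K}. {S. L \<subseteq> S \<and> S \<subseteq> K}). (- 1) ^ card (K - S) * y K)"
          by (rule sum.reindex_bij_witness[of _ "\<lambda>(a, b). (b, a)" "\<lambda>(a, b). (b, a)"]) (use D(3) in auto)
        then show ?thesis
          using finD fin by (subst sum.Sigma sum.Sigma, auto)+
      qed
      also have "\<dots> = (\<Sum>K\<in>{K\<in>D. L \<subseteq> K}. if K = L then y L else 0)"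
      proof (intro sum.cong refl)
        fix K assume K: "K \<in> {K\<in>D. L \<subseteq> K}"
        then have "(\<Sum>S\<in>{S. L \<subseteq> S \<and> S \<subseteq> K}. (- 1) ^ card (K - S) * y K) = (if L = K then 1 else 0) * y K"
          using fin sum_interval_signs[of K L] by (simp flip: sum_distrib_right)
        then show "(\<Sum>S\<in>{S. L \<subseteq> S \<and> S \<subseteq> K}. (- 1) ^ card (K - S) * y K) = (if K = L then y L else 0)"
          by auto
      qed
      also have "\<dots> = y L" using finD L by simp
      finally show ?thesis .
    qed
    \<comment> \<open>The diagonalization: N (A \<union> B) N (A \<inter> B) = N A * N B, the
      relation between lcm and gcd, and N (A \<inter> B) is the sum of ph over the subsets of A
      \<inter> B.\<close>
    have "w A * w B / N (A \<union> B) = (\<Sum>L\<in>D. ph L * ((if L \<subseteq> A then w A / N A else 0) * (if L \<subseteq> B then w B / N B else 0)))"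
      if AB: "A \<in> D" "B \<in> D" for A B
    proof -
      have "N (A \<union> B) * N (A \<inter> B) = N A * N B"
        unfolding N_def using fin AB by (intro prod.union_inter) auto
      moreover have "A \<inter> B \<in> D" using D(3)[of "A \<inter> B" A] AB by auto
      moreover have "N (A \<union> B) \<noteq> 0"
        using calculation(1) N0[OF AB(1)] N0[OF AB(2)] by (metis mult_zero_left less_irrefl mult_pos_pos)
      ultimately have "1 / N (A \<union> B) = N (A \<inter> B) / (N A * N B)"
        using N0[OF AB(1)] N0[OF AB(2)] by (simp add: divide_simps mult.commute)
      then have "w A * w B / N (A \<union> B) = N (A \<inter> B) * (w A / N A * (w B / N B))"
        by (simp add: field_class.field_divide_inverse mult_ac)
      moreover have "N (A \<inter> B) = (\<Sum>L\<in>Pow (A \<inter> B). ph L)"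
        unfolding N_def ph_def using prod_add[of "A \<inter> B" "\<lambda>q. real q - 1" "\<lambda>_. 1"] fin AB by simp
      moreover have "Pow (A \<inter> B) = {L\<in>D. L \<subseteq> A \<and> L \<subseteq> B}"
        using D(3) AB by auto
      ultimately have "w A * w B / N (A \<union> B) = (\<Sum>L\<in>{L\<in>D. L \<subseteq> A \<and> L \<subseteq> B}. ph L) * (w A / N A * (w B / N B))"
        by simp
      also have "\<dots> = (\<Sum>L\<in>{L\<in>D. L \<subseteq> A \<and> L \<subseteq> B}. ph L * (w A / N A * (w B / N B)))"
        by (rule sum_distrib_right)
      also have "\<dots> = (\<Sum>L\<in>D. ph L * ((if L \<subseteq> A then w A / N A else 0) * (if L \<subseteq> B then w B / N B else 0)))"
        using finD by (intro sum.mono_neutral_cong_left) auto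
      finally show ?thesis .
    qed
    then have "(\<Sum>A\<in>D. \<Sum>B\<in>D. w A * w B / N (A \<union> B)) =
       (\<Sum>A\<in>D. \<Sum>B\<in>D. \<Sum>L\<in>D. ph L * ((if L \<subseteq> A then w A / N A else 0) * (if L \<subseteq> B then w B / N B else 0)))"
      by (intro sum.cong) auto
    also have "\<dots> = (\<Sum>L\<in>D. \<Sum>A\<in>D. \<Sum>B\<in>D. ph L * ((if L \<subseteq> A then w A / N A else 0) * (if L \<subseteq> B then w B / N B else 0)))"
      by (subst sum.swap[of _ D D], subst sum.swap[of _ D D]) (intro sum.cong refl sum.swap)
    also have "\<dots> = (\<Sum>L\<in>D. ph L * ((\<Sum>A\<in>D. if L \<subseteq> A then w A / N A else 0) * (\<Sum>B\<in>D. if L \<subseteq> B then w B / N B else 0)))"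
      unfolding sum_product by (simp only: sum_distrib_left)
    also have "\<dots> = (\<Sum>L\<in>D. ph L * (y L * y L))"
    proof (intro sum.cong refl)
      fix L assume "L \<in> D"
      have "(\<Sum>A\<in>D. if L \<subseteq> A then w A / N A else 0) = y L"
        unfolding inv[OF \<open>L \<in> D\<close>, symmetric] using finD by (intro sum.mono_neutral_cong_right) auto
      then show "ph L * ((\<Sum>A\<in>D. if L \<subseteq> A then w A / N A else 0) * (\<Sum>B\<in>D. if L \<subseteq> B then w B / N B else 0)) = ph L * (y L * y L)"
        by simp
    qed
    also have "\<dots> = (\<Sum>L\<in>D. 1 / ph L / G ^ 2)"
      using ph0 G0 by (intro sum.cong refl) (auto simp: y_def field_simps power2_eq_square simp flip: power_mult_distrib)
    also have "\<dots> = 1 / G"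
      unfolding sum_divide_distrib[symmetric] G[symmetric] using G0 by (simp add: power2_eq_square)
    finally show ?thesis .
  qed
  ultimately show ?thesis unfolding N_def by blast
qed

section \<open>Lower bound for the sum in Selberg's main term\<close>

definition prime_ratio :: "nat \<Rightarrow> real"
  where "prime_ratio u = (\<Prod>q\<in>prime_factors u. 1 + 1 / (real q - 1))"

definition sieving_primes :: "nat \<Rightarrow> nat \<Rightarrow> nat set"
  where "sieving_primes u R = {q. prime q \<and> q \<le> R \<and> \<not> q dvd u}"

definition sieving_sets :: "nat \<Rightarrow> nat \<Rightarrow> nat set set"
  where "sieving_sets u R = {S. S \<subseteq> sieving_primes u R \<and> \<Prod>S \<le> R}"

text \<open>Selberg's sum of mu(m)^2 / phi(m) over the m \<le> R coprime to u. In the same notation,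
  \<open>prime_ratio u\<close> is u / phi(u) for u > 0.\<close>

definition sieve_sum :: "nat \<Rightarrow> nat \<Rightarrow> real"
  where "sieve_sum u R = (\<Sum>S\<in>sieving_sets u R. \<Prod>q\<in>S. 1 / (real q - 1))"

lemma finite_sieving_primes [simp]: "finite (sieving_primes u R)"
  by (rule finite_subset[of _ "{..R}"]) (auto simp: sieving_primes_def)

lemma finite_sieving_sets [simp]: "finite (sieving_sets u R)"
  by (rule finite_subset[of _ "Pow (sieving_primes u R)"]) (auto simp: sieving_sets_def)

lemma prod_prime_powers_dvd_iff:
  fixes m :: nat
  assumes "finite S" "\<And>q. q \<in> S \<Longrightarrow> prime q"
  shows "(\<Prod>q\<in>S. q ^ e q) dvd m \<longleftrightarrow> (\<forall>q\<in>S. q ^ e q dvd m)"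
  using assms
proof (induction S rule: finite_induct)
  case (insert q S)
  have "coprime (q ^ e q) (\<Prod>r\<in>S. r ^ e r)"
  proof (rule prod_coprime_right)
    fix r assume "r \<in> S"
    then have "coprime q r" using insert by (metis insertCI primes_coprime)
    then show "coprime (q ^ e q) (r ^ e r)" by simp
  qed
  then show ?case
    using insert by (auto simp: divides_mult intro: dvd_trans[OF dvd_triv_left] dvd_trans[OF dvd_triv_right])
qed simp

lemma prod_primes_dvd_iff:
  fixes m :: nat
  assumes "finite S" "\<And>q. q \<in> S \<Longrightarrow> prime q"
  shows "\<Prod>S dvd m \<longleftrightarrow> (\<forall>q\<in>S. q dvd m)"
  using prod_prime_powers_dvd_iff[OF assms, of "\<lambda>_. 1"] by simp

lemma prime_dvd_prod_primes:
  fixes r :: nat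
  assumes "finite S" "\<And>q. q \<in> S \<Longrightarrow> prime q" "prime r"
  shows "r dvd \<Prod>S \<longleftrightarrow> r \<in> S"
proof -
  have "r dvd \<Prod>S \<longleftrightarrow> (\<exists>q\<in>S. r dvd q)"
    using assms by (simp add: prime_dvd_prod_iff)
  then show ?thesis
    using assms primes_dvd_imp_eq by blast
qed

lemma card_residue_class_bounds:
  fixes u N v T :: nat
  assumes "coprime u N" "N > 0"
  shows "\<bar>real (card {t\<in>{..<T}. N dvd u * t + v}) - real T / real N\<bar> \<le> 1"
proof -
  obtain t0 where t0: "t0 < N" "[u * t0 = (N - 1) * v] (mod N)"
    using cong_solve_unique[of u N "(N - 1) * v"] assms by auto
  have "N dvd u * t + v \<longleftrightarrow> t mod N = t0" for t
  proof -
    have "(N - 1) * v + v = N * v" using assms(2) by (metis Suc_diff_1 mult_Suc add.commute)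
    then have "N dvd u * t + v \<longleftrightarrow> [u * t + v = (N - 1) * v + v] (mod N)"
      by (simp add: Cong.cong_def dvd_eq_mod_eq_0)
    also have "\<dots> \<longleftrightarrow> [u * t = (N - 1) * v] (mod N)"
      by (rule cong_add_rcancel_nat)
    also have "\<dots> \<longleftrightarrow> [u * t = u * t0] (mod N)"
      using t0(2) cong_sym cong_trans by blast
    also have "\<dots> \<longleftrightarrow> [t = t0] (mod N)"
      using assms(1) by (simp add: cong_mult_lcancel_nat)
    also have "\<dots> \<longleftrightarrow> t mod N = t0" using t0(1) by (simp add: Cong.cong_def)
    finally show ?thesis .
  qed
  then have set_eq: "{t\<in>{..<T}. N dvd u * t + v} = {t\<in>{..<T}. t mod N = t0}" by auto
  define k where "k = (LEAST k. \<not> N * k + t0 < T)"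
  have "\<exists>k. \<not> N * k + t0 < T"
  proof
    have "1 * T \<le> N * T" using assms(2) by (intro mult_le_mono) auto
    then show "\<not> N * T + t0 < T" by linarith
  qed
  then have k: "\<not> N * k + t0 < T" unfolding k_def by (rule LeastI_ex)
  have below: "N * j + t0 < T" if "j < k" for j using not_less_Least[of j] that unfolding k_def by blast
  have "{t\<in>{..<T}. t mod N = t0} = (\<lambda>j. N * j + t0) ` {..<k}"
  proof (intro equalityI subsetI)
    fix t assume t: "t \<in> {t\<in>{..<T}. t mod N = t0}"
    then have "t = N * (t div N) + t0" by (metis (lifting) mem_Collect_eq mult_div_mod_eq)
    moreover have "t div N < k"
    proof (rule ccontr)
      assume "\<not> t div N < k"
      then have "N * k \<le> N * (t div N)" by simp
      moreover have "t < T" using t by simp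
      ultimately show False using k \<open>t = N * (t div N) + t0\<close> by linarith
    qed
    ultimately show "t \<in> (\<lambda>j. N * j + t0) ` {..<k}" by blast
  qed (use t0 below in auto)
  moreover have "inj_on (\<lambda>j. N * j + t0) {..<k}" using assms(2) by (auto simp: inj_on_def)
  ultimately have card: "card {t\<in>{..<T}. N dvd u * t + v} = k"
    unfolding set_eq by (simp add: card_image)
  have "real T \<le> real N * k + real t0" using k by (simp flip: of_nat_mult of_nat_add)
  moreover have "real t0 < real N" using t0 by simp
  ultimately have "real T \<le> real N * (k + 1)" by (simp add: algebra_simps)
  then have 1: "real T / N \<le> k + 1" using assms(2) by (simp add: field_simps)
  have 2: "real k - 1 \<le> real T / N"
  proof (cases k)
    case (Suc j)
    then have "real (N * j) \<le> real T" using below[of j] by (intro of_nat_mono) simp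
    then show ?thesis using Suc assms(2) by (simp add: field_simps)
  next
    case 0
    moreover have "0 \<le> real T / N" by simp
    ultimately show ?thesis by linarith
  qed
  show ?thesis unfolding card using 1 2 by linarith
qed

lemma sum_inverse_powers_le:
  assumes "q \<ge> 2"
  shows "(\<Sum>j\<le>R. 1 / real q ^ j) \<le> 1 + 1 / (real q - 1)" "(\<Sum>j\<in>{1..R}. 1 / real q ^ j) \<le> 1 / (real q - 1)"
proof -
  define x where "x = 1 / real q"
  have x: "0 < x" "x < 1" using assms by (auto simp: x_def)
  have "(1 - x) * (\<Sum>j\<le>R. x ^ j) = 1 - x ^ Suc R" by (rule sum_gp_basic)
  also have "\<dots> \<le> 1" using x by simp
  finally have "(\<Sum>j\<le>R. x ^ j) \<le> 1 / (1 - x)" using x by (simp add: field_simps)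
  also have "1 / (1 - x) = 1 + 1 / (real q - 1)" using assms by (simp add: x_def field_simps)
  finally show 1: "(\<Sum>j\<le>R. 1 / real q ^ j) \<le> 1 + 1 / (real q - 1)" by (simp add: x_def power_divide)
  have "{..R} = insert 0 {1..R}" by auto
  then have "(\<Sum>j\<le>R. 1 / real q ^ j) = 1 + (\<Sum>j\<in>{1..R}. 1 / real q ^ j)" by simp
  with 1 show "(\<Sum>j\<in>{1..R}. 1 / real q ^ j) \<le> 1 / (real q - 1)" by simp
qed

lemma prod_multiplicity_superset:
  fixes n :: nat
  assumes "n > 0" "finite Q" "prime_factors n \<subseteq> Q" "\<And>q. q \<in> Q \<Longrightarrow> prime q"
  shows "(\<Prod>q\<in>Q. q ^ multiplicity q n) = n"
proof -
  have "(\<Prod>q\<in>Q. q ^ multiplicity q n) = (\<Prod>q\<in>prime_factors n. q ^ multiplicity q n)"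
    using assms by (intro prod.mono_neutral_right) (auto simp: prime_factors_multiplicity)
  then show ?thesis using prime_factorization_nat[OF assms(1)] by simp
qed

lemma multiplicity_le_self:
  fixes n q :: nat
  assumes "n > 0" "prime q"
  shows "multiplicity q n \<le> n"
proof -
  have "multiplicity q n < q ^ multiplicity q n"
    using prime_ge_2_nat[OF assms(2)] less_exp[of "multiplicity q n"] power_mono[of 2 q "multiplicity q n"] by linarith
  also have "\<dots> \<le> n" using assms by (intro dvd_imp_le multiplicity_dvd) auto
  finally show ?thesis by simp
qed

text \<open>Vectors of exponents embed X into a product of ranges. An exponent at q in S is at least
  1, so the geometric series there is at most 1 / (q - 1), as against q / (q - 1) for q in
  W.\<close>

lemma sum_inverse_le_euler_product:
  fixes W S :: "nat set" and X :: "nat set"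
  assumes fin: "finite W" "finite S" "W \<inter> S = {}" and prime: "\<And>q. q \<in> W \<union> S \<Longrightarrow> prime q"
    and X: "X \<subseteq> {1..R}" "\<And>n. n \<in> X \<Longrightarrow> prime_factors n \<subseteq> W \<union> S \<and> (\<forall>q\<in>S. q dvd n)"
  shows "(\<Sum>n\<in>X. 1 / real n) \<le> (\<Prod>q\<in>W. 1 + 1 / (real q - 1)) * (\<Prod>q\<in>S. 1 / (real q - 1))"
proof -
  define B where "B q = (if q \<in> S then {1..R} else {..R})" for q
  define e where "e n = restrict (\<lambda>q. multiplicity q n) (W \<union> S)" for n :: nat
  have finX: "finite X" using X(1) finite_subset by blast
  have prod_e: "(\<Prod>q\<in>W \<union> S. q ^ e n q) = n" if "n \<in> X" for n
  proof -
    have "(\<Prod>q\<in>W \<union> S. q ^ e n q) = (\<Prod>q\<in>W \<union> S. q ^ multiplicity q n)" by (simp add: e_def)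
    also have "\<dots> = n" using X that fin prime by (intro prod_multiplicity_superset) auto
    finally show ?thesis .
  qed
  have "inj_on e X" by (rule inj_onI) (metis prod_e)
  have "e ` X \<subseteq> PiE (W \<union> S) B"
  proof (rule image_subsetI)
    fix n assume n: "n \<in> X"
    then have n0: "n > 0" "n \<le> R" using X(1) by auto
    have "multiplicity q n \<in> B q" if "q \<in> W \<union> S" for q
    proof -
      have "multiplicity q n \<le> R" using multiplicity_le_self[OF n0(1) prime[OF that]] n0 by simp
      moreover have "multiplicity q n \<ge> 1" if "q \<in> S"
        using X(2)[OF n] that n0 prime[of q] by (simp add: Suc_le_eq prime_multiplicity_gt_zero_iff)
      ultimately show ?thesis by (auto simp: B_def)
    qed
    then show "e n \<in> PiE (W \<union> S) B" by (auto simp: e_def)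
  qed
  have "(\<Sum>n\<in>X. 1 / real n) = (\<Sum>n\<in>X. \<Prod>q\<in>W \<union> S. 1 / real q ^ e n q)"
  proof (intro sum.cong refl)
    fix n assume "n \<in> X"
    then have "real n = (\<Prod>q\<in>W \<union> S. real q ^ e n q)"
      using prod_e by (metis (mono_tags, lifting) of_nat_power of_nat_prod prod.cong)
    then show "1 / real n = (\<Prod>q\<in>W \<union> S. 1 / real q ^ e n q)" by (simp add: prod_dividef)
  qed
  also have "\<dots> = (\<Sum>f\<in>e ` X. \<Prod>q\<in>W \<union> S. 1 / real q ^ f q)"
    using \<open>inj_on e X\<close> by (simp add: sum.reindex)
  also have "\<dots> \<le> (\<Sum>f\<in>PiE (W \<union> S) B. \<Prod>q\<in>W \<union> S. 1 / real q ^ f q)"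
    using \<open>e ` X \<subseteq> _\<close> fin by (intro sum_mono2 finite_PiE) (auto simp: B_def intro!: prod_nonneg)
  also have "\<dots> = (\<Prod>q\<in>W \<union> S. \<Sum>j\<in>B q. 1 / real q ^ j)"
    using fin by (intro prod_sum_PiE[symmetric]) (auto simp: B_def)
  also have "\<dots> = (\<Prod>q\<in>W. \<Sum>j\<in>B q. 1 / real q ^ j) * (\<Prod>q\<in>S. \<Sum>j\<in>B q. 1 / real q ^ j)"
    using fin by (intro prod.union_disjoint)
  also have "\<dots> \<le> (\<Prod>q\<in>W. 1 + 1 / (real q - 1)) * (\<Prod>q\<in>S. 1 / (real q - 1))"
  proof (intro mult_mono prod_mono conjI prod_nonneg sum_nonneg)
    fix q assume q: "q \<in> W"
    then have "B q = {..R}" using fin by (auto simp: B_def)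
    then show "(\<Sum>j\<in>B q. 1 / real q ^ j) \<le> 1 + 1 / (real q - 1)"
      using sum_inverse_powers_le(1)[of q R] prime[of q] q prime_ge_2_nat by auto
    show "0 \<le> 1 + 1 / (real q - 1)" using prime[of q] q prime_ge_2_nat[of q] by simp
  next
    fix q assume q: "q \<in> S"
    then show "(\<Sum>j\<in>B q. 1 / real q ^ j) \<le> 1 / (real q - 1)"
      using sum_inverse_powers_le(2)[of q R] prime[of q] prime_ge_2_nat by (auto simp: B_def)
  qed auto
  finally show ?thesis .
qed

text \<open>Sort the n \<le> R by the set of their prime factors not dividing u. The class of S
  contributes at most \<open>prime_ratio u\<close> times the term of S in \<open>sieve_sum\<close>,
  and the harmonic sum is at least ln (R + 1).\<close>

lemma ln_le_prime_ratio_sieve_sum: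
  assumes "u > 0"
  shows "ln (real R + 1) \<le> prime_ratio u * sieve_sum u R"
proof -
  define W where "W = {q. prime q \<and> q \<le> R \<and> q dvd u}"
  have finW: "finite W" by (rule finite_subset[of _ "{..R}"]) (auto simp: W_def)
  let ?g = "\<lambda>n. {q \<in> sieving_primes u R. q dvd n}"
  have g: "?g n \<in> sieving_sets u R" if "n \<in> {1..R}" for n
  proof -
    have "\<Prod>(?g n) dvd n"
      by (subst prod_primes_dvd_iff) (auto simp: sieving_primes_def)
    then have "\<Prod>(?g n) \<le> R" using that dvd_imp_le[of "\<Prod>(?g n)" n] by auto
    then show ?thesis by (auto simp: sieving_sets_def)
  qed
  have "harm R = (\<Sum>n\<in>{1..R}. 1 / real n)" by (simp add: harm_def inverse_eq_divide)
  also have "\<dots> = (\<Sum>S\<in>sieving_sets u R. \<Sum>n\<in>{n\<in>{1..R}. ?g n = S}. 1 / real n)"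
    using g by (intro sum.group[symmetric]) auto
  also have "\<dots> \<le> (\<Sum>S\<in>sieving_sets u R. (\<Prod>q\<in>W. 1 + 1 / (real q - 1)) * (\<Prod>q\<in>S. 1 / (real q - 1)))"
  proof (intro sum_mono sum_inverse_le_euler_product finW)
    fix S assume S: "S \<in> sieving_sets u R"
    then have "S \<subseteq> sieving_primes u R" by (simp add: sieving_sets_def)
    then show "finite S" using finite_subset finite_sieving_primes by blast
    show "W \<inter> S = {}" using S by (auto simp: W_def sieving_sets_def sieving_primes_def)
    show "prime q" if "q \<in> W \<union> S" for q using S that by (auto simp: W_def sieving_sets_def sieving_primes_def)
    show "{n \<in> {1..R}. ?g n = S} \<subseteq> {1..R}" by auto
    fix n assume n: "n \<in> {n \<in> {1..R}. ?g n = S}"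
    have "q \<in> W \<union> S" if "q \<in> prime_factors n" for q
    proof -
      have q: "prime q" "q dvd n" using that by auto
      have "q \<le> R" using n dvd_imp_le[OF q(2)] by auto
      then show ?thesis using n q by (auto simp: W_def sieving_primes_def)
    qed
    then show "prime_factors n \<subseteq> W \<union> S \<and> (\<forall>q\<in>S. q dvd n)" using n by auto
  qed
  also have "\<dots> = (\<Prod>q\<in>W. 1 + 1 / (real q - 1)) * sieve_sum u R"
    by (simp add: sieve_sum_def sum_distrib_left)
  also have "\<dots> \<le> prime_ratio u * sieve_sum u R"
  proof (rule mult_right_mono)
    show "0 \<le> sieve_sum u R"
      unfolding sieve_sum_def
    proof (intro sum_nonneg prod_nonneg)
      fix S q assume "S \<in> sieving_sets u R" "q \<in> S"
      then have "prime q" by (auto simp: sieving_sets_def sieving_primes_def)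
      then show "0 \<le> 1 / (real q - 1)" using prime_ge_2_nat[of q] by simp
    qed
    show "(\<Prod>q\<in>W. 1 + 1 / (real q - 1)) \<le> prime_ratio u"
      unfolding prime_ratio_def
    proof (rule prod_mono2)
      show "W \<subseteq> prime_factors u" using assms by (auto simp: W_def prime_factors_dvd)
      fix q assume "q \<in> prime_factors u - W"
      then show "1 \<le> 1 + 1 / (real q - 1)" using prime_ge_2_nat[of q] in_prime_factors_imp_prime[of q u] by fastforce
    next
      fix q assume "q \<in> W"
      then show "0 \<le> 1 + 1 / (real q - 1)" using prime_ge_2_nat[of q] by (auto simp: W_def)
    qed simp
  qed
  finally show ?thesis using ln_le_harm[of R] by linarith
qed

lemma prime_ratio_ge_1: "prime_ratio u \<ge> 1"
  unfolding prime_ratio_def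
proof (rule prod_ge_1)
  fix q assume "q \<in> prime_factors u"
  then show "1 \<le> 1 + 1 / (real q - 1)" using prime_ge_2_nat[of q] in_prime_factors_imp_prime[of q u] by fastforce
qed

lemma card_sieving_sets_le: "card (sieving_sets u R) \<le> R"
proof -
  have inj: "inj_on Prod (sieving_sets u R)"
  proof (rule inj_onI)
    fix A B assume AB: "A \<in> sieving_sets u R" "B \<in> sieving_sets u R" "\<Prod>A = \<Prod>B"
    have *: "A = {q. prime q \<and> q dvd \<Prod>A}" if "A \<in> sieving_sets u R" for A
    proof -
      have A: "A \<subseteq> sieving_primes u R" using that by (simp add: sieving_sets_def)
      then have "finite A" "\<And>q. q \<in> A \<Longrightarrow> prime q"
        using finite_subset finite_sieving_primes by (blast, auto simp: sieving_primes_def)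
      then show ?thesis using prime_dvd_prod_primes by blast
    qed
    show "A = B" using *[OF AB(1)] *[OF AB(2)] AB(3) by simp
  qed
  have "Prod ` sieving_sets u R \<subseteq> {1..R}"
  proof (rule image_subsetI)
    fix A assume A: "A \<in> sieving_sets u R"
    have "\<Prod>A > 0" using A by (intro prod_pos) (auto simp: sieving_sets_def sieving_primes_def prime_gt_0_nat)
    then show "\<Prod>A \<in> {1..R}" using A by (simp add: sieving_sets_def)
  qed
  then show ?thesis using card_inj_on_le[OF inj, of "{1..R}"] by simp
qed

text \<open>If u t + v is a prime larger than R, only the empty set contributes to the weight sum,
  whose square is then 1. The other t are at most R because t \<le> u t + v. R^4 bounds the square
  of the sum of N A, as there are at most R sets, each with product at most R.\<close>

theorem selberg_sieve_linear:
  assumes u: "u > 0" and R: "R > 0"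
  shows "real (card {t\<in>{..<T}. prime (u * t + v)}) \<le> real T * prime_ratio u / ln (real R + 1) + real R ^ 4 + real R + 1"
proof -
  define D where "D = sieving_sets u R"
  define N where "N S = (\<Prod>q\<in>S. real q)" for S :: "nat set"
  define G where "G = sieve_sum u R"
  have finD: "finite D" by (simp add: D_def)
  have D: "A \<subseteq> sieving_primes u R" "\<Prod>A \<le> R" "finite A" "\<And>q. q \<in> A \<Longrightarrow> prime q" "\<And>q. q \<in> A \<Longrightarrow> coprime u q" if "A \<in> D" for A
  proof -
    show A: "A \<subseteq> sieving_primes u R" "\<Prod>A \<le> R" using that by (auto simp: D_def sieving_sets_def)
    show "finite A" using A(1) finite_subset finite_sieving_primes by blast
    show pr: "prime q" if "q \<in> A" for q using A(1) that by (auto simp: sieving_primes_def)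
    show "coprime u q" if "q \<in> A" for q
      using pr[OF that] A(1) that prime_imp_coprime[of q u] by (auto simp: sieving_primes_def coprime_commute)
  qed
  have "\<exists>w. w {} = 1 \<and> (\<forall>S\<in>D. \<bar>w S\<bar> \<le> (\<Prod>q\<in>S. real q)) \<and>
      (\<Sum>A\<in>D. \<Sum>B\<in>D. w A * w B / (\<Prod>q\<in>A \<union> B. real q)) = 1 / (\<Sum>S\<in>D. \<Prod>q\<in>S. 1 / (real q - 1))"
  proof (rule selberg_weights[of "sieving_primes u R"])
    show "{} \<in> D" using R by (auto simp: D_def sieving_sets_def)
    show "D \<subseteq> Pow (sieving_primes u R)" using D(1) by auto
    show "q \<ge> 2" if "q \<in> sieving_primes u R" for q using that prime_ge_2_nat by (auto simp: sieving_primes_def)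
    fix A B assume AB: "A \<subseteq> B" "B \<in> D"
    have "\<Prod>A dvd \<Prod>B" using AB D(3) by (intro prod_dvd_prod_subset) auto
    moreover have "\<Prod>B > 0" using D(4)[OF AB(2)] by (intro prod_pos) (auto simp: prime_gt_0_nat)
    ultimately have "\<Prod>A \<le> \<Prod>B" by (rule dvd_imp_le)
    then have "\<Prod>A \<le> R" using D(2)[OF AB(2)] by simp
    then show "A \<in> D" using D(1)[OF AB(2)] AB(1) by (auto simp: D_def sieving_sets_def)
  qed simp
  then obtain w where w: "w {} = 1" "\<And>S. S \<in> D \<Longrightarrow> \<bar>w S\<bar> \<le> N S"
      "(\<Sum>A\<in>D. \<Sum>B\<in>D. w A * w B / N (A \<union> B)) = 1 / G"
    unfolding N_def G_def sieve_sum_def D_def[symmetric] by blast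
  define I where "I A t = (if \<forall>q\<in>A. q dvd u * t + v then 1 else 0 :: real)" for A t
  define S1 where "S1 = {t\<in>{..<T}. prime (u * t + v) \<and> R < u * t + v}"
  have one: "(\<Sum>A\<in>D. w A * I A t) = 1" if t: "t \<in> S1" for t
  proof -
    have "w A * I A t = (if A = {} then 1 else 0)" if A: "A \<in> D" for A
    proof (cases "A = {}")
      case False
      then obtain q where q: "q \<in> A" by auto
      have "q \<le> R" "prime q" using D(1)[OF A] q by (auto simp: sieving_primes_def)
      then have "\<not> q dvd u * t + v"
        using t primes_dvd_imp_eq[of q "u * t + v"] by (auto simp: S1_def)
      then show ?thesis using q False by (auto simp: I_def)
    qed (simp add: w(1) I_def)
    moreover have "{} \<in> D" using R by (auto simp: D_def sieving_sets_def)
    ultimately show ?thesis using finD by simp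
  qed
  have "real (card S1) = (\<Sum>t\<in>S1. (\<Sum>A\<in>D. w A * I A t) ^ 2)" using one by simp
  also have "\<dots> \<le> (\<Sum>t<T. (\<Sum>A\<in>D. w A * I A t) ^ 2)"
    by (intro sum_mono2) (auto simp: S1_def)
  also have "\<dots> = (\<Sum>t<T. \<Sum>A\<in>D. \<Sum>B\<in>D. w A * w B * I (A \<union> B) t)"
  proof (intro sum.cong refl)
    fix t
    have "I A t * I B t = I (A \<union> B) t" for A B by (auto simp: I_def)
    then have "w A * I A t * (w B * I B t) = w A * w B * I (A \<union> B) t" for A B
      by (metis mult.assoc mult.left_commute)
    then show "(\<Sum>A\<in>D. w A * I A t) ^ 2 = (\<Sum>A\<in>D. \<Sum>B\<in>D. w A * w B * I (A \<union> B) t)"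
      unfolding power2_eq_square sum_product by (intro sum.cong refl)
  qed
  also have "\<dots> = (\<Sum>A\<in>D. \<Sum>B\<in>D. w A * w B * (\<Sum>t<T. I (A \<union> B) t))"
    by (simp add: sum.swap[of _ "{..<T}"] sum_distrib_left)
  also have "\<dots> \<le> (\<Sum>A\<in>D. \<Sum>B\<in>D. real T * (w A * w B / N (A \<union> B)) + N A * N B)"
  proof (intro sum_mono)
    fix A B assume AB: "A \<in> D" "B \<in> D"
    let ?C = "A \<union> B"
    have C: "finite ?C" "\<And>q. q \<in> ?C \<Longrightarrow> prime q" "\<And>q. q \<in> ?C \<Longrightarrow> coprime u q" using D AB by auto
    have "(\<Sum>t<T. I ?C t) = card {t\<in>{..<T}. \<forall>q\<in>?C. q dvd u * t + v}"
      unfolding I_def by (simp add: sum.If_cases Int_def)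
    also have "{t\<in>{..<T}. \<forall>q\<in>?C. q dvd u * t + v} = {t\<in>{..<T}. \<Prod>?C dvd u * t + v}"
      using prod_primes_dvd_iff[OF C(1,2)] by blast
    finally have "(\<Sum>t<T. I ?C t) = card {t\<in>{..<T}. \<Prod>?C dvd u * t + v}" .
    moreover have "coprime u (\<Prod>?C)" using C(3) by (rule prod_coprime_right)
    moreover have "\<Prod>?C > 0" using C(2) by (intro prod_pos) (auto simp: prime_gt_0_nat)
    ultimately have "\<bar>(\<Sum>t<T. I ?C t) - real T / N ?C\<bar> \<le> 1"
      using card_residue_class_bounds[of u "\<Prod>?C" T v] by (simp add: N_def)
    then have "\<bar>w A * w B * ((\<Sum>t<T. I ?C t) - real T / N ?C)\<bar> \<le> N A * N B * 1"
      unfolding abs_mult using w(2)[OF AB(1)] w(2)[OF AB(2)] by (intro mult_mono) auto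
    then have "w A * w B * ((\<Sum>t<T. I ?C t) - real T / N ?C) \<le> N A * N B" by simp
    then show "w A * w B * (\<Sum>t<T. I ?C t) \<le> real T * (w A * w B / N ?C) + N A * N B"
      by (simp add: algebra_simps)
  qed
  also have "\<dots> = real T / G + (\<Sum>A\<in>D. N A) * (\<Sum>B\<in>D. N B)"
  proof -
    have "(\<Sum>A\<in>D. \<Sum>B\<in>D. real T * (w A * w B / N (A \<union> B))) = real T * (1 / G)"
      unfolding w(3)[symmetric] by (simp only: sum_distrib_left)
    then show ?thesis by (simp only: sum.distrib sum_product) simp
  qed
  also have "(\<Sum>A\<in>D. N A) * (\<Sum>B\<in>D. N B) \<le> real (R * R) * real (R * R)"
  proof -
    have "(\<Sum>A\<in>D. N A) \<le> (\<Sum>A\<in>D. real R)"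
    proof (rule sum_mono)
      fix A assume "A \<in> D"
      have "N A = real (\<Prod>A)" by (simp add: N_def)
      then show "N A \<le> real R" using D(2)[OF \<open>A \<in> D\<close>] by (metis of_nat_le_iff)
    qed
    also have "\<dots> \<le> real R * real R" using card_sieving_sets_le[of u R] unfolding D_def by (simp add: mult_right_mono)
    finally have "(\<Sum>A\<in>D. N A) \<le> real (R * R)" by simp
    moreover have "0 \<le> (\<Sum>A\<in>D. N A)" unfolding N_def by (intro sum_nonneg prod_nonneg) auto
    ultimately show ?thesis by (intro mult_mono) auto
  qed
  finally have S1: "real (card S1) \<le> real T / G + real R ^ 4" by (simp add: power4_eq_xxxx)
  have ln0: "0 < ln (real R + 1)" using R by simp
  have lnG: "ln (real R + 1) \<le> prime_ratio u * G"
    unfolding G_def by (rule ln_le_prime_ratio_sieve_sum[OF u])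
  then have "0 < prime_ratio u * G" using ln0 by linarith
  then have G0: "0 < G" using prime_ratio_ge_1[of u] by (simp add: zero_less_mult_iff)
  have "1 / G \<le> prime_ratio u / ln (real R + 1)" using lnG ln0 G0 by (simp add: field_simps)
  then have "real T * (1 / G) \<le> real T * (prime_ratio u / ln (real R + 1))" by (rule mult_left_mono) simp
  moreover have "card {t\<in>{..<T}. prime (u * t + v)} \<le> card S1 + (R + 1)"
  proof -
    have "{t\<in>{..<T}. prime (u * t + v)} \<subseteq> S1 \<union> {..R}"
    proof
      fix t assume t: "t \<in> {t\<in>{..<T}. prime (u * t + v)}"
      have "1 * t \<le> u * t" using u by (intro mult_le_mono) auto
      then have "R < u * t + v \<or> t \<le> R" by linarith
      then show "t \<in> S1 \<union> {..R}" using t by (auto simp: S1_def)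
    qed
    then have "card {t\<in>{..<T}. prime (u * t + v)} \<le> card (S1 \<union> {..R})"
      by (intro card_mono) (auto simp: S1_def)
    also have "\<dots> \<le> card S1 + card {..R}" by (rule card_Un_le)
    finally show ?thesis by simp
  qed
  ultimately show ?thesis using S1 by simp
qed

section \<open>Prime numbers and their reciprocals\<close>

text \<open>Taking R about T^(1/8) gives ln (R + 1) \<ge> (ln T) / 8 and R^4 \<le> \<surd>T, and 9
  is 8 + 1. The threshold T0 is independent of u and v, which matters where u = d a grows with
  X.\<close>

lemma linear_primes_upper_bound:
  "\<exists>T0\<ge>2. \<forall>T\<ge>T0. \<forall>u>0. \<forall>v. real (card {t\<in>{..<T}. prime (u * t + v)}) \<le> 9 * prime_ratio u * real T / ln (real T)"
proof -
  have "eventually (\<lambda>T :: nat. real T \<ge> 2 \<and> 3 * sqrt (real T) \<le> real T / ln (real T)) sequentially"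
    by (intro eventually_conj) real_asymp+
  then obtain T0 where T0: "\<And>T. T \<ge> T0 \<Longrightarrow> real T \<ge> 2 \<and> 3 * sqrt (real T) \<le> real T / ln (real T)"
    by (auto simp: eventually_sequentially)
  have "real (card {t\<in>{..<T}. prime (u * t + v)}) \<le> 9 * prime_ratio u * real T / ln (real T)"
    if T: "T \<ge> max T0 2" and u: "u > 0" for T u v
  proof -
    have T2: "real T \<ge> 2" "3 * sqrt (real T) \<le> real T / ln (real T)" using T0[of T] T by auto
    define y where "y = real T powr (1 / 8)"
    have y1: "y \<ge> 1" unfolding y_def using T2 by (intro ge_one_powr_ge_zero) auto
    define R where "R = nat \<lfloor>y\<rfloor>"
    have R: "real R \<le> y" "y < real R + 1" "R > 0" using y1 unfolding R_def by linarith+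
    have "ln (real T) / 8 = ln y" using T2 by (simp add: y_def ln_powr)
    also have "\<dots> \<le> ln (real R + 1)" using R y1 by simp
    finally have ln: "ln (real T) / 8 \<le> ln (real R + 1)" .
    have lnT: "ln (real T) > 0" using T2 by simp
    have "real R ^ 4 \<le> y ^ 4" using R by (intro power_mono) auto
    also have "y ^ 4 = sqrt (real T)"
    proof -
      have "y ^ 4 = y powr real 4" using y1 by (intro powr_realpow[symmetric]) simp
      also have "\<dots> = real T powr (1 / 8 * real 4)" unfolding y_def powr_powr ..
      also have "\<dots> = sqrt (real T)" using T2 by (simp add: powr_half_sqrt)
      finally show ?thesis .
    qed
    finally have R4: "real R ^ 4 \<le> sqrt (real T)" .
    moreover have "real R \<le> real R ^ 4" using R by (intro self_le_power) auto
    moreover have "1 \<le> sqrt (real T)" using T2 by simp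
    ultimately have rest: "real R ^ 4 + real R + 1 \<le> real T / ln (real T)" using T2 by linarith
    have h: "prime_ratio u \<ge> 1" by (rule prime_ratio_ge_1)
    have "real T * prime_ratio u / ln (real R + 1) \<le> real T * prime_ratio u / (ln (real T) / 8)"
      using ln lnT h R by (intro divide_left_mono mult_pos_pos) auto
    moreover have "real T / ln (real T) \<le> prime_ratio u * (real T / ln (real T))"
      using h lnT mult_right_mono[of 1 "prime_ratio u" "real T / ln (real T)"] by simp
    moreover have "real T * prime_ratio u / (ln (real T) / 8) = 8 * (prime_ratio u * (real T / ln (real T)))"
      "9 * prime_ratio u * real T / ln (real T) = 9 * (prime_ratio u * (real T / ln (real T)))"
      by simp_all
    ultimately show ?thesis
      using selberg_sieve_linear[OF u R(3), of T v] rest by linarith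
  qed
  then show ?thesis by (intro exI[of _ "max T0 2"]) auto
qed

section \<open>Chebyshev's lower bound\<close>

definition prime_set :: "nat \<Rightarrow> nat set"
  where "prime_set z = {q. prime q \<and> q \<le> z}"

lemma finite_prime_set [simp]: "finite (prime_set z)"
  by (rule finite_subset[of _ "{..z}"]) (auto simp: prime_set_def)

lemma prime_set_ge_2: "q \<in> prime_set z \<Longrightarrow> q \<ge> 2"
  by (auto simp: prime_set_def prime_ge_2_nat)

lemma int_poly_integral_scaled:
  fixes P :: "real poly"
  assumes "\<And>k. k \<le> degree P \<Longrightarrow> Suc k dvd N" "\<And>k. poly.coeff P k \<in> \<int>"
  shows "real N * (\<Sum>k\<le>degree P. poly.coeff P k / real (Suc k)) \<in> \<int>"
  unfolding sum_distrib_left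
proof (rule Ints_sum)
  fix k assume "k \<in> {..degree P}"
  then have "real N / real (Suc k) = real (N div Suc k)"
    using assms(1) by (simp add: real_of_nat_div del: of_nat_Suc)
  then have "real N * (poly.coeff P k / real (Suc k)) = real (N div Suc k) * poly.coeff P k"
    by (metis times_divide_eq_left times_divide_eq_right)
  then show "real N * (poly.coeff P k / real (Suc k)) \<in> \<int>"
    using assms(2) by (simp add: Ints_mult)
qed

lemma Ints_coeff_power:
  fixes P :: "real poly"
  assumes "\<And>k. poly.coeff P k \<in> \<int>"
  shows "poly.coeff (P ^ m) k \<in> \<int>"
proof (induction m arbitrary: k)
  case (Suc m)
  then show ?case using assms by (simp add: coeff_mult Ints_sum Ints_mult)
qed (simp add: coeff_1)

text \<open>The integral of \<open>x\<^sup>m (1 - x)\<^sup>m\<close> over the unit interval lies between \<open>0\<close> and \<open>4\<^sup>-\<^sup>m\<close>, and any common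
  multiple of \<open>1, \<dots>, 2 m + 1\<close> clears its denominators.\<close>
lemma common_multiple_ge:
  fixes N :: nat
  assumes N: "\<And>k. 1 \<le> k \<Longrightarrow> k \<le> 2 * m + 1 \<Longrightarrow> k dvd N" and "N > 0"
  shows "4 ^ m \<le> N"
proof -
  define P :: "real poly" where "P = [:0, 1, -1:] ^ m"
  have deg: "degree P \<le> 2 * m" unfolding P_def by (simp add: degree_power_eq)
  define F where "F x = (\<Sum>k\<le>degree P. poly.coeff P k / real (Suc k) * x ^ Suc k)" for x
  have F': "(F has_real_derivative (x * (1 - x)) ^ m) (at x)" for x
  proof -
    have "(F has_real_derivative (\<Sum>k\<le>degree P. poly.coeff P k * x ^ k)) (at x)"
      unfolding F_def
    proof (rule DERIV_sum)
      fix k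
      have "((\<lambda>x. poly.coeff P k / real (Suc k) * x ^ Suc k) has_real_derivative
          poly.coeff P k / real (Suc k) * (real (Suc k) * x ^ (Suc k - Suc 0))) (at x)"
        by (intro DERIV_cmult DERIV_pow)
      then show "((\<lambda>x. poly.coeff P k / real (Suc k) * x ^ Suc k) has_real_derivative
          poly.coeff P k * x ^ k) (at x)"
        by (simp del: of_nat_Suc)
    qed
    also have "(\<Sum>k\<le>degree P. poly.coeff P k * x ^ k) = poly P x"
      unfolding poly_altdef ..
    also have "poly P x = (x * (1 - x)) ^ m"
      unfolding P_def by (simp add: poly_power algebra_simps)
    finally show ?thesis .
  qed
  \<comment> \<open>The mean value theorem for the antiderivative \<open>F\<close> stands in for the
    integral.\<close>
  obtain \<xi> where \<xi>: "0 < \<xi>" "\<xi> < 1" "F 1 - F 0 = (1 - 0) * (\<xi> * (1 - \<xi>)) ^ m"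
    using MVT2[of 0 1 F "\<lambda>x. (x * (1 - x)) ^ m"] F' by auto
  have F0: "F 0 = 0" by (simp add: F_def)
  have "0 < F 1" using \<xi> F0 by simp
  have "\<xi> * (1 - \<xi>) \<le> 1 / 4"
    using zero_le_power2[of "\<xi> - 1 / 2"] by (simp add: power2_eq_square algebra_simps)
  then have "F 1 \<le> (1 / 4) ^ m" using \<xi> F0 by (simp add: power_mono)
  have "poly.coeff [:0, 1, -1 :: real:] k \<in> \<int>" for k
    by (auto simp: coeff_pCons split: nat.splits)
  then have "real N * F 1 \<in> \<int>"
    unfolding F_def using N deg int_poly_integral_scaled[of P N] Ints_coeff_power[of "[:0, 1, -1:]" m]
    by (simp add: P_def[symmetric])
  then obtain j where j: "real N * F 1 = real_of_int j" by (auto elim: Ints_cases)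
  have "0 < real_of_int j" unfolding j[symmetric] using \<open>0 < F 1\<close> assms(2) by simp
  then have "1 \<le> real_of_int j" by simp
  also have "\<dots> \<le> real N * (1 / 4) ^ m"
    unfolding j[symmetric] using \<open>F 1 \<le> _\<close> by (simp add: mult_left_mono)
  finally have "4 ^ m \<le> real N" by (simp add: field_simps power_divide)
  then show ?thesis by (metis of_nat_le_iff of_nat_numeral of_nat_power)
qed

text \<open>\<open>N\<close> is the least common multiple of 1, ..., n. Each of its prime powers
  divides some k \<le> n, so N is at most n to the number of primes up to n.\<close>

lemma four_power_le_prime_set: "4 ^ m \<le> (2 * m + 1) ^ card (prime_set (2 * m + 1))"
proof -
  define n where "n = 2 * m + 1"
  define e where "e q = Max ((\<lambda>k. multiplicity q k) ` {1..n})" for q :: nat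
  define N where "N = (\<Prod>q\<in>prime_set n. q ^ e q)"
  have n0: "{1..n} \<noteq> {}" by (simp add: n_def)
  have "q ^ e q \<le> n" if "q \<in> prime_set n" for q
  proof -
    have "e q \<in> (\<lambda>k. multiplicity q k) ` {1..n}" unfolding e_def using n0 by (intro Max_in) auto
    then obtain k where k: "k \<in> {1..n}" "e q = multiplicity q k" by auto
    then have "q ^ e q \<le> k" by (metis atLeastAtMost_iff dvd_imp_le less_le_trans multiplicity_dvd zero_less_one)
    then show ?thesis using k by simp
  qed
  then have "N \<le> (\<Prod>q\<in>prime_set n. n)" unfolding N_def by (intro prod_mono) auto
  then have "N \<le> n ^ card (prime_set n)" by simp
  moreover have "4 ^ m \<le> N"
  proof (rule common_multiple_ge)
    show "N > 0" unfolding N_def by (intro prod_pos) (auto dest: prime_set_ge_2)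
    fix k assume k: "1 \<le> k" "k \<le> 2 * m + 1"
    have "prime_factors k \<subseteq> prime_set n"
    proof
      fix q assume q: "q \<in> prime_factors k"
      then have "q \<le> k" using k by (intro dvd_imp_le) auto
      then show "q \<in> prime_set n" using q k by (auto simp: prime_set_def n_def)
    qed
    then have "(\<Prod>q\<in>prime_set n. q ^ multiplicity q k) = k"
      using k by (intro prod_multiplicity_superset) (auto simp: prime_set_def)
    moreover have "(\<Prod>q\<in>prime_set n. q ^ multiplicity q k) dvd N"
      unfolding N_def using k by (intro prod_dvd_prod le_imp_power_dvd) (auto simp: e_def n_def intro!: Max_ge)
    ultimately show "k dvd N" by (simp only:)
  qed
  ultimately show ?thesis unfolding n_def by linarith
qed

text \<open>Needed because the sieve bounds are multiples of x / ln x and have to be compared with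
  the number of primes. Take logarithms in 4^m \<le> x^\<pi>(x), with m about x / 2.\<close>

lemma chebyshev_lower_bound:
  assumes x: "x \<ge> 12"
  shows "x / (4 * ln x) \<le> real (card {p :: nat. prime p \<and> real p \<le> x})"
proof -
  define m where "m = nat \<lfloor>(x - 1) / 2\<rfloor>"
  have m: "real m \<le> (x - 1) / 2" "(x - 1) / 2 < real m + 1"
  proof -
    have "real m = real_of_int \<lfloor>(x - 1) / 2\<rfloor>" using x by (simp add: m_def)
    then show "real m \<le> (x - 1) / 2" "(x - 1) / 2 < real m + 1" by linarith+
  qed
  let ?c = "card (prime_set (2 * m + 1))"
  have sub: "prime_set (2 * m + 1) \<subseteq> {p :: nat. prime p \<and> real p \<le> x}"
    using m by (auto simp: prime_set_def)
  have "finite {p :: nat. prime p \<and> real p \<le> x}"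
    by (rule finite_subset[of _ "{..nat \<lfloor>x\<rfloor>}"]) (auto simp: le_nat_floor)
  then have le: "?c \<le> card {p :: nat. prime p \<and> real p \<le> x}" using sub by (rule card_mono)
  have "(4 :: real) ^ m \<le> real (2 * m + 1) ^ ?c"
    using four_power_le_prime_set[of m] by (metis of_nat_le_iff of_nat_numeral of_nat_power)
  also have "\<dots> \<le> x ^ ?c" using m by (intro power_mono) auto
  finally have "ln ((4 :: real) ^ m) \<le> ln (x ^ ?c)" using x by simp
  then have "m * ln 4 \<le> ?c * ln x" using x by (simp add: ln_realpow)
  moreover have "1 \<le> ln (4 :: real)" using ln_ge_iff[of 4 1] exp_le by simp
  then have "real m \<le> m * ln 4" using mult_left_mono[of 1 "ln 4" "real m"] by simp
  moreover have "x / 4 \<le> real m" using m x by simp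
  moreover have "0 < ln x" using x by simp
  ultimately have "x / 4 / ln x \<le> ?c" by (simp add: field_simps)
  then show ?thesis using le by (simp add: field_simps)
qed

section \<open>Divergence of the sum of the reciprocals of the primes\<close>

lemma sum_inverse_consecutive_le: "(\<Sum>q\<in>prime_set z. 1 / (real q * (real q - 1))) \<le> 1"
proof -
  have telescope: "n \<ge> 1 \<Longrightarrow> (\<Sum>q\<in>{2..n}. 1 / (real q * (real q - 1))) = 1 - 1 / real n" for n
  proof (induction n rule: nat_induct_at_least)
    case (Suc n)
    then have "(\<Sum>q\<in>{2..Suc n}. 1 / (real q * (real q - 1))) = 1 - 1 / real n + 1 / (real (Suc n) * real n)"
      by simp
    also have "\<dots> = 1 - 1 / real (Suc n)" using Suc.hyps by (simp add: divide_simps) (simp add: algebra_simps)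
    finally show ?case .
  qed simp
  have "(\<Sum>q\<in>prime_set z. 1 / (real q * (real q - 1))) \<le> (\<Sum>q\<in>{2..max 1 z}. 1 / (real q * (real q - 1)))"
    by (intro sum_mono2) (auto simp: prime_set_def prime_ge_2_nat)
  also have "\<dots> = 1 - 1 / real (max 1 z)" by (rule telescope) simp
  also have "\<dots> \<le> 1" by simp
  finally show ?thesis .
qed

lemma sum_inverse_squares_le: "(\<Sum>q\<in>prime_set z. 1 / (real q)\<^sup>2) \<le> 1"
proof -
  have "(\<Sum>q\<in>prime_set z. 1 / (real q)\<^sup>2) \<le> (\<Sum>q\<in>prime_set z. 1 / (real q * (real q - 1)))"
    by (intro sum_mono divide_left_mono) (auto simp: power2_eq_square dest!: prime_set_ge_2)
  then show ?thesis using sum_inverse_consecutive_le[of z] by linarith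
qed

definition prime_harmonic :: "nat \<Rightarrow> real"
  where "prime_harmonic z = (\<Sum>q\<in>prime_set z. 1 / real q)"

lemma sum_inverse_pred_le: "(\<Sum>q\<in>prime_set z. 1 / (real q - 1)) \<le> prime_harmonic z + 1"
proof -
  have "(\<Sum>q\<in>prime_set z. 1 / (real q - 1)) = (\<Sum>q\<in>prime_set z. 1 / real q + 1 / (real q * (real q - 1)))"
    by (intro sum.cong refl) (auto simp: field_simps dest!: prime_set_ge_2)
  then show ?thesis using sum_inverse_consecutive_le[of z] by (simp add: sum.distrib prime_harmonic_def)
qed

lemma prod_le_exp_sum:
  assumes "\<And>i. i \<in> A \<Longrightarrow> 0 \<le> 1 + f i"
  shows "(\<Prod>i\<in>A. 1 + f i) \<le> exp (\<Sum>i\<in>A. f i :: real)"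
proof (cases "finite A")
  case True
  then have "exp (\<Sum>i\<in>A. f i) = (\<Prod>i\<in>A. exp (f i))" by (rule exp_sum)
  then show ?thesis using assms by (auto intro!: prod_mono exp_ge_add_one_self)
qed simp

text \<open>Take u to be the product of all primes up to z in
  \<open>ln_le_prime_ratio_sieve_sum\<close>. No prime is left to sieve by, so
  \<open>sieve_sum u z\<close> is at most 1, and the inequality becomes Euler's comparison of the
  harmonic sum with the product of q / (q - 1).\<close>

lemma ln_ln_le_prime_harmonic: "ln (real z + 1) \<le> exp (prime_harmonic z + 1)"
proof -
  define u where "u = \<Prod>(prime_set z)"
  have pr: "\<And>q. q \<in> prime_set z \<Longrightarrow> prime q" by (auto simp: prime_set_def)
  have u0: "u > 0" unfolding u_def using pr by (intro prod_pos) (auto simp: prime_gt_0_nat)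
  have dvd: "prime q \<Longrightarrow> q dvd u \<longleftrightarrow> q \<in> prime_set z" for q
    unfolding u_def using pr by (intro prime_dvd_prod_primes) auto
  have "sieving_primes u z = {}" using dvd by (auto simp: sieving_primes_def prime_set_def)
  then have "sieving_sets u z = {S. S = {} \<and> 1 \<le> z}" by (auto simp: sieving_sets_def)
  then have "sieve_sum u z \<le> 1" by (cases "1 \<le> z") (auto simp: sieve_sum_def)
  moreover have "prime_ratio u = (\<Prod>q\<in>prime_set z. 1 + 1 / (real q - 1))"
  proof -
    have "prime_factors u = prime_set z" using dvd u0 by (auto simp: prime_factors_dvd prime_set_def)
    then show ?thesis by (simp add: prime_ratio_def)
  qed
  ultimately have "ln (real z + 1) \<le> (\<Prod>q\<in>prime_set z. 1 + 1 / (real q - 1)) * 1"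
  proof -
    have "prime_ratio u * sieve_sum u z \<le> prime_ratio u * 1"
      using \<open>sieve_sum u z \<le> 1\<close> prime_ratio_ge_1[of u] by (intro mult_left_mono) auto
    then show ?thesis
      using ln_le_prime_ratio_sieve_sum[OF u0, of z] \<open>prime_ratio u = _\<close> by simp
  qed
  also have "\<dots> \<le> exp (\<Sum>q\<in>prime_set z. 1 / (real q - 1))"
    unfolding mult_1_right by (rule prod_le_exp_sum) (auto dest!: prime_set_ge_2)
  also have "\<dots> \<le> exp (prime_harmonic z + 1)" using sum_inverse_pred_le by simp
  finally show ?thesis .
qed

lemma prime_harmonic_unbounded: "\<exists>z. K \<le> prime_harmonic z"
proof -
  have "eventually (\<lambda>z :: nat. exp (K + 1) \<le> ln (real z + 1)) sequentially" by real_asymp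
  then obtain z where "exp (K + 1) \<le> ln (real z + 1)" by (auto simp: eventually_sequentially)
  then have "exp (K + 1) \<le> exp (prime_harmonic z + 1)" using ln_ln_le_prime_harmonic[of z] by linarith
  then show ?thesis by auto
qed

section \<open>Mean values of functions of the prime factors\<close>

lemma prod_divisor_indicators:
  fixes Z :: "nat set"
  assumes "finite Z" "\<And>q. q \<in> Z \<Longrightarrow> prime q"
  shows "(\<Prod>q\<in>Z. 1 + (if q dvd a then c q else 0)) = (\<Sum>S\<in>Pow Z. (\<Prod>q\<in>S. c q) * (if \<Prod>S dvd a then 1 else 0 :: real))"
proof -
  have "(\<Prod>q\<in>Z. (if q dvd a then c q else 0) + 1) = (\<Sum>S\<in>Pow Z. (\<Prod>q\<in>S. if q dvd a then c q else 0))"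
    using prod_add[OF assms(1), of "\<lambda>q. if q dvd a then c q else 0" "\<lambda>_. 1"] by simp
  also have "\<dots> = (\<Sum>S\<in>Pow Z. (\<Prod>q\<in>S. c q) * (if \<Prod>S dvd a then 1 else 0))"
  proof (intro sum.cong refl)
    fix S assume "S \<in> Pow Z"
    then have S: "finite S" "\<And>q. q \<in> S \<Longrightarrow> prime q" using assms finite_subset by auto
    show "(\<Prod>q\<in>S. if q dvd a then c q else 0) = (\<Prod>q\<in>S. c q) * (if \<Prod>S dvd a then 1 else 0)"
    proof (cases "\<forall>q\<in>S. q dvd a")
      case True
      then show ?thesis using prod_primes_dvd_iff[OF S, of a] by simp
    next
      case False
      then have "(\<Prod>q\<in>S. if q dvd a then c q else 0) = 0"
        using S(1) by (intro prod_zero) auto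
      moreover have "\<not> \<Prod>S dvd a" using False prod_primes_dvd_iff[OF S, of a] by blast
      ultimately show ?thesis by simp
    qed
  qed
  finally show ?thesis by (simp add: add.commute)
qed

lemma card_multiples:
  fixes N Y :: nat
  assumes "N > 0"
  shows "card {a\<in>{1..Y}. N dvd a} = Y div N"
proof -
  have "{a\<in>{1..Y}. N dvd a} = (\<lambda>j. N * j) ` {1..Y div N}"
    using assms by (auto simp: less_eq_div_iff_mult_less_eq mult.commute image_iff elim!: dvdE)
  moreover have "inj_on (\<lambda>j. N * j) {1..Y div N}" using assms by (auto simp: inj_on_def)
  ultimately show ?thesis by (simp add: card_image)
qed

text \<open>With g(q) = (q / (q - 1))^2 - 1, the square of \<open>prime_ratio a\<close> is the sum
  of the products of g over the squarefree divisors of a. Its mean is at most the product of 1 +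
  g(q) / q, which is bounded because g(q) / q \<le> 6 / q^2.\<close>

lemma sum_prime_ratio_squared_le: "(\<Sum>a\<in>{1..Y}. prime_ratio a ^ 2) \<le> exp 6 * real Y"
proof -
  define g where "g q = (2 * real q - 1) / (real q - 1)\<^sup>2" for q :: nat
  let ?Z = "prime_set Y"
  have g0: "0 \<le> g q" if "q \<in> ?Z" for q using prime_set_ge_2[OF that] by (simp add: g_def)
  have pr: "\<And>q. q \<in> ?Z \<Longrightarrow> prime q" by (auto simp: prime_set_def)
  have sq: "prime_ratio a ^ 2 = (\<Prod>q\<in>?Z. 1 + (if q dvd a then g q else 0))" if a: "a \<in> {1..Y}" for a
  proof -
    have "prime_ratio a ^ 2 = (\<Prod>q\<in>prime_factors a. (1 + 1 / (real q - 1)) ^ 2)"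
      by (simp add: prime_ratio_def prod_power_distrib)
    also have "\<dots> = (\<Prod>q\<in>prime_factors a. 1 + (if q dvd a then g q else 0))"
    proof (intro prod.cong refl)
      fix q assume q: "q \<in> prime_factors a"
      then have "real q - 1 \<noteq> 0" using prime_ge_2_nat[of q] in_prime_factors_imp_prime[OF q] by auto
      then have "(1 + 1 / (real q - 1)) ^ 2 = 1 + g q"
        unfolding g_def by (simp add: divide_simps power2_eq_square) (simp add: algebra_simps)
      then show "(1 + 1 / (real q - 1)) ^ 2 = 1 + (if q dvd a then g q else 0)"
        using q by (simp add: in_prime_factors_imp_dvd)
    qed
    also have "\<dots> = (\<Prod>q\<in>?Z. 1 + (if q dvd a then g q else 0))"
    proof (intro prod.mono_neutral_left ballI subsetI)
      fix q assume q: "q \<in> prime_factors a"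
      then have "q \<le> a" using a by (intro dvd_imp_le) auto
      then show "q \<in> ?Z" using q a by (auto simp: prime_set_def)
    qed (use a in \<open>auto simp: prime_set_def prime_factors_dvd\<close>)
    finally show ?thesis .
  qed
  have "(\<Sum>a\<in>{1..Y}. prime_ratio a ^ 2) = (\<Sum>a\<in>{1..Y}. \<Sum>S\<in>Pow ?Z. (\<Prod>q\<in>S. g q) * (if \<Prod>S dvd a then 1 else 0))"
    using pr by (intro sum.cong refl) (simp add: sq prod_divisor_indicators)
  also have "\<dots> = (\<Sum>S\<in>Pow ?Z. (\<Prod>q\<in>S. g q) * (\<Sum>a\<in>{1..Y}. if \<Prod>S dvd a then 1 else 0))"
    by (subst sum.swap) (simp add: sum_distrib_left)
  also have "\<dots> \<le> (\<Sum>S\<in>Pow ?Z. (\<Prod>q\<in>S. g q) * (real Y / (\<Prod>q\<in>S. real q)))"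
  proof (intro sum_mono mult_left_mono)
    fix S assume S: "S \<in> Pow ?Z"
    then show "0 \<le> (\<Prod>q\<in>S. g q)" using g0 by (intro prod_nonneg) auto
    have "\<Prod>S > 0" using S pr by (intro prod_pos) (auto simp: prime_gt_0_nat)
    have "(\<Sum>a\<in>{1..Y}. if \<Prod>S dvd a then 1 else 0 :: real) = card {a\<in>{1..Y}. \<Prod>S dvd a}"
      by (simp add: sum.If_cases Int_def)
    also have "\<dots> = real (Y div \<Prod>S)" using card_multiples[OF \<open>\<Prod>S > 0\<close>] by simp
    also have "\<dots> \<le> real Y / real (\<Prod>S)" by (rule of_nat_div_le_of_nat)
    finally show "(\<Sum>a\<in>{1..Y}. if \<Prod>S dvd a then 1 else 0) \<le> real Y / (\<Prod>q\<in>S. real q)" by simp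
  qed
  also have "\<dots> = real Y * (\<Sum>S\<in>Pow ?Z. \<Prod>q\<in>S. g q / real q)"
    by (simp add: sum_distrib_left prod_dividef mult.commute)
  also have "(\<Sum>S\<in>Pow ?Z. \<Prod>q\<in>S. g q / real q) = (\<Prod>q\<in>?Z. 1 + g q / real q)"
    using prod_add[of ?Z "\<lambda>q. g q / real q" "\<lambda>_. 1"] by (simp add: add.commute)
  also have "\<dots> \<le> exp (\<Sum>q\<in>?Z. g q / real q)"
    using g0 by (intro prod_le_exp_sum) (auto intro!: add_nonneg_nonneg)
  also have "(\<Sum>q\<in>?Z. g q / real q) \<le> (\<Sum>q\<in>?Z. 6 * (1 / (real q)\<^sup>2))"
  proof (intro sum_mono)
    fix q assume "q \<in> ?Z"
    then have q: "real q \<ge> 2" using prime_set_ge_2 by fastforce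
    have "0 \<le> (real q - 2) * (4 * real q - 3)" using q by simp
    then have "(2 * real q - 1) * real q \<le> 6 * (real q - 1)\<^sup>2" by (simp add: power2_eq_square algebra_simps)
    then have "g q \<le> 6 / real q" unfolding g_def using q by (simp add: divide_simps)
    then have "g q / real q \<le> 6 / real q / real q" using q by (intro divide_right_mono) auto
    then show "g q / real q \<le> 6 * (1 / (real q)\<^sup>2)" by (simp add: power2_eq_square)
  qed
  also have "\<dots> \<le> 6" using sum_inverse_squares_le[of Y] unfolding sum_distrib_left[symmetric] by linarith
  finally show ?thesis by (simp add: mult.commute[of "exp 6"] mult_left_mono)
qed

definition omega_upto :: "nat \<Rightarrow> nat \<Rightarrow> nat"
  where "omega_upto z a = card {q\<in>prime_set z. q dvd a}"

text \<open>Write the power as a product of factors 1 + (t - 1) over the primes dividing a and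
  expand. Each set of primes costs a rounding error of at most 1, and the main term is Y times the
  product of 1 - (1 - t) / q. The error stays bounded as Y grows with z fixed.\<close>

lemma sum_power_omega_le:
  assumes t: "0 \<le> t" "t \<le> 1"
  shows "(\<Sum>a\<in>{1..Y}. t ^ omega_upto z a) \<le> real Y * exp (- (1 - t) * prime_harmonic z) + 2 ^ card (prime_set z)"
proof -
  let ?Z = "prime_set z"
  have pr: "\<And>q. q \<in> ?Z \<Longrightarrow> prime q" by (auto simp: prime_set_def)
  have pow: "t ^ omega_upto z a = (\<Prod>q\<in>?Z. 1 + (if q dvd a then t - 1 else 0))" for a
  proof -
    have "(\<Prod>q\<in>?Z. 1 + (if q dvd a then t - 1 else 0)) = (\<Prod>q\<in>?Z. if q dvd a then t else 1)"
      by (intro prod.cong) auto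
    also have "\<dots> = t ^ omega_upto z a"
      unfolding omega_upto_def by (simp add: prod.If_cases Int_def)
    finally show ?thesis by simp
  qed
  have "(\<Sum>a\<in>{1..Y}. t ^ omega_upto z a) = (\<Sum>a\<in>{1..Y}. \<Sum>S\<in>Pow ?Z. (\<Prod>q\<in>S. t - 1) * (if \<Prod>S dvd a then 1 else 0))"
    using pr by (intro sum.cong refl) (simp only: pow prod_divisor_indicators finite_prime_set)
  also have "\<dots> = (\<Sum>S\<in>Pow ?Z. (\<Prod>q\<in>S. t - 1) * (\<Sum>a\<in>{1..Y}. if \<Prod>S dvd a then 1 else 0))"
    by (subst sum.swap) (simp add: sum_distrib_left)
  also have "\<dots> \<le> (\<Sum>S\<in>Pow ?Z. real Y * (\<Prod>q\<in>S. (t - 1) / real q) + 1)"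
  proof (intro sum_mono)
    fix S assume S: "S \<in> Pow ?Z"
    define N where "N = \<Prod>S"
    have "N > 0" unfolding N_def using S pr by (intro prod_pos) (auto simp: prime_gt_0_nat)
    have "(\<Sum>a\<in>{1..Y}. if N dvd a then 1 else 0 :: real) = card {a\<in>{1..Y}. N dvd a}"
      by (simp add: sum.If_cases Int_def)
    also have "\<dots> = real (Y div N)" using card_multiples[OF \<open>N > 0\<close>] by simp
    finally have cnt: "(\<Sum>a\<in>{1..Y}. if N dvd a then 1 else 0 :: real) = real (Y div N)" .
    have "real (Y div N) \<le> real Y / N" by (rule of_nat_div_le_of_nat)
    moreover have "real Y / N \<le> real (Y div N) + 1"
    proof -
      have "Y < N * (Y div N) + N" using \<open>N > 0\<close> by (metis add.commute dividend_less_div_times mult.commute)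
      then have "real Y \<le> real N * (real (Y div N) + 1)"
        by (simp add: distrib_left flip: of_nat_mult of_nat_add)
      then show ?thesis using \<open>N > 0\<close> by (simp add: divide_simps mult.commute)
    qed
    ultimately have "\<bar>real (Y div N) - real Y / N\<bar> \<le> 1" by simp
    moreover have "\<bar>\<Prod>q\<in>S. t - 1\<bar> \<le> 1" using t by (simp add: power_abs power_le_one)
    ultimately have "\<bar>(\<Prod>q\<in>S. t - 1) * (real (Y div N) - real Y / N)\<bar> \<le> 1 * 1"
      unfolding abs_mult by (intro mult_mono) auto
    then have "(\<Prod>q\<in>S. t - 1) * real (Y div N) \<le> (\<Prod>q\<in>S. t - 1) * (real Y / N) + 1"
      unfolding right_diff_distrib by simp
    moreover have "(\<Prod>q\<in>S. t - 1) * (real Y / N) = real Y * (\<Prod>q\<in>S. (t - 1) / real q)"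
      by (simp add: N_def prod_dividef)
    ultimately show "(\<Prod>q\<in>S. t - 1) * (\<Sum>a\<in>{1..Y}. if \<Prod>S dvd a then 1 else 0) \<le> real Y * (\<Prod>q\<in>S. (t - 1) / real q) + 1"
      unfolding N_def[symmetric] cnt by simp
  qed
  also have "\<dots> = real Y * (\<Sum>S\<in>Pow ?Z. \<Prod>q\<in>S. (t - 1) / real q) + 2 ^ card ?Z"
    by (simp add: sum.distrib sum_distrib_left card_Pow)
  also have "(\<Sum>S\<in>Pow ?Z. \<Prod>q\<in>S. (t - 1) / real q) = (\<Prod>q\<in>?Z. 1 + (t - 1) / real q)"
    using prod_add[of ?Z "\<lambda>q. (t - 1) / real q" "\<lambda>_. 1"] by (simp add: add.commute)
  also have "\<dots> \<le> exp (\<Sum>q\<in>?Z. (t - 1) / real q)"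
  proof (rule prod_le_exp_sum)
    fix q assume "q \<in> ?Z"
    then have "real q \<ge> 2" using prime_set_ge_2 by fastforce
    then show "0 \<le> 1 + (t - 1) / real q" using t by (simp add: field_simps)
  qed
  also have "(\<Sum>q\<in>?Z. (t - 1) / real q) = - (1 - t) * prime_harmonic z"
    by (simp add: prime_harmonic_def sum_distrib_left field_simps)
  finally show ?thesis by (simp add: mult_left_mono)
qed

section \<open>Shifted primes with a balanced factorization\<close>

text \<open>Sieve p = r t + d + 1 with t \<le> X / r. As r is fixed, ln (X / r) is asymptotic to ln
  X, and a factor 2 for this and for rounding turns 9 into 18.\<close>

lemma card_primes_in_class_le:
  fixes r d :: nat
  assumes r: "r > 0"
  shows "\<forall>\<^sub>F X in sequentially. real (card {p. prime p \<and> p \<le> X \<and> d + 1 < p \<and> r dvd p - (d + 1)})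
           \<le> 18 * (prime_ratio r / real r) * (real X / ln (real X))"
proof -
  obtain T0 where T0: "T0 \<ge> 2" "\<And>T u v. T \<ge> T0 \<Longrightarrow> u > 0 \<Longrightarrow>
      real (card {t\<in>{..<T}. prime (u * t + v)}) \<le> 9 * prime_ratio u * real T / ln (real T)"
    using linear_primes_upper_bound by blast
  define c where "c = real r"
  have c: "c > 0" using r by (simp add: c_def)
  have "\<forall>\<^sub>F X :: nat in sequentially. real X / c > 1 \<and> real X / c \<ge> real T0 \<and>
      (real X / c + 1) / ln (real X / c) \<le> 2 * (real X / c) / ln (real X)"
    using c by (intro eventually_conj) real_asymp+
  then show ?thesis
  proof eventually_elim
    case (elim X)
    define T where "T = X div r + 1"
    have T: "real X / c \<le> real T" "real T \<le> real X / c + 1"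
    proof -
      have "real X < real (r * T)" unfolding T_def using r
        by (metis Suc_eq_plus1 add.commute dividend_less_times_div mult_Suc_right of_nat_less_iff)
      then show "real X / c \<le> real T" using c by (simp add: c_def field_simps)
      show "real T \<le> real X / c + 1" unfolding T_def c_def using of_nat_div_le_of_nat[of X r, where 'a = real] by simp
    qed
    have "T \<ge> T0" using elim T by linarith
    let ?S = "{p. prime p \<and> p \<le> X \<and> d + 1 < p \<and> r dvd p - (d + 1)}"
    have "card ?S \<le> card {t\<in>{..<T}. prime (r * t + (d + 1))}"
    proof (rule card_inj_on_le[of "\<lambda>p. (p - (d + 1)) div r"])
      show "inj_on (\<lambda>p. (p - (d + 1)) div r) ?S"
      proof (rule inj_onI)
        fix p q assume pq: "p \<in> ?S" "q \<in> ?S" "(p - (d + 1)) div r = (q - (d + 1)) div r"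
        then have "p - (d + 1) = q - (d + 1)" by (metis (lifting) mem_Collect_eq dvd_mult_div_cancel)
        then show "p = q" using pq by auto
      qed
      show "(\<lambda>p. (p - (d + 1)) div r) ` ?S \<subseteq> {t\<in>{..<T}. prime (r * t + (d + 1))}"
      proof (rule image_subsetI)
        fix p assume p: "p \<in> ?S"
        then have "r * ((p - (d + 1)) div r) + (d + 1) = p" by simp
        moreover have "(p - (d + 1)) div r \<le> X div r" using p by (intro div_le_mono) auto
        ultimately show "(p - (d + 1)) div r \<in> {t\<in>{..<T}. prime (r * t + (d + 1))}" using p by (simp add: T_def)
      qed
    qed simp
    then have "real (card ?S) \<le> 9 * prime_ratio r * real T / ln (real T)"
      using T0(2)[OF \<open>T \<ge> T0\<close> r, of "d + 1"] by linarith
    also have "\<dots> = 9 * prime_ratio r * (real T / ln (real T))" by simp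
    also have "real T / ln (real T) \<le> (real X / c + 1) / ln (real X / c)"
      using T elim by (intro frac_le) auto
    also have "\<dots> \<le> 2 * (real X / c) / ln (real X)" using elim by blast
    finally have "real (card ?S) \<le> 9 * prime_ratio r * (2 * (real X / c) / ln (real X))"
      using prime_ratio_ge_1[of r] by (simp add: mult_left_mono)
    then show ?case by (simp add: c_def mult_ac)
  qed
qed

text \<open>The factor at \<open>q\<close> is \<open>1\<close>, \<open>3/2\<close> or \<open>9/4\<close> according to whether \<open>q\<close> divides \<open>N\<close> not at all, once or at least twice, so
  that primes dividing both \<open>a\<close> and \<open>b\<close> are counted twice in \<open>N = d a b\<close>.\<close>
definition tail_weight :: "nat \<Rightarrow> nat \<Rightarrow> real"
  where "tail_weight z N = (\<Prod>q\<in>prime_set z. 1 + (if q dvd N then 1 / 2 else 0) + (if q\<^sup>2 dvd N then 3 / 4 else 0))"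

lemma tail_weight_mult_ge:
  "(3 / 2) ^ (omega_upto z a + omega_upto z b) \<le> tail_weight z (d * (a * b))"
proof -
  have om: "(3 / 2 :: real) ^ omega_upto z a = (\<Prod>q\<in>prime_set z. if q dvd a then 3 / 2 else 1)" for a
    unfolding omega_upto_def by (simp add: prod.If_cases Int_def)
  have "(3 / 2 :: real) ^ (omega_upto z a + omega_upto z b) =
      (\<Prod>q\<in>prime_set z. (if q dvd a then 3 / 2 else 1) * (if q dvd b then 3 / 2 else 1))"
    by (simp add: power_add om prod.distrib)
  also have "\<dots> \<le> tail_weight z (d * (a * b))"
    unfolding tail_weight_def
    by (intro prod_mono) (auto simp: power2_eq_square intro: mult_dvd_mono)
  finally show ?thesis .
qed

lemma prime_ratio_prod_prime_powers:
  assumes "finite S" "\<And>q. q \<in> S \<Longrightarrow> prime q"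
  shows "prime_ratio (\<Prod>q\<in>S. q ^ e q) = (\<Prod>q\<in>S. if e q = 0 then 1 else 1 + 1 / (real q - 1))"
proof -
  have pos: "(\<Prod>q\<in>S. q ^ e q) > 0" using assms(2) by (intro prod_pos) (auto simp: prime_gt_0_nat)
  have "prime_factors (\<Prod>q\<in>S. q ^ e q) = {q\<in>S. e q \<noteq> 0}"
  proof (intro equalityI subsetI)
    fix r assume "r \<in> prime_factors (\<Prod>q\<in>S. q ^ e q)"
    then have r: "prime r" "r dvd (\<Prod>q\<in>S. q ^ e q)" by auto
    then obtain q where q: "q \<in> S" "r dvd q ^ e q" using assms(1) by (auto simp: prime_dvd_prod_iff)
    then have "r dvd q" using r prime_dvd_power by blast
    then have "r = q" using r assms(2)[OF q(1)] primes_dvd_imp_eq by blast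
    moreover have "e q \<noteq> 0" using q(2) r(1) by (auto intro!: Nat.gr0I)
    ultimately show "r \<in> {q\<in>S. e q \<noteq> 0}" using q by simp
  next
    fix q assume q: "q \<in> {q\<in>S. e q \<noteq> 0}"
    then have "q dvd q ^ e q" by (simp add: dvd_power)
    also have "q ^ e q dvd (\<Prod>q\<in>S. q ^ e q)" using q assms(1) by (intro dvd_prodI) auto
    finally show "q \<in> prime_factors (\<Prod>q\<in>S. q ^ e q)"
      using q assms(2) pos by (intro prime_factorsI) auto
  qed
  then have "prime_ratio (\<Prod>q\<in>S. q ^ e q) = (\<Prod>q\<in>{q\<in>S. e q \<noteq> 0}. 1 + 1 / (real q - 1))"
    by (simp add: prime_ratio_def)
  also have "\<dots> = (\<Prod>q\<in>S. if e q = 0 then 1 else 1 + 1 / (real q - 1))"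
    using assms(1) by (intro prod.mono_neutral_cong_left) auto
  finally show ?thesis .
qed

text \<open>Expanding the weight leaves, for each vector of exponents 0, 1, 2, a count of primes in
  one class modulo \<open>r e\<close>; these are finitely many since z is fixed. The sieve bounds
  combine into an Euler product with factors 1 + 1/2 / (q - 1) + 3/4 / (q (q - 1)). The two sums
  over q are at most (L + 1) / 2 and 3/4, where L is \<open>prime_harmonic z\<close>, which gives L
  / 2 + 5/4.\<close>

lemma sum_tail_weight_le:
  "\<forall>\<^sub>F X in sequentially. (\<Sum>p\<in>{p. prime p \<and> p \<le> X \<and> d + 1 < p}. tail_weight z (p - (d + 1)))
     \<le> 18 * exp (prime_harmonic z / 2 + 5 / 4) * (real X / ln (real X))"
proof -
  let ?Z = "prime_set z"
  define E where "E = PiE ?Z (\<lambda>_. {0, 1, 2 :: nat})"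
  define cf :: "nat \<Rightarrow> real" where "cf j = (if j = 0 then 1 else if j = 1 then 1 / 2 else 3 / 4)" for j
  define r where "r e = (\<Prod>q\<in>?Z. q ^ e q)" for e :: "nat \<Rightarrow> nat"
  define C where "C e = (\<Prod>q\<in>?Z. cf (e q))" for e :: "nat \<Rightarrow> nat"
  have pr: "\<And>q. q \<in> ?Z \<Longrightarrow> prime q" by (auto simp: prime_set_def)
  have finE: "finite E" unfolding E_def by (intro finite_PiE) auto
  have C0: "C e \<ge> 0" for e unfolding C_def cf_def by (intro prod_nonneg) auto
  have r0: "r e > 0" for e unfolding r_def using pr by (intro prod_pos) (auto simp: prime_gt_0_nat)
  have weight: "tail_weight z N = (\<Sum>e\<in>E. C e * (if r e dvd N then 1 else 0))" for N
  proof -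
    have "tail_weight z N = (\<Prod>q\<in>?Z. \<Sum>j\<in>{0, 1, 2}. cf j * (if q ^ j dvd N then 1 else 0))"
      unfolding tail_weight_def by (intro prod.cong) (auto simp: cf_def)
    also have "\<dots> = (\<Sum>e\<in>E. \<Prod>q\<in>?Z. cf (e q) * (if q ^ e q dvd N then 1 else 0))"
      unfolding E_def by (intro prod_sum_PiE) auto
    also have "\<dots> = (\<Sum>e\<in>E. C e * (if r e dvd N then 1 else 0))"
    proof (intro sum.cong refl)
      fix e
      have "(\<Prod>q\<in>?Z. if q ^ e q dvd N then 1 else 0 :: real) = (if \<forall>q\<in>?Z. q ^ e q dvd N then 1 else 0)"
        by (auto intro!: prod_zero)
      then show "(\<Prod>q\<in>?Z. cf (e q) * (if q ^ e q dvd N then 1 else 0)) = C e * (if r e dvd N then 1 else 0)"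
        unfolding C_def prod.distrib by (simp only: r_def prod_prime_powers_dvd_iff[OF finite_prime_set pr])
    qed
    finally show ?thesis .
  qed
  have total: "(\<Sum>e\<in>E. C e * (prime_ratio (r e) / real (r e))) \<le> exp (prime_harmonic z / 2 + 5 / 4)"
  proof -
    define g where "g q j = cf j * (if j = 0 then 1 else 1 + 1 / (real q - 1)) / real q ^ j" for q j :: nat
    have "C e * (prime_ratio (r e) / real (r e)) = (\<Prod>q\<in>?Z. g q (e q))" for e
    proof -
      have "prime_ratio (r e) = (\<Prod>q\<in>?Z. if e q = 0 then 1 else 1 + 1 / (real q - 1))"
        unfolding r_def using pr by (intro prime_ratio_prod_prime_powers) auto
      then show ?thesis unfolding C_def g_def r_def by (simp add: prod.distrib prod_dividef)
    qed
    then have "(\<Sum>e\<in>E. C e * (prime_ratio (r e) / real (r e))) = (\<Sum>e\<in>E. \<Prod>q\<in>?Z. g q (e q))"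
      by (simp only:)
    also have "\<dots> = (\<Prod>q\<in>?Z. \<Sum>j\<in>{0, 1, 2}. g q j)"
      unfolding E_def by (intro prod_sum_PiE[symmetric]) auto
    also have "\<dots> = (\<Prod>q\<in>?Z. 1 + (1 / 2 * (1 / (real q - 1)) + 3 / 4 * (1 / (real q * (real q - 1)))))"
    proof (intro prod.cong refl)
      fix q assume "q \<in> ?Z"
      then have "real q \<ge> 2" using prime_set_ge_2 by fastforce
      then have "1 + 1 / (real q - 1) = real q / (real q - 1)" by (simp add: field_simps)
      then show "(\<Sum>j\<in>{0, 1, 2}. g q j) = 1 + (1 / 2 * (1 / (real q - 1)) + 3 / 4 * (1 / (real q * (real q - 1))))"
        using \<open>real q \<ge> 2\<close> by (simp add: g_def cf_def power2_eq_square)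
    qed
    also have "\<dots> \<le> exp (\<Sum>q\<in>?Z. 1 / 2 * (1 / (real q - 1)) + 3 / 4 * (1 / (real q * (real q - 1))))"
      by (intro prod_le_exp_sum) (auto dest!: prime_set_ge_2)
    also have "(\<Sum>q\<in>?Z. 1 / 2 * (1 / (real q - 1)) + 3 / 4 * (1 / (real q * (real q - 1)))) \<le> prime_harmonic z / 2 + 5 / 4"
      unfolding sum.distrib sum_distrib_left[symmetric]
      using sum_inverse_pred_le[of z] sum_inverse_consecutive_le[of z] by linarith
    finally show ?thesis by simp
  qed
  have "\<forall>\<^sub>F X in sequentially. \<forall>e\<in>E. real (card {p. prime p \<and> p \<le> X \<and> d + 1 < p \<and> r e dvd p - (d + 1)})
           \<le> 18 * (prime_ratio (r e) / real (r e)) * (real X / ln (real X))"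
    using finE r0 by (intro eventually_ball_finite ballI card_primes_in_class_le) auto
  moreover have "\<forall>\<^sub>F X :: nat in sequentially. real X / ln (real X) \<ge> 0" by real_asymp
  ultimately show ?thesis
  proof eventually_elim
    case (elim X)
    let ?P = "{p. prime p \<and> p \<le> X \<and> d + 1 < p}"
    have finP: "finite ?P" by (rule finite_subset[of _ "{..X}"]) auto
    have "(\<Sum>p\<in>?P. tail_weight z (p - (d + 1))) = (\<Sum>e\<in>E. C e * (\<Sum>p\<in>?P. if r e dvd p - (d + 1) then 1 else 0))"
      unfolding weight by (subst sum.swap) (simp add: sum_distrib_left)
    also have "\<dots> = (\<Sum>e\<in>E. C e * real (card {p. prime p \<and> p \<le> X \<and> d + 1 < p \<and> r e dvd p - (d + 1)}))"
      using finP by (intro sum.cong refl) (simp add: sum.If_cases Int_def conj_assoc)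
    also have "\<dots> \<le> (\<Sum>e\<in>E. C e * (18 * (prime_ratio (r e) / real (r e)) * (real X / ln (real X))))"
      using elim(1) C0 by (intro sum_mono mult_left_mono) auto
    also have "\<dots> = 18 * (\<Sum>e\<in>E. C e * (prime_ratio (r e) / real (r e))) * (real X / ln (real X))"
      unfolding sum_distrib_left sum_distrib_right by (intro sum.cong refl) (simp only: mult_ac)
    also have "\<dots> \<le> 18 * exp (prime_harmonic z / 2 + 5 / 4) * (real X / ln (real X))"
      using total elim(2) by (intro mult_right_mono mult_left_mono) auto
    finally show ?case .
  qed
qed

text \<open>Rankin's method at the threshold 3 L / 2 needs 3/2 ln (3/2) > 1/2; the value 9/25 leaves
  27/50 - 1/2 = 1/25.\<close>

lemma ln_three_halves_ge: "ln (3 / 2 :: real) \<ge> 9 / 25"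
proof -
  have "sqrt (2 / 3) \<le> 41 / 50" by (rule real_le_lsqrt) (auto simp: power2_eq_square)
  moreover have "ln (sqrt (2 / 3)) \<le> sqrt (2 / 3) - 1" by (rule ln_le_minus_one) simp
  moreover have "ln (sqrt (2 / 3)) = ln (2 / 3) / 2" by (simp add: ln_sqrt)
  moreover have "ln (3 / 2 :: real) = - ln (2 / 3)" by (simp add: ln_div)
  ultimately show ?thesis by simp
qed

text \<open>At the threshold 3 L / 4, 3/4 ln (4/3) < 1/4 is needed; the value 8/25 leaves 1/4 - 6/25
  = 1/100.\<close>

lemma ln_four_thirds_le: "ln (4 / 3 :: real) \<le> 8 / 25"
proof -
  have "sqrt (4 / 3) \<le> 29 / 25" by (rule real_le_lsqrt) (auto simp: power2_eq_square)
  moreover have "ln (sqrt (4 / 3)) \<le> sqrt (4 / 3) - 1" by (rule ln_le_minus_one) simp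
  moreover have "ln (sqrt (4 / 3)) = ln (4 / 3) / 2" by (simp add: ln_sqrt)
  ultimately show ?thesis by simp
qed

text \<open>Rankin's method: at every prime counted the weight is at least (3/2)^(3 L / 2) \<ge> exp
  (27 L / 50), where L is \<open>prime_harmonic z\<close>, while its total is at most a constant
  times exp (L / 2) X / ln X.\<close>

lemma card_many_prime_factors_le:
  "\<forall>\<^sub>F X in sequentially. real (card {p. prime p \<and> p \<le> X \<and> d + 1 < p \<and>
       (\<exists>a b. p - (d + 1) = d * (a * b) \<and> 3 / 2 * prime_harmonic z \<le> real (omega_upto z a + omega_upto z b))})
     \<le> 18 * exp (5 / 4 - prime_harmonic z / 25) * (real X / ln (real X))"
  using sum_tail_weight_le[where d = d and z = z]
proof eventually_elim
  case (elim X)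
  let ?P = "{p. prime p \<and> p \<le> X \<and> d + 1 < p}"
  define S where "S = {p. prime p \<and> p \<le> X \<and> d + 1 < p \<and>
       (\<exists>a b. p - (d + 1) = d * (a * b) \<and> 3 / 2 * prime_harmonic z \<le> real (omega_upto z a + omega_upto z b))}"
  define B where "B = exp (27 / 50 * prime_harmonic z)"
  have finP: "finite ?P" by (rule finite_subset[of _ "{..X}"]) auto
  have tw: "tail_weight z N \<ge> 0" for N unfolding tail_weight_def by (intro prod_nonneg) auto
  have L0: "prime_harmonic z \<ge> 0" unfolding prime_harmonic_def by (intro sum_nonneg) auto
  have "B \<le> tail_weight z (p - (d + 1))" if p: "p \<in> S" for p
  proof -
    obtain a b where ab: "p - (d + 1) = d * (a * b)" "3 / 2 * prime_harmonic z \<le> real (omega_upto z a + omega_upto z b)"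
      using p by (auto simp: S_def)
    have "27 / 50 * prime_harmonic z \<le> (3 / 2 * prime_harmonic z) * ln (3 / 2)"
      using mult_left_mono[OF ln_three_halves_ge, of "3 / 2 * prime_harmonic z"] L0 by simp
    also have "\<dots> \<le> real (omega_upto z a + omega_upto z b) * ln (3 / 2)"
      using ab(2) ln_three_halves_ge by (intro mult_right_mono) auto
    also have "\<dots> = ln ((3 / 2) ^ (omega_upto z a + omega_upto z b))" by (simp add: ln_realpow)
    finally have "B \<le> (3 / 2) ^ (omega_upto z a + omega_upto z b)" unfolding B_def by (subst (asm) ln_ge_iff) auto
    then show ?thesis using tail_weight_mult_ge[of z a b d] unfolding ab(1) by linarith
  qed
  then have "(\<Sum>p\<in>S. B) \<le> (\<Sum>p\<in>S. tail_weight z (p - (d + 1)))" by (rule sum_mono)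
  also have "\<dots> \<le> (\<Sum>p\<in>?P. tail_weight z (p - (d + 1)))"
    using finP tw by (intro sum_mono2) (auto simp: S_def)
  also have "\<dots> \<le> 18 * exp (prime_harmonic z / 2 + 5 / 4) * (real X / ln (real X))" by (rule elim)
  also have "exp (prime_harmonic z / 2 + 5 / 4) = exp (5 / 4 - prime_harmonic z / 25) * B"
    unfolding B_def exp_add[symmetric] by (simp add: field_simps)
  finally have "real (card S) * B \<le> (18 * exp (5 / 4 - prime_harmonic z / 25) * (real X / ln (real X))) * B"
    by (simp add: mult_ac)
  then have "real (card S) \<le> 18 * exp (5 / 4 - prime_harmonic z / 25) * (real X / ln (real X))"
    by (subst (asm) mult_le_cancel_right) (auto simp: B_def)
  then show ?case unfolding S_def .
qed

lemma prime_ratio_mult_le: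
  assumes "a > 0" "b > 0"
  shows "prime_ratio (a * b) \<le> prime_ratio a * prime_ratio b"
proof -
  let ?f = "\<lambda>q. 1 + 1 / (real q - 1)"
  have f: "?f q \<ge> 1" if "q \<in> prime_factors n" for q n
    using prime_ge_2_nat[of q] in_prime_factors_imp_prime[OF that] by simp
  have "prime_factors (a * b) = prime_factors a \<union> prime_factors b"
    using assms by (simp add: prime_factors_product)
  then have "prime_ratio (a * b) * (\<Prod>q\<in>prime_factors a \<inter> prime_factors b. ?f q) = prime_ratio a * prime_ratio b"
    unfolding prime_ratio_def by (simp add: prod.union_inter)
  moreover have "1 \<le> (\<Prod>q\<in>prime_factors a \<inter> prime_factors b. ?f q)" using f by (intro prod_ge_1) auto
  ultimately show ?thesis
    using mult_left_mono[of 1 "\<Prod>q\<in>prime_factors a \<inter> prime_factors b. ?f q" "prime_ratio (a * b)"] prime_ratio_ge_1[of "a * b"]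
    by simp
qed

text \<open>Rankin's method with base 3/4 bounds the number of such a by 2 exp (- L / 100) Y. The
  weight \<open>prime_ratio\<close> is brought in by Cauchy-Schwarz and its bounded mean square,
  which halves the exponent to L / 200.\<close>

lemma sum_prime_ratio_few_prime_factors_le:
  "\<forall>\<^sub>F Y in sequentially. (\<Sum>a\<in>{a\<in>{1..Y}. real (omega_upto z a) \<le> 3 / 4 * prime_harmonic z}. prime_ratio a)
     \<le> 2 * exp (3 - prime_harmonic z / 200) * real Y"
proof -
  define L where "L = prime_harmonic z"
  have L0: "L \<ge> 0" unfolding L_def prime_harmonic_def by (intro sum_nonneg) auto
  define K where "K = exp (6 / 25 * L) * 2 ^ card (prime_set z)"
  have "\<forall>\<^sub>F Y :: nat in sequentially. K \<le> exp (- L / 100) * real Y"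
    using exp_gt_zero[of "- L / 100"] by real_asymp
  then show ?thesis
  proof eventually_elim
    case (elim Y)
    define S where "S = {a\<in>{1..Y}. real (omega_upto z a) \<le> 3 / 4 * L}"
    have "exp (- (6 / 25 * L)) * real (card S) \<le> (\<Sum>a\<in>S. (3 / 4) ^ omega_upto z a)"
    proof -
      have "exp (- (6 / 25 * L)) \<le> (3 / 4) ^ omega_upto z a" if "a \<in> S" for a
      proof -
        have "real (omega_upto z a) * ln (4 / 3) \<le> (3 / 4 * L) * (8 / 25)"
          using that ln_four_thirds_le L0 by (intro mult_mono) (auto simp: S_def)
        then have "- (6 / 25 * L) \<le> real (omega_upto z a) * (- ln (4 / 3))" by simp
        also have "- ln (4 / 3 :: real) = ln (3 / 4)" by (simp add: ln_div)
        also have "real (omega_upto z a) * ln (3 / 4) = ln ((3 / 4) ^ omega_upto z a)" by (simp add: ln_realpow)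
        finally show ?thesis by (simp add: ln_ge_iff)
      qed
      then have "(\<Sum>a\<in>S. exp (- (6 / 25 * L))) \<le> (\<Sum>a\<in>S. (3 / 4) ^ omega_upto z a)" by (rule sum_mono)
      then show ?thesis by (simp add: mult.commute)
    qed
    also have "\<dots> \<le> (\<Sum>a\<in>{1..Y}. (3 / 4) ^ omega_upto z a)"
      by (intro sum_mono2) (auto simp: S_def)
    also have "\<dots> \<le> real Y * exp (- (1 - 3 / 4) * L) + 2 ^ card (prime_set z)"
      unfolding L_def by (rule sum_power_omega_le) auto
    finally have "exp (6 / 25 * L) * (exp (- (6 / 25 * L)) * real (card S)) \<le>
        exp (6 / 25 * L) * (real Y * exp (- (1 - 3 / 4) * L) + 2 ^ card (prime_set z))"
      by (intro mult_left_mono) auto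
    also have "\<dots> = exp (- L / 100) * real Y + K"
    proof -
      have "exp (6 / 25 * L) * exp (- (1 - 3 / 4) * L) = exp (- L / 100)"
        unfolding exp_add[symmetric] by (simp add: field_simps)
      then show ?thesis unfolding K_def by (simp add: distrib_left mult_ac)
    qed
    also have "exp (6 / 25 * L) * (exp (- (6 / 25 * L)) * real (card S)) = real (card S)"
      by (simp add: exp_minus)
    finally have cardS: "real (card S) \<le> 2 * exp (- L / 100) * real Y" using elim by linarith
    have "(\<Sum>a\<in>S. prime_ratio a * 1) ^ 2 \<le> (\<Sum>a\<in>S. prime_ratio a ^ 2) * (\<Sum>a\<in>S. 1 ^ 2)"
      by (rule Cauchy_Schwarz_ineq_sum)
    also have "(\<Sum>a\<in>S. prime_ratio a ^ 2) \<le> (\<Sum>a\<in>{1..Y}. prime_ratio a ^ 2)"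
      by (intro sum_mono2) (auto simp: S_def)
    also have "\<dots> \<le> exp 6 * real Y" by (rule sum_prime_ratio_squared_le)
    also have "(\<Sum>a\<in>S. 1 ^ 2) = real (card S)" by simp
    also note cardS
    finally have "(\<Sum>a\<in>S. prime_ratio a) ^ 2 \<le> exp 6 * real Y * (2 * exp (- L / 100) * real Y)"
      by (simp add: mult_left_mono mult_right_mono)
    also have "\<dots> \<le> exp 6 * real Y * (4 * exp (- L / 100) * real Y)"
      by (intro mult_left_mono mult_right_mono) auto
    also have "\<dots> = (2 * exp (3 - L / 200) * real Y) ^ 2"
    proof -
      have "exp (3 - L / 200) ^ 2 = exp 6 * exp (- L / 100)"
        unfolding exp_add[symmetric] exp_of_nat_mult[symmetric] by (simp add: field_simps)
      then show ?thesis by (simp add: power_mult_distrib power2_eq_square)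
    qed
    finally have "(\<Sum>a\<in>S. prime_ratio a) \<le> 2 * exp (3 - L / 200) * real Y"
      by (rule power2_le_imp_le) simp
    then show ?case unfolding S_def L_def .
  qed
qed

text \<open>For fixed a, sieve the progression d a t + d + 1 with t \<le> X / (d a). As a \<le>
  \<beta> \<surd>X, the logarithm of this range is at least (ln X) / 4; as a \<ge> \<alpha>
  \<surd>X, the factor 1/a is at most 1 / (\<alpha> \<surd>X), so summing over a loses only \<beta>
  / \<alpha>. The constant is 9 * 2 * 4 = 72, doubled by the preceding lemma.\<close>

lemma card_primes_few_prime_factors_le:
  fixes d :: nat and \<alpha> \<beta> :: real
  assumes d: "d > 0" and \<alpha>: "\<alpha> > 0" and \<beta>: "\<beta> > 0"
  shows "\<forall>\<^sub>F X in sequentially. real (card {p. prime p \<and> p \<le> X \<and> d + 1 < p \<and>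
       (\<exists>a b. p - (d + 1) = d * (a * b) \<and> \<alpha> * sqrt (real X) \<le> real a \<and> real a \<le> \<beta> * sqrt (real X) \<and>
          real (omega_upto z a) \<le> 3 / 4 * prime_harmonic z)})
     \<le> 144 * prime_ratio d / real d * (\<beta> / \<alpha>) * exp (3 - prime_harmonic z / 200) * (real X / ln (real X))"
proof -
  obtain T0 where T0: "T0 \<ge> 2" "\<And>T u v. T \<ge> T0 \<Longrightarrow> u > 0 \<Longrightarrow>
      real (card {t\<in>{..<T}. prime (u * t + v)}) \<le> 9 * prime_ratio u * real T / ln (real T)"
    using linear_primes_upper_bound by blast
  define D where "D = real d"
  have D: "D > 0" using d by (simp add: D_def)
  define L where "L = prime_harmonic z"
  obtain Y0 where Y0: "\<And>Y. Y \<ge> Y0 \<Longrightarrow> (\<Sum>a\<in>{a\<in>{1..Y}. real (omega_upto z a) \<le> 3 / 4 * L}. prime_ratio a)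
     \<le> 2 * exp (3 - L / 200) * real Y"
    using sum_prime_ratio_few_prime_factors_le[of z] unfolding L_def eventually_sequentially by blast
  have "\<forall>\<^sub>F X :: nat in sequentially. real X > 1 \<and> real Y0 + 1 \<le> \<beta> * sqrt (real X) \<and> D * (\<beta> * sqrt (real X)) \<le> real X \<and>
      real T0 \<le> real X / (D * (\<beta> * sqrt (real X))) \<and> ln (real X) / 4 \<le> ln (real X / (D * (\<beta> * sqrt (real X))))"
    using \<beta> D by (intro eventually_conj) real_asymp+
  then show ?thesis
  proof eventually_elim
    case (elim X)
    define S where "S = {p. prime p \<and> p \<le> X \<and> d + 1 < p \<and>
       (\<exists>a b. p - (d + 1) = d * (a * b) \<and> \<alpha> * sqrt (real X) \<le> real a \<and> real a \<le> \<beta> * sqrt (real X) \<and>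
          real (omega_upto z a) \<le> 3 / 4 * L)}"
    define Y where "Y = nat \<lfloor>\<beta> * sqrt (real X)\<rfloor>"
    have X1: "real X > 1" using elim by simp
    have sX: "sqrt (real X) > 0" using X1 by simp
    have lnX: "ln (real X) > 0" using X1 by simp
    have "Y0 \<le> Y" using elim unfolding Y_def by linarith
    have Yle: "real Y \<le> \<beta> * sqrt (real X)" unfolding Y_def using \<beta> sX by simp
    define I where "I = {a\<in>{1..Y}. real (omega_upto z a) \<le> 3 / 4 * L \<and> \<alpha> * sqrt (real X) \<le> real a}"
    define T where "T a = X div (d * a) + 1" for a
    define W where "W a = {t\<in>{..<T a}. prime (d * a * t + (d + 1))}" for a
    have "S \<subseteq> (\<Union>a\<in>I. (\<lambda>t. d * a * t + (d + 1)) ` W a)"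
    proof
      fix p assume "p \<in> S"
      then obtain a b where p: "prime p" "p \<le> X" "d + 1 < p" "p - (d + 1) = d * (a * b)"
        and a: "\<alpha> * sqrt (real X) \<le> real a" "real a \<le> \<beta> * sqrt (real X)" "real (omega_upto z a) \<le> 3 / 4 * L"
        by (auto simp: S_def)
      have "0 < \<alpha> * sqrt (real X)" using \<alpha> sX by simp
      then have "a > 0" using a(1) by (metis less_le_trans of_nat_0_less_iff)
      moreover have "a \<le> Y" using a(2) by (simp add: Y_def le_nat_floor)
      ultimately have "a \<in> I" using a by (simp add: I_def)
      have pe: "p = d * a * b + (d + 1)" using p(3,4) by (simp add: mult.assoc)
      then have "b * (d * a) \<le> X" using p(2) by (simp add: mult_ac)
      then have "b < T a" unfolding T_def using d \<open>a > 0\<close> by (simp add: less_Suc_eq_le less_eq_div_iff_mult_less_eq)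
      then have "b \<in> W a" using p(1) pe by (simp add: W_def)
      then show "p \<in> (\<Union>a\<in>I. (\<lambda>t. d * a * t + (d + 1)) ` W a)" using pe \<open>a \<in> I\<close> by blast
    qed
    moreover have finI: "finite I" by (simp add: I_def)
    moreover have finW: "finite (W a)" for a by (simp add: W_def)
    ultimately have "card S \<le> card (\<Union>a\<in>I. (\<lambda>t. d * a * t + (d + 1)) ` W a)"
      by (intro card_mono) auto
    also have "\<dots> \<le> (\<Sum>a\<in>I. card ((\<lambda>t. d * a * t + (d + 1)) ` W a))" by (rule card_UN_le[OF finI])
    also have "\<dots> \<le> (\<Sum>a\<in>I. card (W a))" by (intro sum_mono card_image_le finW)
    finally have "real (card S) \<le> (\<Sum>a\<in>I. real (card (W a)))" by (metis of_nat_le_iff of_nat_sum)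
    also have "\<dots> \<le> (\<Sum>a\<in>I. 72 * prime_ratio d / D * (real X / ln (real X)) / (\<alpha> * sqrt (real X)) * prime_ratio a)"
    proof (rule sum_mono)
      fix a assume a: "a \<in> I"
      have a0: "a > 0" "real a \<ge> \<alpha> * sqrt (real X)" using a by (auto simp: I_def)
      have a\<beta>: "real a \<le> \<beta> * sqrt (real X)" using a Yle by (auto simp: I_def intro: order_trans[of _ "real Y"])
      have Da: "D * real a \<le> D * (\<beta> * sqrt (real X))" using D a\<beta> by (intro mult_left_mono) auto
      have Da0: "0 < D * real a" using D a0 by simp
      have Teq: "real X / (D * real a) \<le> real (T a)" "real (T a) \<le> real X / (D * real a) + 1"
      proof -
        have "X < d * a * T a" unfolding T_def using d a0
          by (metis Suc_eq_plus1 add.commute dividend_less_times_div mult_Suc_right nat_0_less_mult_iff)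
        then have "real X < D * real a * real (T a)" unfolding D_def by (metis of_nat_less_iff of_nat_mult)
        then show "real X / (D * real a) \<le> real (T a)" using Da0 by (simp add: field_simps)
        show "real (T a) \<le> real X / (D * real a) + 1"
          unfolding T_def D_def using of_nat_div_le_of_nat[of X "d * a", where 'a = real] by simp
      qed
      have low: "real X / (D * (\<beta> * sqrt (real X))) \<le> real X / (D * real a)"
        using Da D \<beta> sX X1 a0 by (intro divide_left_mono mult_pos_pos) auto
      have "T a \<ge> T0" using elim low Teq by linarith
      have Tpos: "real X / (D * (\<beta> * sqrt (real X))) > 0" using X1 D \<beta> sX by simp
      have lnT: "ln (real X) / 4 \<le> ln (real (T a))"
      proof -
        have "real X / (D * (\<beta> * sqrt (real X))) \<le> real (T a)" using low Teq by linarith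
        then have "ln (real X / (D * (\<beta> * sqrt (real X)))) \<le> ln (real (T a))" using Tpos by (intro ln_mono) auto
        then show ?thesis using elim by linarith
      qed
      have "1 \<le> real X / (D * real a)" using Da Da0 elim by (simp add: field_simps)
      then have T2: "real (T a) \<le> 2 * (real X / (D * real a))" using Teq by linarith
      have h: "prime_ratio (d * a) \<le> prime_ratio d * prime_ratio a" using d a0 by (intro prime_ratio_mult_le) auto
      have h0: "prime_ratio d \<ge> 0" "prime_ratio a \<ge> 0" "prime_ratio (d * a) \<ge> 0"
        using prime_ratio_ge_1[of d] prime_ratio_ge_1[of a] prime_ratio_ge_1[of "d * a"] by linarith+
      have "real (card (W a)) \<le> 9 * prime_ratio (d * a) * real (T a) / ln (real (T a))"
        unfolding W_def using T0(2)[OF \<open>T a \<ge> T0\<close>, of "d * a" "d + 1"] d a0 by simp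
      also have "\<dots> \<le> 9 * (prime_ratio d * prime_ratio a) * (2 * (real X / (D * real a))) / (ln (real X) / 4)"
        using h h0 T2 lnT lnX Da0 X1 by (intro frac_le mult_mono) auto
      also have "\<dots> = 72 * prime_ratio d / D * (real X / ln (real X)) * prime_ratio a / real a"
        by (simp add: mult_ac)
      also have "\<dots> \<le> 72 * prime_ratio d / D * (real X / ln (real X)) * prime_ratio a / (\<alpha> * sqrt (real X))"
        using a0 h0 D lnX \<alpha> sX by (intro divide_left_mono mult_nonneg_nonneg mult_pos_pos divide_nonneg_nonneg) auto
      finally show "real (card (W a)) \<le> 72 * prime_ratio d / D * (real X / ln (real X)) / (\<alpha> * sqrt (real X)) * prime_ratio a"
        by (simp add: mult_ac)
    qed
    also have "\<dots> = 72 * prime_ratio d / D * (real X / ln (real X)) / (\<alpha> * sqrt (real X)) * (\<Sum>a\<in>I. prime_ratio a)"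
      by (simp only: sum_distrib_left)
    also have "\<dots> \<le> 72 * prime_ratio d / D * (real X / ln (real X)) / (\<alpha> * sqrt (real X)) * (2 * exp (3 - L / 200) * (\<beta> * sqrt (real X)))"
    proof (rule mult_left_mono)
      have "(\<Sum>a\<in>I. prime_ratio a) \<le> (\<Sum>a\<in>{a\<in>{1..Y}. real (omega_upto z a) \<le> 3 / 4 * L}. prime_ratio a)"
        using order_trans[OF zero_le_one prime_ratio_ge_1] by (intro sum_mono2) (auto simp: I_def)
      also have "\<dots> \<le> 2 * exp (3 - L / 200) * real Y" by (rule Y0[OF \<open>Y0 \<le> Y\<close>])
      also have "\<dots> \<le> 2 * exp (3 - L / 200) * (\<beta> * sqrt (real X))" using Yle by (intro mult_left_mono) auto
      finally show "(\<Sum>a\<in>I. prime_ratio a) \<le> 2 * exp (3 - L / 200) * (\<beta> * sqrt (real X))" .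
      show "0 \<le> 72 * prime_ratio d / D * (real X / ln (real X)) / (\<alpha> * sqrt (real X))"
        using prime_ratio_ge_1[of d] D lnX \<alpha> sX by simp
    qed
    also have "\<dots> = 144 * prime_ratio d / D * (\<beta> / \<alpha>) * exp (3 - L / 200) * (real X / ln (real X))"
      using sX by (simp add: mult_ac)
    finally show ?case unfolding S_def L_def D_def .
  qed
qed

text \<open>The order of the choices matters. First \<eta>, to discard p \<le> \<eta> X; then
  \<alpha>, since d a b \<ge> p / 2 and b \<le> C \<surd>p give a \<ge> \<surd>p / (2 d C) with p
  \<ge> \<eta> X; last z, large in terms of the constant \<open>M\<close>, which depends on
  \<alpha>.\<close>

theorem card_balanced_shifted_primes_le:
  fixes d :: nat and C \<epsilon> :: real
  assumes d: "d > 0" and C: "C > 0" and \<epsilon>: "\<epsilon> > 0"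
  shows "\<forall>\<^sub>F X in sequentially. real (card {p. prime p \<and> p \<le> X \<and> d + 1 < p \<and>
       (\<exists>a b. p - (d + 1) = d * (a * b) \<and> real a \<le> C * sqrt (real p) \<and> real b \<le> C * sqrt (real p))})
     \<le> \<epsilon> * (real X / ln (real X))"
proof -
  \<comment> \<open>Chosen so that the bound 18 * 2 \<eta> X / ln X for the primes up to \<eta> X is
    a quarter of the allowance.\<close>
  define \<eta> where "\<eta> = \<epsilon> / 144"
  have \<eta>: "\<eta> > 0" using \<epsilon> by (simp add: \<eta>_def)
  define \<alpha> where "\<alpha> = sqrt \<eta> / (2 * real d * C)"
  have \<alpha>: "\<alpha> > 0" using \<eta> C d by (simp add: \<alpha>_def)
  define M where "M = 144 * prime_ratio d / real d * (C / \<alpha>)"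
  have M: "M > 0" unfolding M_def using prime_ratio_ge_1[of d] d C \<alpha> by simp
  have "\<forall>\<^sub>F L in at_top. 18 * exp (5 / 4 - L / 25) \<le> \<epsilon> / 4 \<and> M * exp (3 - L / 200) \<le> \<epsilon> / 4"
    using \<epsilon> M by (intro eventually_conj) real_asymp+
  then obtain L0 where L0: "\<And>L. L \<ge> L0 \<Longrightarrow> 18 * exp (5 / 4 - L / 25) \<le> \<epsilon> / 4 \<and> M * exp (3 - L / 200) \<le> \<epsilon> / 4"
    by (auto simp: eventually_at_top_linorder)
  obtain z where z: "L0 \<le> prime_harmonic z" using prime_harmonic_unbounded by blast
  obtain X0 where X0: "\<And>X. X \<ge> X0 \<Longrightarrow> real (card {p. prime p \<and> p \<le> X \<and> d + 1 < p}) \<le> 18 * (real X / ln (real X))"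
    using card_primes_in_class_le[of 1 d] by (auto simp: eventually_sequentially prime_ratio_def)
  have "\<forall>\<^sub>F X :: nat in sequentially. real X > 1 \<and> \<eta> * real X \<ge> real X0 + 1 \<and> \<eta> * real X \<ge> 2 * (real d + 1) \<and> \<eta> * real X > 3 \<and>
      (\<eta> * real X) / ln (\<eta> * real X - 1) \<le> 2 * \<eta> * (real X / ln (real X))"
    using \<eta> by (intro eventually_conj) real_asymp+
  moreover note card_many_prime_factors_le[where d = d and z = z]
  moreover note card_primes_few_prime_factors_le[OF d \<alpha> C, where z = z]
  ultimately show ?thesis
  proof eventually_elim
    case (elim X)
    define S where "S = {p. prime p \<and> p \<le> X \<and> d + 1 < p \<and>
       (\<exists>a b. p - (d + 1) = d * (a * b) \<and> real a \<le> C * sqrt (real p) \<and> real b \<le> C * sqrt (real p))}"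
    define X' where "X' = nat \<lfloor>\<eta> * real X\<rfloor>"
    define S1 where "S1 = {p. prime p \<and> p \<le> X' \<and> d + 1 < p}"
    define S2 where "S2 = {p. prime p \<and> p \<le> X \<and> d + 1 < p \<and>
       (\<exists>a b. p - (d + 1) = d * (a * b) \<and> 3 / 2 * prime_harmonic z \<le> real (omega_upto z a + omega_upto z b))}"
    define S3 where "S3 = {p. prime p \<and> p \<le> X \<and> d + 1 < p \<and>
       (\<exists>a b. p - (d + 1) = d * (a * b) \<and> \<alpha> * sqrt (real X) \<le> real a \<and> real a \<le> C * sqrt (real X) \<and>
          real (omega_upto z a) \<le> 3 / 4 * prime_harmonic z)}"
    have q0: "real X / ln (real X) \<ge> 0" using elim(1) by simp
    have X': "real X' \<le> \<eta> * real X" "\<eta> * real X - 1 < real X'" unfolding X'_def using elim(1) by linarith+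
    have "X0 \<le> X'" using X' elim(1) by linarith
    have "real (card S1) \<le> 18 * (real X' / ln (real X'))" unfolding S1_def by (rule X0[OF \<open>X0 \<le> X'\<close>])
    also have "real X' / ln (real X') \<le> \<eta> * real X / ln (\<eta> * real X - 1)"
      using X' elim(1) by (intro frac_le) auto
    also have "\<dots> \<le> 2 * \<eta> * (real X / ln (real X))" using elim(1) by blast
    finally have c1: "real (card S1) \<le> \<epsilon> / 4 * (real X / ln (real X))" by (simp add: \<eta>_def)
    have "real (card S2) \<le> 18 * exp (5 / 4 - prime_harmonic z / 25) * (real X / ln (real X))"
      unfolding S2_def by (rule elim(2))
    also have "\<dots> \<le> \<epsilon> / 4 * (real X / ln (real X))"
      using L0[OF z] q0 by (intro mult_right_mono) auto
    finally have c2: "real (card S2) \<le> \<epsilon> / 4 * (real X / ln (real X))" .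
    have "real (card S3) \<le> M * exp (3 - prime_harmonic z / 200) * (real X / ln (real X))"
      unfolding S3_def M_def by (rule elim(3))
    also have "\<dots> \<le> \<epsilon> / 4 * (real X / ln (real X))"
      using L0[OF z] q0 by (intro mult_right_mono) auto
    finally have c3: "real (card S3) \<le> \<epsilon> / 4 * (real X / ln (real X))" .
    have sub: "S \<subseteq> S1 \<union> (S2 \<union> S3)"
    proof
      fix p assume p: "p \<in> S"
      then obtain a b where p': "prime p" "p \<le> X" "d + 1 < p" and ab: "p - (d + 1) = d * (a * b)"
        "real a \<le> C * sqrt (real p)" "real b \<le> C * sqrt (real p)"
        by (auto simp: S_def)
      show "p \<in> S1 \<union> (S2 \<union> S3)"
      proof (cases "p \<le> X'")
        case True
        then show ?thesis using p' by (simp add: S1_def)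
      next
        case False
        then have "real p \<ge> real X' + 1" by linarith
        then have p\<eta>: "real p \<ge> \<eta> * real X" using X' by linarith
        have sp: "sqrt (real p) > 0" using p' by simp
        have low: "\<alpha> * sqrt (real X) \<le> real a" if ab: "p - (d + 1) = d * (a * b)" "real b \<le> C * sqrt (real p)" for a b
        proof -
          have "real p - (real d + 1) = real d * (real a * real b)"
            using ab(1) p' by (metis Suc_eq_plus1 of_nat_1 of_nat_add of_nat_diff of_nat_mult less_imp_le_nat)
          moreover have "2 * (real d + 1) \<le> real p" using p\<eta> elim(1) by (auto intro: order_trans)
          then have "real p / 2 \<le> real p - (real d + 1)" by simp
          ultimately have "real p / 2 \<le> real d * (real a * real b)" by simp
          also have "\<dots> \<le> real d * (real a * (C * sqrt (real p)))" using ab(2) by (intro mult_left_mono) auto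
          finally have "sqrt (real p) * sqrt (real p) \<le> (2 * real d * C * real a) * sqrt (real p)"
            by (simp add: mult_ac)
          then have "sqrt (real p) \<le> 2 * real d * C * real a" using sp by (subst (asm) mult_le_cancel_right) auto
          moreover have "sqrt \<eta> * sqrt (real X) \<le> sqrt (real p)"
            using p\<eta> by (simp flip: real_sqrt_mult)
          ultimately have "sqrt \<eta> * sqrt (real X) \<le> real a * (2 * real d * C)" by (simp add: mult_ac)
          then show ?thesis unfolding \<alpha>_def using d C by (simp add: field_simps)
        qed
        have "C * sqrt (real p) \<le> C * sqrt (real X)" using p' C by simp
        then have up: "real a \<le> C * sqrt (real X)" "real b \<le> C * sqrt (real X)" using ab by linarith+
        have ba: "p - (d + 1) = d * (b * a)" using ab(1) by (simp add: mult.commute)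
        consider "3 / 2 * prime_harmonic z \<le> real (omega_upto z a + omega_upto z b)"
          | "real (omega_upto z a) \<le> 3 / 4 * prime_harmonic z" | "real (omega_upto z b) \<le> 3 / 4 * prime_harmonic z"
          unfolding of_nat_add by linarith
        then show ?thesis
        proof cases
          case 1
          then have "p \<in> S2" unfolding S2_def using p' ab(1) by blast
          then show ?thesis by blast
        next
          case 2
          then have "p \<in> S3" unfolding S3_def using p' ab(1) low[OF ab(1,3)] up(1) by blast
          then show ?thesis by blast
        next
          case 3
          then have "p \<in> S3" unfolding S3_def using p' ba low[OF ba ab(2)] up(2) by blast
          then show ?thesis by blast
        qed
      qed
    qed
    have "finite (S1 \<union> (S2 \<union> S3))"
      by (rule finite_subset[of _ "{..max X X'}"]) (auto simp: S1_def S2_def S3_def)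
    then have "card S \<le> card (S1 \<union> (S2 \<union> S3))" using sub by (rule card_mono)
    also have "\<dots> \<le> card S1 + (card S2 + card S3)"
      by (meson add_left_mono card_Un_le order_trans)
    finally have "real (card S) \<le> real (card S1) + (real (card S2) + real (card S3))" by linarith
    also have "\<dots> \<le> 3 * (\<epsilon> / 4 * (real X / ln (real X)))" using c1 c2 c3 by linarith
    also have "\<dots> \<le> \<epsilon> * (real X / ln (real X))" using mult_nonneg_nonneg[OF less_imp_le[OF \<epsilon>] q0] by linarith
    finally show ?case unfolding S_def .
  qed
qed

section \<open>Proof of the theorem\<close>

text \<open>With p - 1 = d n, the identity |A| |B| = n - 1 says that p - 1 - d = d |A| |B|. The size
  bound applies to both factors because decompositions are symmetric in A and B.\<close>

lemma decomposable_imp_balanced_factorization: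
  fixes d p :: nat
  assumes d: "d \<ge> 2" and p: "prime p" "[p = 1] (mod d)"
    and dec: "mult_decomposable p (shifted_dth_powers d p - {\<zero>\<^bsub>Fp p\<^esub>})"
    and big: "size_threshold d ^ 2 < p"
  shows "d + 1 < p \<and> (\<exists>a b. p - (d + 1) = d * (a * b) \<and>
    real a \<le> 512 * real (moment_const d) * sqrt (real p) \<and> real b \<le> 512 * real (moment_const d) * sqrt (real p))"
proof -
  interpret prime_modulus p by unfold_locales (rule p(1))
  define n where "n = (p - 1) div d"
  obtain A B where AB: "decomposes n A B" "card A \<ge> 2" "card B \<ge> 2"
    using mult_decomposable_imp_decomposes[OF p d dec] unfolding n_def by blast
  have p1: "p > 1" using p(1) prime_gt_1_nat by blast
  have nd: "n * d = p - 1"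
    using p(2) p1 unfolding n_def by (metis cong_altdef_nat cong_sym dvd_div_mult_self less_imp_le_nat)
  have "real (size_threshold d) ^ 2 < real p" using big by (metis of_nat_less_iff of_nat_power)
  then have big': "real (size_threshold d) < sqrt (real p)" by (rule real_less_rsqrt)
  have ne: "A \<noteq> {}" "B \<noteq> {}" using AB by auto
  have card: "card A * card B = n - 1" by (rule decomposes_card[OF nd d AB(1) ne])
  have "2 * 2 \<le> card A * card B" using AB by (intro mult_le_mono)
  then have "n = card A * card B + 1" using card by simp
  then have "d * (card A * card B) + d = p - 1"
    using nd by (simp add: algebra_simps)
  moreover have "0 < d * (card A * card B)" using AB d by simp
  ultimately have "d + 1 < p" "p - (d + 1) = d * (card A * card B)" using p1 by linarith+
  moreover have "real (card B) \<le> 512 * real (moment_const d) * sqrt (real p)"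
    using decomposes_card_bound[OF nd d AB big'] by simp
  moreover have "real (card A) \<le> 512 * real (moment_const d) * sqrt (real p)"
    using decomposes_card_bound[OF nd d decomposes_sym[OF AB(1)] AB(3,2) big'] by simp
  ultimately show ?thesis by blast
qed

theorem theorem6p1:
  fixes d :: nat
  assumes "d \<ge> 2"
  shows "(\<lambda>x :: real. real (card {p :: nat. prime p \<and> real p \<le> x \<and> [p = 1] (mod d) \<and>
             mult_decomposable p (shifted_dth_powers d p - {\<zero>\<^bsub>Fp p\<^esub>})}))
         \<in> o[at_top](\<lambda>x. real (prime_pi x))"
proof (rule landau_o.smallI)
  fix c :: real assume c: "c > 0"
  define Q where "Q p \<longleftrightarrow> [p = 1] (mod d) \<and> mult_decomposable p (shifted_dth_powers d p - {\<zero>\<^bsub>Fp p\<^esub>})" for p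
  define C where "C = 512 * real (moment_const d) + 1"
  define P0 where "P0 = size_threshold d ^ 2"
  have "C > 0" by (simp add: C_def)
  \<comment> \<open>One share c / 8 is for the sieve bound and one for the primes up to
    \<open>P0\<close>; Chebyshev's lower bound then costs a factor 4.\<close>
  have "d > 0" "c / 8 > 0" using assms c by auto
  have "\<forall>\<^sub>F X :: nat in sequentially. X \<ge> 12 \<and> real P0 + 1 \<le> c / 8 * (real X / ln (real X))"
    using c by (intro eventually_conj eventually_ge_at_top) real_asymp
  with card_balanced_shifted_primes_le[OF \<open>d > 0\<close> \<open>C > 0\<close> \<open>c / 8 > 0\<close>]
  have "\<forall>\<^sub>F X :: nat in sequentially. real (card {p. prime p \<and> p \<le> X \<and> Q p}) \<le> c * real (prime_pi (real X))"
  proof eventually_elim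
    case (elim X)
    let ?S = "{p. prime p \<and> p \<le> X \<and> d + 1 < p \<and>
       (\<exists>a b. p - (d + 1) = d * (a * b) \<and> real a \<le> C * sqrt (real p) \<and> real b \<le> C * sqrt (real p))}"
    have "{p. prime p \<and> p \<le> X \<and> Q p} \<subseteq> {..P0} \<union> ?S"
    proof
      fix p assume p: "p \<in> {p. prime p \<and> p \<le> X \<and> Q p}"
      show "p \<in> {..P0} \<union> ?S"
      proof (cases "p \<le> P0")
        case False
        then have "d + 1 < p \<and> (\<exists>a b. p - (d + 1) = d * (a * b) \<and>
            real a \<le> 512 * real (moment_const d) * sqrt (real p) \<and> real b \<le> 512 * real (moment_const d) * sqrt (real p))"
          using p by (intro decomposable_imp_balanced_factorization assms) (auto simp: Q_def P0_def)
        moreover have "512 * real (moment_const d) * sqrt (real p) \<le> C * sqrt (real p)"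
          by (intro mult_right_mono) (auto simp: C_def)
        ultimately have "d + 1 < p \<and> (\<exists>a b. p - (d + 1) = d * (a * b) \<and> real a \<le> C * sqrt (real p) \<and> real b \<le> C * sqrt (real p))"
          by (meson order_trans)
        then show ?thesis using p by blast
      qed simp
    qed
    moreover have "finite ?S" by (rule finite_subset[of _ "{..X}"]) auto
    ultimately have "card {p. prime p \<and> p \<le> X \<and> Q p} \<le> card ({..P0} \<union> ?S)"
      by (intro card_mono) auto
    also have "\<dots> \<le> card {..P0} + card ?S" by (rule card_Un_le)
    finally have "real (card {p. prime p \<and> p \<le> X \<and> Q p}) \<le> real P0 + 1 + real (card ?S)" by simp
    also have "\<dots> \<le> c / 8 * (real X / ln (real X)) + c / 8 * (real X / ln (real X))"
      using elim by (intro add_mono) auto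
    also have "\<dots> = c * (real X / (4 * ln (real X)))" by simp
    also have "\<dots> \<le> c * real (prime_pi (real X))"
      unfolding prime_pi_def using c elim(2) by (intro mult_left_mono chebyshev_lower_bound) auto
    finally show ?case .
  qed
  then have "\<forall>\<^sub>F x in at_top. real (card {p. prime p \<and> p \<le> nat \<lfloor>x\<rfloor> \<and> Q p}) \<le> c * real (prime_pi (real (nat \<lfloor>x\<rfloor>)))"
    using filterlim_compose[OF filterlim_nat_sequentially filterlim_floor_sequentially]
    by (rule eventually_compose_filterlim)
  with eventually_ge_at_top[of "0 :: real"]
  show "\<forall>\<^sub>F x in at_top. norm (real (card {p :: nat. prime p \<and> real p \<le> x \<and> [p = 1] (mod d) \<and>
             mult_decomposable p (shifted_dth_powers d p - {\<zero>\<^bsub>Fp p\<^esub>})})) \<le> c * norm (real (prime_pi x))"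
  proof eventually_elim
    case (elim x)
    \<comment> \<open>Both counts depend only on the integer part of x, so the bound along the
      integers suffices.\<close>
    have le: "real p \<le> x \<longleftrightarrow> p \<le> nat \<lfloor>x\<rfloor>" for p
      using elim(1) by (simp add: le_nat_iff le_floor_iff)
    have "prime_pi x = prime_pi (real (nat \<lfloor>x\<rfloor>))" unfolding prime_pi_def le by simp
    then show ?case using elim(2) unfolding le Q_def by simp
  qed
qed

end
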